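(* Let $X$ be a compact computable metric space with computable metric $d_X$, and let $f:X\to X$ be a computable (hence continuous) map with finite topological entropy such that $\mu\mapsto h_\mu(f)$ is upper semi-continuous on $\mathcal{M}$. Let $\Phi:X\to\mathbb{R}^m$ be computable. Suppose a computable function $r:\operatorname{int}\mathrm{Rot}(\Phi)\to\mathbb{R}^+$ is given such that $B(w,r(w))\subset\mathrm{Rot}(\Phi)$ for all $w\in\operatorname{int}\mathrm{Rot}(\Phi)$. Suppose that there exists an approximating sequence $(\Phi_{\epsilon_n})_n$ of $\Phi$ such that for all $n\in\mathbb{N}$ and all $v\in\mathbb{R}^m$ the potential $v\cdot\Phi_{\epsilon_n}$ has a unique equilibrium state $\mu_{v\cdot\Phi_{\epsilon_n}}$. Moreover, assume that the functions $n\mapsto\epsilon_n$, $(v,n)\mapsto h_{\mu_{v\cdot\Phi_{\epsilon_n}}}(f)$ and $(v,n)\mapsto\mathrm{rv}_{\Phi_{\epsilon_n}}(\mu_{v\cdot\Phi_{\epsilon_n}})$ (with $n\in\mathbb{N}$, $v\in\mathbb{R}^m$) are computable. Then the localized entropy function $\mathcal{H}_\Phi$ is computable on $\operatorname{int}\mathrm{Rot}(\Phi)$.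
   Context: Dynamics. $\mathcal{M}$ is the set of $f$-invariant Borel probability measures on $X$ with the weak$^*$ topology; $h_\mu(f)$ is the measure-theoretic entropy. For $\Psi\in C(X,\mathbb{R}^m)$, $\mathrm{rv}_\Psi(\mu)=\int\Psi\,d\mu\in\mathbb{R}^m$ (componentwise), $\mathrm{Rot}(\Psi)=\{\mathrm{rv}_\Psi(\mu):\mu\in\mathcal{M}\}$, and $\mathcal{H}_\Psi(w)=\sup\{h_\mu(f):\mu\in\mathcal{M},\ \mathrm{rv}_\Psi(\mu)=w\}$ for $w\in\mathrm{Rot}(\Psi)$. An approximating sequence of $\Phi$ is a sequence $\Phi_{\epsilon_n}\in C(X,\mathbb{R}^m)$ with $\epsilon_n\to0$ and $\|\Phi_{\epsilon_n}-\Phi\|_\infty<\epsilon_n$ for all $n$. For $v\in\mathbb{R}^m$, $v\cdot\Psi=v_1\Psi_1+\dots+v_m\Psi_m$. An equilibrium state of $\psi\in C(X,\mathbb{R})$ is a measure $\mu\in\mathcal{M}$ attaining $P_{\mathrm{top}}(\psi)=\sup_{\mu\in\mathcal{M}}\left(h_\mu(f)+\int\psi\,d\mu\right)$. $B(w,r)$ is the open Euclidean ball. Computability. A computable metric space is a separable metric space $(X,d_X)$ with a fixed dense sequence $(s_1,s_2,\dots)$ (an injective function $\mathbb{N}\to X$ with dense image); $\mathbb{R}^m$ carries (an enumeration of) $\mathbb{Q}^m$. An oracle for $\alpha\in X$ is a function $\phi:\mathbb{N}\to\mathbb{N}$ with $d_X(\alpha,s_{\phi(n)})<2^{-n}$ for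 all $n$ (for $\alpha\in\mathbb{R}^m$: $\phi(n)\in\mathbb{Q}^m$ with $\|\alpha-\phi(n)\|<2^{-n}$); $\alpha$ is computable if some Turing machine is an oracle for it. A function $g:S\to Y$ with $S\subset X$ and $Y$ a computable metric space with dense sequence $(t_i)$ is computable if there is an oracle Turing machine $\psi$ such that for every $\alpha\in S$, every oracle $\phi$ for $\alpha$ and every $n$, $d_Y(t_{\psi(\phi,n)},g(\alpha))<2^{-n}$. For functions of several arguments, each real or metric-space argument is given by an oracle and each natural-number argument is given exactly. *)

theory Defs
  imports "HOL-Probability.Probability"
begin

section \<open>Oracle Turing machines\<close>

text \<open>
  Deterministic multi-tape machines with two-way infinite tapes over the alphabet
  {blank, mark}.  A tape is a head position together with its contents.
\<close>

datatype symbol = Blank | Mark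

datatype direction = Go_Left | Stay | Go_Right

type_synonym tape = "int \<times> (int \<Rightarrow> symbol)"

text \<open>
  The states are the numbers below \<open>states\<close>, the initial state is 0, and every number outside this
  range is a halting state.  Since only states below \<open>states\<close> and symbol lists of length \<open>tapes\<close> are
  ever passed to \<open>delta\<close> and \<open>query\<close>, the machine is determined by a finite amount of data.
  In an ordinary state, \<open>delta\<close> maps the state and the scanned symbols of all tapes to the next
  state and, for each tape, the symbol to be written and the direction of the head.  In a query
  state, with \<open>query q = Some (j, t, q')\<close>, the number \<open>x\<close> on tape \<open>t\<close> is replaced in a single step
  by the answer of the \<open>j\<close>-th oracle to \<open>x\<close>, and the next state is \<open>q'\<close>.
\<close>

record oracle_machine =
  states :: nat
  tapes :: nat
  delta :: "nat \<Rightarrow> symbol list \<Rightarrow> nat \<times> (symbol \<times> direction) list"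
  query :: "nat \<Rightarrow> (nat \<times> nat \<times> nat) option"

definition scanned :: "tape \<Rightarrow> symbol" where
  "scanned T = snd T (fst T)"

fun act :: "symbol \<times> direction \<Rightarrow> tape \<Rightarrow> tape" where
  "act (s, d) (p, c) =
     ((case d of Go_Left \<Rightarrow> p - 1 | Stay \<Rightarrow> p | Go_Right \<Rightarrow> p + 1), c(p := s))"

text \<open>
  Numbers are written in unary: they are placed on a tape as a block of marks starting at
  cell 0, and the number read off a tape is the number of its marked cells.
\<close>

definition unary_tape :: "nat \<Rightarrow> tape" where
  "unary_tape n = (0, \<lambda>p. if 0 \<le> p \<and> p < int n then Mark else Blank)"

definition tape_value :: "tape \<Rightarrow> nat" where
  "tape_value T = card {p. snd T p = Mark}"

definition ask :: "(nat \<Rightarrow> nat) list \<Rightarrow> nat \<Rightarrow> nat \<Rightarrow> nat" where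
  "ask \<phi>s j x = (if j < length \<phi>s then (\<phi>s ! j) x else 0)"

fun machine_step ::
  "oracle_machine \<Rightarrow> (nat \<Rightarrow> nat) list \<Rightarrow> nat \<times> (nat \<Rightarrow> tape) \<Rightarrow> nat \<times> (nat \<Rightarrow> tape)" where
  "machine_step M \<phi>s (q, T) =
     (if q \<ge> states M then (q, T)
      else case query M q of
        Some (j, t, q') \<Rightarrow> (q', T(t := unary_tape (ask \<phi>s j (tape_value (T t)))))
      | None \<Rightarrow>
          (let (q', as) = delta M q (map (\<lambda>i. scanned (T i)) [0..<tapes M])
           in (q', \<lambda>i. if i < tapes M then act (as ! i) (T i) else T i)))"

text \<open>The inputs are placed on the first tapes, and the output is read off tape 0.\<close>

definition initial_config :: "nat list \<Rightarrow> nat \<times> (nat \<Rightarrow> tape)" where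
  "initial_config ns = (0, \<lambda>i. unary_tape (if i < length ns then ns ! i else 0))"

definition machine_output ::
  "oracle_machine \<Rightarrow> (nat \<Rightarrow> nat) list \<Rightarrow> nat list \<Rightarrow> nat \<Rightarrow> bool" where
  "machine_output M \<phi>s ns y \<longleftrightarrow>
     (\<exists>k q T. (machine_step M \<phi>s ^^ k) (initial_config ns) = (q, T) \<and>
        q \<ge> states M \<and> tape_value (T 0) = y)"

section \<open>Computable metric spaces and computable functions\<close>

definition computable_metric_space :: "(nat \<Rightarrow> 'a::metric_space) \<Rightarrow> bool" where
  "computable_metric_space s \<longleftrightarrow> inj s \<and> closure (range s) = UNIV"

definition oracle_for :: "(nat \<Rightarrow> 'a::metric_space) \<Rightarrow> 'a \<Rightarrow> (nat \<Rightarrow> nat) \<Rightarrow> bool" where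
  "oracle_for s x \<phi> \<longleftrightarrow> (\<forall>n. dist x (s (\<phi> n)) < (1/2) ^ n)"

text \<open>
  An injective enumeration is obtained from a surjective one by listing, in increasing order,
  the codes that are the least codes of their values.
\<close>

definition without_repetition :: "(nat \<Rightarrow> 'a) \<Rightarrow> nat \<Rightarrow> 'a" where
  "without_repetition D n = D (enumerate {c. \<forall>b<c. D b \<noteq> D c} n)"

lemma
  assumes "infinite (range D)"
  shows inj_without_repetition: "inj (without_repetition D)"
    and range_without_repetition: "range (without_repetition D) = range D"
proof -
  let ?S = "{c. \<forall>b<c. D b \<noteq> D c}"
  have "D c \<in> D ` ?S" for c
  proof -
    define l where "l = (LEAST b. D b = D c)"
    have l: "D l = D c" unfolding l_def by (rule LeastI) (rule refl)
    have "D b \<noteq> D l" if "b < l" for b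
      using not_less_Least[of b "\<lambda>b. D b = D c"] that l by (simp add: l_def)
    then have "l \<in> ?S" by simp
    with l show ?thesis by (intro image_eqI[of _ _ l]) simp_all
  qed
  then have img: "D ` ?S = range D" by (intro subset_antisym image_mono image_subsetI) simp_all
  have inf: "infinite ?S"
  proof
    assume "finite ?S"
    then have "finite (D ` ?S)" by (rule finite_imageI)
    with assms show False by (simp only: img)
  qed
  have "inj_on D ?S"
  proof (rule inj_onI)
    fix a b assume "a \<in> ?S" "b \<in> ?S" "D a = D b"
    then show "a = b" by (auto intro: linorder_neqE_nat[of a b])
  qed
  moreover have "inj (enumerate ?S)" by (rule inj_enumerate[OF inf])
  ultimately have "inj (D \<circ> enumerate ?S)" by (intro comp_inj_on) (simp_all only: range_enumerate[OF inf])
  moreover have eq: "without_repetition D = D \<circ> enumerate ?S"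
    by (rule ext) (simp add: without_repetition_def)
  ultimately show "inj (without_repetition D)" by simp
  have "range (without_repetition D) = D ` range (enumerate ?S)"
    unfolding eq by (rule image_comp[symmetric])
  then show "range (without_repetition D) = range D"
    by (simp only: range_enumerate[OF inf] img)
qed

definition rat_enum :: "nat \<Rightarrow> real" where
  "rat_enum = without_repetition (\<lambda>c. of_rat (nat_to_rat_surj c))"

text \<open>
  A code of a vector in $\mathbb{Q}^m$ is a nested pair of codes of its components, where the
  indices are numbered by \<open>to_nat_on UNIV :: 'm \<Rightarrow> nat\<close>, a bijection onto \<open>{..<m}\<close>.
\<close>

definition rat_vec_decode :: "nat \<Rightarrow> real ^ 'm::finite" where
  "rat_vec_decode c =
     (\<chi> i. of_rat (nat_to_rat_surj
        (fst (prod_decode (((snd \<circ> prod_decode) ^^ to_nat_on (UNIV :: 'm set) i) c)))))"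

definition rat_vec_enum :: "nat \<Rightarrow> real ^ 'm::finite" where
  "rat_vec_enum = without_repetition rat_vec_decode"

lemma inj_rat_enum: "inj rat_enum" and range_rat_enum: "range rat_enum = \<rat>"
proof -
  have R: "range (\<lambda>c. real_of_rat (nat_to_rat_surj c)) = \<rat>"
    by (rule Rats_eq_range_of_rat_o_nat_to_rat_surj[unfolded comp_def, symmetric])
  have "infinite (\<rat> :: real set)"
    using Rats_infinite by blast
  then have I: "infinite (range (\<lambda>c. real_of_rat (nat_to_rat_surj c)))" by (simp add: R)
  show "inj rat_enum" "range rat_enum = \<rat>"
    unfolding rat_enum_def by (simp_all only: inj_without_repetition[OF I] range_without_repetition[OF I] R)
qed

lemma inj_rat_vec_enum: "inj (rat_vec_enum :: nat \<Rightarrow> real ^ 'm::finite)"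
  and range_rat_vec_enum: "range (rat_vec_enum :: nat \<Rightarrow> real ^ 'm) = {v. \<forall>i. v $ i \<in> \<rat>}"
proof -
  have cod: "\<exists>c. \<forall>j<k. fst (prod_decode (((snd \<circ> prod_decode) ^^ j) c)) = a j" for k and a :: "nat \<Rightarrow> nat"
  proof (induction k arbitrary: a)
    case (Suc k)
    from Suc[of "\<lambda>j. a (Suc j)"] obtain c
      where c: "fst (prod_decode (((snd \<circ> prod_decode) ^^ j) c)) = a (Suc j)" if "j < k" for j
      by blast
    have "fst (prod_decode (((snd \<circ> prod_decode) ^^ j) (prod_encode (a 0, c)))) = a j"
      if "j < Suc k" for j
      using that c[of "j - 1"] by (cases j) (simp_all add: funpow_Suc_right del: funpow.simps(2))
    then show ?case by blast
  qed simp
  have "\<exists>c. rat_vec_decode c = v" if "\<forall>i. v $ i \<in> \<rat>" for v :: "real ^ 'm"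
  proof -
    let ?e = "to_nat_on (UNIV :: 'm set)"
    have e: "inj ?e" "?e i < CARD('m)" for i
      using to_nat_on_finite[of "UNIV :: 'm set"] by (auto simp: bij_betw_def)
    have "\<exists>n. real_of_rat (nat_to_rat_surj n) = v $ i" for i
      using that surj_nat_to_rat_surj by (metis Rats_cases surjD)
    then obtain a where a: "real_of_rat (nat_to_rat_surj (a i)) = v $ i" for i by metis
    obtain c where "\<forall>j<CARD('m). fst (prod_decode (((snd \<circ> prod_decode) ^^ j) c)) = a (inv ?e j)"
      using cod[of "CARD('m)" "\<lambda>j. a (inv ?e j)"] by blast
    then have "rat_vec_decode c = v"
      using e by (simp add: rat_vec_decode_def vec_eq_iff a)
    then show ?thesis ..
  qed
  moreover have "rat_vec_decode c $ i \<in> \<rat>" for c and i :: 'm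
    by (simp add: rat_vec_decode_def)
  ultimately have R: "range rat_vec_decode = {v :: real ^ 'm. \<forall>i. v $ i \<in> \<rat>}"
    by blast
  have "inj (\<lambda>n. (\<chi> i. real n) :: real ^ 'm)"
    by (rule injI) (simp add: vec_eq_iff)
  then have "infinite (range (\<lambda>n. (\<chi> i. real n) :: real ^ 'm))"
    by (simp add: finite_image_iff)
  moreover have "range (\<lambda>n. (\<chi> i. real n) :: real ^ 'm) \<subseteq> range rat_vec_decode"
    unfolding R by auto
  ultimately have I: "infinite (range (rat_vec_decode :: nat \<Rightarrow> real ^ 'm))"
    using finite_subset by blast
  show "inj (rat_vec_enum :: nat \<Rightarrow> real ^ 'm)"
    "range (rat_vec_enum :: nat \<Rightarrow> real ^ 'm) = {v. \<forall>i. v $ i \<in> \<rat>}"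
    unfolding rat_vec_enum_def
    by (simp_all only: inj_without_repetition[OF I] range_without_repetition[OF I] R)
qed

text \<open>
  With oracles \<open>\<phi>s\<close> and exact inputs \<open>ns\<close>, \<open>M\<close> approximates \<open>y\<close> to every precision \<open>2\<^sup>-\<^sup>k\<close>, the
  number \<open>k\<close> being its last input.
\<close>

definition approximates ::
  "oracle_machine \<Rightarrow> (nat \<Rightarrow> nat) list \<Rightarrow> nat list \<Rightarrow> (nat \<Rightarrow> 'b::metric_space) \<Rightarrow> 'b \<Rightarrow> bool" where
  "approximates M \<phi>s ns t y \<longleftrightarrow>
     (\<forall>k. \<exists>i. machine_output M \<phi>s (ns @ [k]) i \<and> dist (t i) y < (1/2) ^ k)"

definition computable_on ::
  "(nat \<Rightarrow> 'a::metric_space) \<Rightarrow> (nat \<Rightarrow> 'b::metric_space) \<Rightarrow> 'a set \<Rightarrow> ('a \<Rightarrow> 'b) \<Rightarrow> bool" where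
  "computable_on s t S g \<longleftrightarrow>
     (\<exists>M. \<forall>x\<in>S. \<forall>\<phi>. oracle_for s x \<phi> \<longrightarrow> approximates M [\<phi>] [] t (g x))"

definition computable_sequence ::
  "(nat \<Rightarrow> 'b::metric_space) \<Rightarrow> (nat \<Rightarrow> 'b) \<Rightarrow> bool" where
  "computable_sequence t g \<longleftrightarrow> (\<exists>M. \<forall>n. approximates M [] [n] t (g n))"

definition computable_function_sequence ::
  "(nat \<Rightarrow> 'a::metric_space) \<Rightarrow> (nat \<Rightarrow> 'b::metric_space) \<Rightarrow> ('a \<Rightarrow> nat \<Rightarrow> 'b) \<Rightarrow> bool" where
  "computable_function_sequence s t g \<longleftrightarrow>
     (\<exists>M. \<forall>x n \<phi>. oracle_for s x \<phi> \<longrightarrow> approximates M [\<phi>] [n] t (g x n))"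

definition computable_metric :: "(nat \<Rightarrow> 'a::metric_space) \<Rightarrow> bool" where
  "computable_metric s \<longleftrightarrow>
     (\<exists>M. \<forall>x y \<phi> \<psi>. oracle_for s x \<phi> \<longrightarrow> oracle_for s y \<psi> \<longrightarrow>
        approximates M [\<phi>, \<psi>] [] rat_enum (dist x y))"

section \<open>Invariant measures and entropy\<close>

definition invariant_measures :: "('a::metric_space \<Rightarrow> 'a) \<Rightarrow> 'a measure set" where
  "invariant_measures f =
     {\<mu>. prob_space \<mu> \<and> sets \<mu> = sets borel \<and>
         (\<forall>A\<in>sets borel. emeasure \<mu> (f -` A) = emeasure \<mu> A)}"

text \<open>
  The coarsest topology making all \<open>\<mu> \<mapsto> \<integral> g d\<mu>\<close> with \<open>g\<close> continuous continuous (the underlying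
  space is compact where this is used).
\<close>

definition weak_star_topology :: "('a::metric_space \<Rightarrow> 'a) \<Rightarrow> 'a measure topology" where
  "weak_star_topology f =
     topology_generated_by
       {{\<mu> \<in> invariant_measures f. (\<integral>x. g x \<partial>\<mu>) \<in> U} | (g :: 'a \<Rightarrow> real) U.
          continuous_on UNIV g \<and> open U}"

definition upper_semicontinuous_map :: "'b topology \<Rightarrow> ('b \<Rightarrow> ereal) \<Rightarrow> bool" where
  "upper_semicontinuous_map T h \<longleftrightarrow> (\<forall>c. openin T {x \<in> topspace T. h x < c})"

definition partition_entropy :: "'a measure \<Rightarrow> 'a set set \<Rightarrow> real" where
  "partition_entropy \<mu> P = - (\<Sum>A\<in>P. measure \<mu> A * ln (measure \<mu> A))"

definition dynamical_refinement :: "('a \<Rightarrow> 'a) \<Rightarrow> 'a set set \<Rightarrow> nat \<Rightarrow> 'a set set" where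
  "dynamical_refinement f P n = common_refinement ((\<lambda>i. (\<lambda>A. (f ^^ i) -` A) ` P) ` {..<n})"

definition metric_entropy_partition :: "'a measure \<Rightarrow> ('a \<Rightarrow> 'a) \<Rightarrow> 'a set set \<Rightarrow> real" where
  "metric_entropy_partition \<mu> f P =
     lim (\<lambda>n. partition_entropy \<mu> (dynamical_refinement f P n) / real n)"

definition metric_entropy :: "('a \<Rightarrow> 'a) \<Rightarrow> 'a measure \<Rightarrow> ereal" where
  "metric_entropy f \<mu> =
     (SUP P\<in>{P. finite P \<and> partition_on (space \<mu>) P \<and> P \<subseteq> sets \<mu>}.
        ereal (metric_entropy_partition \<mu> f P))"

text \<open>Bowen's definition of topological entropy by \<open>(n, \<delta>)\<close>-separated sets.\<close>

definition separated :: "('a::metric_space \<Rightarrow> 'a) \<Rightarrow> nat \<Rightarrow> real \<Rightarrow> 'a set \<Rightarrow> bool" where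
  "separated f n \<delta> E \<longleftrightarrow>
     (\<forall>x\<in>E. \<forall>y\<in>E. x \<noteq> y \<longrightarrow> (\<exists>i<n. dist ((f ^^ i) x) ((f ^^ i) y) > \<delta>))"

definition topological_entropy :: "('a::metric_space \<Rightarrow> 'a) \<Rightarrow> ereal" where
  "topological_entropy f =
     (SUP \<delta>\<in>{0<..}. limsup (\<lambda>n.
        SUP E\<in>{E. finite E \<and> separated f n \<delta> E}. ereal (ln (real (card E)) / real n)))"

section \<open>Equilibrium states, rotation sets and localized entropy\<close>

definition topological_pressure :: "('a::metric_space \<Rightarrow> 'a) \<Rightarrow> ('a \<Rightarrow> real) \<Rightarrow> ereal" where
  "topological_pressure f \<psi> =
     (SUP \<mu>\<in>invariant_measures f. metric_entropy f \<mu> + ereal (\<integral>x. \<psi> x \<partial>\<mu>))"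

definition equilibrium_state ::
  "('a::metric_space \<Rightarrow> 'a) \<Rightarrow> ('a \<Rightarrow> real) \<Rightarrow> 'a measure \<Rightarrow> bool" where
  "equilibrium_state f \<psi> \<mu> \<longleftrightarrow>
     \<mu> \<in> invariant_measures f \<and>
     metric_entropy f \<mu> + ereal (\<integral>x. \<psi> x \<partial>\<mu>) = topological_pressure f \<psi>"

definition the_equilibrium_state ::
  "('a::metric_space \<Rightarrow> 'a) \<Rightarrow> ('a \<Rightarrow> real) \<Rightarrow> 'a measure" where
  "the_equilibrium_state f \<psi> = (THE \<mu>. equilibrium_state f \<psi> \<mu>)"

definition rotation_vector :: "('a \<Rightarrow> real ^ 'm::finite) \<Rightarrow> 'a measure \<Rightarrow> real ^ 'm" where
  "rotation_vector \<Psi> \<mu> = (\<chi> i. \<integral>x. \<Psi> x $ i \<partial>\<mu>)"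

definition rotation_set ::
  "('a::metric_space \<Rightarrow> 'a) \<Rightarrow> ('a \<Rightarrow> real ^ 'm::finite) \<Rightarrow> (real ^ 'm) set" where
  "rotation_set f \<Psi> = rotation_vector \<Psi> ` invariant_measures f"

definition localized_entropy ::
  "('a::metric_space \<Rightarrow> 'a) \<Rightarrow> ('a \<Rightarrow> real ^ 'm::finite) \<Rightarrow> real ^ 'm \<Rightarrow> ereal" where
  "localized_entropy f \<Psi> w =
     (SUP \<mu>\<in>{\<mu> \<in> invariant_measures f. rotation_vector \<Psi> \<mu> = w}. metric_entropy f \<mu>)"

definition approximating_sequence ::
  "('a::metric_space \<Rightarrow> real ^ 'm::finite) \<Rightarrow> (nat \<Rightarrow> real) \<Rightarrow> (nat \<Rightarrow> 'a \<Rightarrow> real ^ 'm) \<Rightarrow> bool" where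
  "approximating_sequence \<Phi> \<epsilon> \<Phi>s \<longleftrightarrow>
     \<epsilon> \<longlonglongrightarrow> 0 \<and>
     (\<forall>n. continuous_on UNIV (\<Phi>s n)) \<and>
     (\<forall>n. (SUP x. norm (\<Phi>s n x - \<Phi> x)) < \<epsilon> n)"

end

theory Submission
  imports Defs
begin

text \<open>
  Let \<open>h v n\<close> and \<open>R v n\<close> be the entropy and the rotation vector of the equilibrium state of
  \<open>v \<bullet> \<Phi>s n\<close>.  The variational inequality at that state gives, for every \<open>v\<close> and \<open>n\<close>, the upper bound
  \<open>H w \<le> h v n + |v| d\<close> with \<open>d = |R v n - w| + \<epsilon> n\<close>.  For a lower bound, mix the state with a measure
  whose rotation vector lies on the other side of \<open>w\<close> at distance \<open>\<rho> < r w\<close>: since the entropy of a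
  mixture dominates the weighted entropy of each part, \<open>H w \<ge> \<rho> / (\<rho> + d) h v n\<close>.  The two bounds
  become arbitrarily close, because the convex function \<open>h v n + v \<bullet> (R v n - w)\<close> of \<open>v\<close> has a minimiser,
  bounded independently of \<open>n\<close>, at which \<open>R v n = w\<close>; the continuity of \<open>R\<close> needed here holds because a
  computable function is continuous.  So a search over rational \<open>v\<close>, over \<open>n\<close> and over the precision of
  the given approximations ends, and its result approximates \<open>H w\<close>.

  To see that a Turing machine can carry out the search, structured programs on tapes are compiled to
  machines.  A given machine can be run inside such a program with its queries answered by a subroutine,
  and the functionals computed by programs are closed under iteration and unbounded search.
\<close>

section \<open>Structured programs on tapes\<close>

text \<open>Equality of real numbers cannot be tested, so the exact solution
  \<open>R v n = w\<close> is not what the search looks for: it only guarantees that an open set of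
  directions, hence a rational one, meets strict inequalities that approximations can confirm. For
  this the solutions must stay bounded as \<open>n\<close> grows. They do, since the ball of radius
  \<open>r w\<close> in the rotation set forces growth of at least \<open>r w / 4\<close> times
  \<open>norm v\<close> for large \<open>n\<close>, and since \<open>h 0 n\<close>, the maximal
  entropy, does not depend on \<open>n\<close>. A rational vector is named exactly by a constant
  oracle, so in the search the machines for \<open>h\<close> and \<open>R\<close> run with every
  query answered by one register. Sums of absolute values stand in for Euclidean norms, because they
  keep all tested quantities rational. On the machine side the difficulty is that outputs and
  queries count all marks of a tape, wherever they lie and wherever the head is. A simulation
  therefore carries the count along instead of scanning, and a tape is cleared by asking an oracle
  that does not exist.\<close>

datatype prog =
    Act nat symbol direction
  | Query nat nat
  | Skip
  | Seq prog prog (infixl ";;" 60)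
  | If_Mark nat prog prog
  | While_Mark nat prog

inductive exec :: "(nat \<Rightarrow> nat) list \<Rightarrow> prog \<Rightarrow> (nat \<Rightarrow> tape) \<Rightarrow> (nat \<Rightarrow> tape) \<Rightarrow> bool" for \<phi>s where
  Act: "exec \<phi>s (Act t s d) T (T(t := act (s, d) (T t)))"
| Query: "exec \<phi>s (Query j t) T (T(t := unary_tape (ask \<phi>s j (tape_value (T t)))))"
| Skip: "exec \<phi>s Skip T T"
| Seq: "exec \<phi>s p T T' \<Longrightarrow> exec \<phi>s q T' T'' \<Longrightarrow> exec \<phi>s (p ;; q) T T''"
| If_Mark: "scanned (T t) = Mark \<Longrightarrow> exec \<phi>s p T T' \<Longrightarrow> exec \<phi>s (If_Mark t p q) T T'"
| If_Blank: "scanned (T t) = Blank \<Longrightarrow> exec \<phi>s q T T' \<Longrightarrow> exec \<phi>s (If_Mark t p q) T T'"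
| While_Blank: "scanned (T t) = Blank \<Longrightarrow> exec \<phi>s (While_Mark t p) T T"
| While_Mark: "scanned (T t) = Mark \<Longrightarrow> exec \<phi>s p T T' \<Longrightarrow> exec \<phi>s (While_Mark t p) T' T'' \<Longrightarrow>
    exec \<phi>s (While_Mark t p) T T''"

section \<open>Flat code with absolute jumps\<close>

datatype instr = Do nat symbol direction | Call nat nat | Jump nat nat nat

fun tape_of :: "instr \<Rightarrow> nat" where
  "tape_of (Do t s d) = t"
| "tape_of (Call j t) = t"
| "tape_of (Jump t a b) = t"

text \<open>Jump targets are absolute, so the length of a branch or of a loop body must be known
  before it is compiled.\<close>

fun code_length :: "prog \<Rightarrow> nat" where
  "code_length (Act t s d) = 1"
| "code_length (Query j t) = 1"
| "code_length Skip = 0"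
| "code_length (p ;; q) = code_length p + code_length q"
| "code_length (If_Mark t p q) = code_length p + code_length q + 2"
| "code_length (While_Mark t p) = code_length p + 2"

text \<open>The second argument is the address at which the code is placed.\<close>

fun compile :: "prog \<Rightarrow> nat \<Rightarrow> instr list" where
  "compile (Act t s d) a = [Do t s d]"
| "compile (Query j t) a = [Call j t]"
| "compile Skip a = []"
| "compile (p ;; q) a = compile p a @ compile q (a + code_length p)"
| "compile (If_Mark t p q) a =
     Jump t (a + 1) (a + code_length p + 2) # compile p (a + 1) @
     Jump t (a + code_length p + code_length q + 2) (a + code_length p + code_length q + 2) #
     compile q (a + code_length p + 2)"
| "compile (While_Mark t p) a =
     Jump t (a + 1) (a + code_length p + 2) # compile p (a + 1) @ [Jump t a a]"

lemma length_compile: "length (compile p a) = code_length p"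
  by (induction p arbitrary: a) auto

text \<open>The state is the address of the next instruction, so running off the end of the code is
  halting. A jump writes back the scanned symbols and leaves all tapes as they are; with two equal
  targets it is unconditional.\<close>

definition machine_of :: "instr list \<Rightarrow> nat \<Rightarrow> oracle_machine" where
  "machine_of c m =
     \<lparr>states = length c, tapes = m,
      delta = (\<lambda>q xs. case c ! q of
          Do t s d \<Rightarrow> (Suc q, map (\<lambda>i. if i = t then (s, d) else (xs ! i, Stay)) [0..<m])
        | Call j t \<Rightarrow> (Suc q, [])
        | Jump t a b \<Rightarrow> (if xs ! t = Mark then a else b, map (\<lambda>i. (xs ! i, Stay)) [0..<m])),
      query = (\<lambda>q. case c ! q of Call j t \<Rightarrow> Some (j, t, Suc q) | _ \<Rightarrow> None)\<rparr>"

lemma act_scanned_Stay: "act (scanned T, Stay) T = T"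
  by (cases T) (simp add: scanned_def)

lemma machine_of_step:
  assumes "q < length c" "tape_of (c ! q) < m"
  shows "machine_step (machine_of c m) \<phi>s (q, T) =
    (case c ! q of
       Do t s d \<Rightarrow> (Suc q, T(t := act (s, d) (T t)))
     | Call j t \<Rightarrow> (Suc q, T(t := unary_tape (ask \<phi>s j (tape_value (T t)))))
     | Jump t a b \<Rightarrow> (if scanned (T t) = Mark then a else b, T))"
  using assms
  by (cases "c ! q") (auto simp: machine_of_def fun_eq_iff act_scanned_Stay)

definition code_at :: "instr list \<Rightarrow> nat \<Rightarrow> instr list \<Rightarrow> bool" where
  "code_at c a d \<longleftrightarrow> (\<forall>i<length d. a + i < length c \<and> c ! (a + i) = d ! i)"

lemma code_at_Nil: "code_at c a []"
  by (simp add: code_at_def)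

lemma code_at_Cons: "code_at c a (x # d) \<longleftrightarrow> a < length c \<and> c ! a = x \<and> code_at c (Suc a) d"
  by (auto simp: code_at_def less_Suc_eq_0_disj)

lemma code_at_append: "code_at c a (d @ e) \<longleftrightarrow> code_at c a d \<and> code_at c (a + length d) e"
proof (induction d arbitrary: a)
  case Nil
  then show ?case by (simp add: code_at_Nil)
next
  case (Cons x d)
  then show ?case by (simp add: code_at_Cons)
qed

definition reaches :: "oracle_machine \<Rightarrow> (nat \<Rightarrow> nat) list \<Rightarrow> nat \<times> (nat \<Rightarrow> tape) \<Rightarrow> nat \<times> (nat \<Rightarrow> tape) \<Rightarrow> bool"
  where "reaches M \<phi>s x y \<longleftrightarrow> (\<exists>k. (machine_step M \<phi>s ^^ k) x = y)"

lemma reaches_refl: "reaches M \<phi>s x x"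
  unfolding reaches_def by (rule exI[of _ 0]) simp

lemma reaches_trans: "reaches M \<phi>s x y \<Longrightarrow> reaches M \<phi>s y z \<Longrightarrow> reaches M \<phi>s x z"
  unfolding reaches_def by (metis funpow_add comp_apply)

lemma reaches_step: "machine_step M \<phi>s x = y \<Longrightarrow> reaches M \<phi>s x y"
  unfolding reaches_def by (rule exI[of _ 1]) simp

text \<open>The code sits inside a longer list, since a subprogram must work wherever it is placed.
  A loop ends with a jump back to its own address \<open>a\<close>, so the hypothesis for the
  remaining rounds applies to the same piece of code.\<close>

lemma compile_correct:
  assumes "exec \<phi>s p T T'"
    and "code_at c a (compile p a)" and "\<forall>x\<in>set c. tape_of x < m"
  shows "reaches (machine_of c m) \<phi>s (a, T) (a + code_length p, T')"
  using assms
proof (induction arbitrary: a rule: exec.induct)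
  case (Act t s d T)
  then have at: "a < length c" "c ! a = Do t s d"
    by (simp_all add: code_at_Cons)
  then have "tape_of (c ! a) < m"
    using Act.prems(2) nth_mem by blast
  with at show ?case
    by (intro reaches_step) (subst machine_of_step, auto)
next
  case (Query j t T)
  then have at: "a < length c" "c ! a = Call j t"
    by (simp_all add: code_at_Cons)
  then have "tape_of (c ! a) < m"
    using Query.prems(2) nth_mem by blast
  with at show ?case
    by (intro reaches_step) (subst machine_of_step, auto)
next
  case (Skip T)
  then show ?case by (simp add: reaches_refl)
next
  case (Seq p T T' q T'')
  then have "reaches (machine_of c m) \<phi>s (a, T) (a + code_length p, T')"
    "reaches (machine_of c m) \<phi>s (a + code_length p, T') (a + code_length p + code_length q, T'')"
    by (auto simp: code_at_append length_compile)
  then show ?case by (auto intro: reaches_trans simp: add.assoc)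
next
  case (If_Mark T t p T' q)
  let ?e = "a + code_length p + code_length q + 2"
  from If_Mark.prems have at: "a < length c" "c ! a = Jump t (a + 1) (a + code_length p + 2)"
    "code_at c (a + 1) (compile p (a + 1))" "a + 1 + code_length p < length c"
    "c ! (a + 1 + code_length p) = Jump t ?e ?e"
    by (simp_all add: code_at_Cons code_at_append length_compile)
  have t: "tape_of (c ! i) < m" if "i < length c" for i
    using that If_Mark.prems(2) by auto
  have "reaches (machine_of c m) \<phi>s (a, T) (a + 1, T)"
    by (rule reaches_step) (subst machine_of_step[OF at(1) t[OF at(1)]], simp add: at If_Mark.hyps)
  moreover have "reaches (machine_of c m) \<phi>s (a + 1, T) (a + 1 + code_length p, T')"
    by (rule If_Mark.IH[OF at(3) If_Mark.prems(2)])
  moreover have "reaches (machine_of c m) \<phi>s (a + 1 + code_length p, T') (?e, T')"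
    by (rule reaches_step) (subst machine_of_step[OF at(4) t[OF at(4)]], simp add: at del: One_nat_def)
  ultimately have "reaches (machine_of c m) \<phi>s (a, T) (?e, T')"
    by (blast intro: reaches_trans)
  then show ?case by (simp add: add.assoc)
next
  case (If_Blank T t q T' p)
  from If_Blank.prems have at: "a < length c" "c ! a = Jump t (a + 1) (a + code_length p + 2)"
    "code_at c (a + code_length p + 2) (compile q (a + code_length p + 2))"
    by (simp_all add: code_at_Cons code_at_append length_compile)
  have t: "tape_of (c ! a) < m"
    using at(1) If_Blank.prems(2) by auto
  have "reaches (machine_of c m) \<phi>s (a, T) (a + code_length p + 2, T)"
    by (rule reaches_step) (subst machine_of_step[OF at(1) t], simp add: at If_Blank.hyps)
  moreover have "reaches (machine_of c m) \<phi>s (a + code_length p + 2, T)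
      (a + code_length p + 2 + code_length q, T')"
    by (rule If_Blank.IH[OF at(3) If_Blank.prems(2)])
  ultimately have "reaches (machine_of c m) \<phi>s (a, T) (a + code_length p + 2 + code_length q, T')"
    by (blast intro: reaches_trans)
  then show ?case by (simp add: algebra_simps)
next
  case (While_Blank T t p)
  from While_Blank.prems have at: "a < length c" "c ! a = Jump t (a + 1) (a + code_length p + 2)"
    by (simp_all add: code_at_Cons)
  have t: "tape_of (c ! a) < m"
    using at(1) While_Blank.prems(2) by auto
  show ?case
    by (rule reaches_step) (subst machine_of_step[OF at(1) t], simp add: at While_Blank.hyps)
next
  case (While_Mark T t p T' T'')
  from While_Mark.prems have at: "a < length c" "c ! a = Jump t (a + 1) (a + code_length p + 2)"
    "code_at c (a + 1) (compile p (a + 1))" "a + 1 + code_length p < length c"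
    "c ! (a + 1 + code_length p) = Jump t a a"
    by (simp_all add: code_at_Cons code_at_append length_compile)
  have t: "tape_of (c ! i) < m" if "i < length c" for i
    using that While_Mark.prems(2) by auto
  have "reaches (machine_of c m) \<phi>s (a, T) (a + 1, T)"
    by (rule reaches_step) (subst machine_of_step[OF at(1) t[OF at(1)]], simp add: at While_Mark.hyps)
  moreover have "reaches (machine_of c m) \<phi>s (a + 1, T) (a + 1 + code_length p, T')"
    by (rule While_Mark.IH(1)[OF at(3) While_Mark.prems(2)])
  moreover have "reaches (machine_of c m) \<phi>s (a + 1 + code_length p, T') (a, T')"
    by (rule reaches_step) (subst machine_of_step[OF at(4) t[OF at(4)]], simp add: at del: One_nat_def)
  moreover have "reaches (machine_of c m) \<phi>s (a, T') (a + code_length (While_Mark t p), T'')"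
    by (rule While_Mark.IH(2)[OF While_Mark.prems])
  ultimately show ?case
    by (blast intro: reaches_trans)
qed

lemma machine_of_exec:
  obtains M where "\<And>\<phi>s ns T. exec \<phi>s p (snd (initial_config ns)) T \<Longrightarrow>
    machine_output M \<phi>s ns (tape_value (T 0))"
proof
  let ?c = "compile p 0"
  \<comment> \<open>One more than every tape mentioned; \<open>insert 0\<close> keeps the maximum
    defined for a program without instructions.\<close>
  let ?m = "Suc (Max (insert 0 (tape_of ` set ?c)))"
  have m: "\<forall>x\<in>set ?c. tape_of x < ?m"
    by (auto intro!: le_imp_less_Suc Max_ge)
  fix \<phi>s ns T
  assume "exec \<phi>s p (snd (initial_config ns)) T"
  moreover have "code_at ?c 0 (compile p 0)"
    by (simp add: code_at_def)
  ultimately have "reaches (machine_of ?c ?m) \<phi>s (0, snd (initial_config ns)) (0 + code_length p, T)"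
    using m by (rule compile_correct)
  then show "machine_output (machine_of ?c ?m) \<phi>s ns (tape_value (T 0))"
    unfolding machine_output_def reaches_def initial_config_def
    by (auto simp: machine_of_def length_compile)
qed

section \<open>Effective functionals\<close>

text \<open>A unary tape whose head is at \<open>p\<close>: the shape of a tape in the middle of a
  walk along its block.\<close>

definition utape :: "nat \<Rightarrow> int \<Rightarrow> tape" where
  "utape n p = (p, \<lambda>q. if 0 \<le> q \<and> q < int n then Mark else Blank)"

lemma unary_tape_utape: "unary_tape n = utape n 0"
  by (simp add: unary_tape_def utape_def)

lemma tape_value_unary_tape: "tape_value (unary_tape n) = n"
proof -
  have "{p. 0 \<le> p \<and> p < int n} = {0..<int n}"
    by auto
  then show ?thesis
    by (simp add: tape_value_def unary_tape_def)
qed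

lemma scanned_utape: "scanned (utape n p) = (if 0 \<le> p \<and> p < int n then Mark else Blank)"
  by (simp add: scanned_def utape_def)

lemma scanned_unary_tape: "scanned (unary_tape n) = (if 0 < n then Mark else Blank)"
  by (simp add: unary_tape_utape scanned_utape)

lemma act_utape:
  "act (Mark, Go_Right) (utape n (int n)) = utape (Suc n) (int n + 1)"
  "act (Mark, Go_Left) (utape n (int n)) = utape (Suc n) (int n - 1)"
  "0 \<le> p \<Longrightarrow> p < int n \<Longrightarrow> act (Mark, d) (utape n p) = act (scanned (utape n p), d) (utape n p)"
  "p < 0 \<or> int n \<le> p \<Longrightarrow> act (Blank, d) (utape n p) = act (scanned (utape n p), d) (utape n p)"
  "act (scanned (utape n p), Go_Right) (utape n p) = utape n (p + 1)"
  "act (scanned (utape n p), Go_Left) (utape n p) = utape n (p - 1)"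
  by (auto simp: utape_def fun_eq_iff scanned_def)

lemma act_utape_Mark:
  assumes "0 \<le> p" "p < int n"
  shows "act (Mark, Go_Right) (utape n p) = utape n (p + 1)"
    and "act (Mark, Go_Left) (utape n p) = utape n (p - 1)"
  using act_utape(3)[OF assms] act_utape(5,6) by simp_all

lemma act_utape_Blank:
  assumes "p < 0 \<or> int n \<le> p"
  shows "act (Blank, Go_Right) (utape n p) = utape n (p + 1)"
    and "act (Blank, Go_Left) (utape n p) = utape n (p - 1)"
  using act_utape(4)[OF assms] act_utape(5,6) by simp_all

lemma act_utape_erase: "act (Blank, d) (utape (Suc n) (int n)) = act (Blank, d) (utape n (int n))"
  by (auto simp: utape_def fun_eq_iff)

lemma exec_ActI: "T' = T(t := act (s, d) (T t)) \<Longrightarrow> exec \<phi>s (Act t s d) T T'"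
  by (simp add: exec.Act)

lemma exec_QueryI: "T' = T(t := unary_tape (ask \<phi>s j (tape_value (T t)))) \<Longrightarrow> exec \<phi>s (Query j t) T T'"
  by (simp add: exec.Query)

text \<open>A query to a missing oracle is answered by 0 and thereby erases the tape.\<close>

lemma exec_reset: "exec [\<phi>] (Query (Suc 0) t) T (T(t := unary_tape 0))"
  by (rule exec_QueryI) (simp add: ask_def)

lemma exec_walk_right:
  assumes "p \<le> n"
  shows "exec \<phi>s (While_Mark t (Act t Mark Go_Right)) (T(t := utape n (int p))) (T(t := utape n (int n)))"
  using assms
proof (induction p rule: inc_induct)
  case base
  show ?case by (rule exec.While_Blank) (simp add: scanned_utape)
next
  case (step p)
  show ?case
    by (rule exec.While_Mark[OF _ exec_ActI step.IH])
      (use step.hyps in \<open>simp_all add: scanned_utape act_utape_Mark fun_eq_iff algebra_simps\<close>)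
qed

lemma exec_walk_left:
  assumes "p \<le> n"
  shows "exec \<phi>s (While_Mark t (Act t Mark Go_Left)) (T(t := utape n (int p - 1))) (T(t := utape n (-1)))"
  using assms
proof (induction p)
  case 0
  have "scanned ((T(t := utape n (-1))) t) = Blank"
    by (simp add: scanned_utape)
  from exec.While_Blank[where T = "T(t := utape n (-1))", OF this] show ?case by (simp only: of_nat_0 diff_0)
next
  case (Suc p)
  show ?case
    by (rule exec.While_Mark[OF _ exec_ActI Suc.IH])
      (use Suc.prems in \<open>simp_all add: scanned_utape act_utape_Mark fun_eq_iff\<close>)
qed

section \<open>Counter programs: increment, decrement, copy\<close>

definition Inc :: "nat \<Rightarrow> prog" where
  "Inc t = While_Mark t (Act t Mark Go_Right) ;; Act t Mark Go_Left ;;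
     While_Mark t (Act t Mark Go_Left) ;; Act t Blank Go_Right"

text \<open>The new mark goes on the first blank to the right of the block. Cell -1 is blank and
  stops the walk back, and one step right restores the head to cell 0.\<close>

lemma exec_Inc:
  assumes "T t = unary_tape n"
  shows "exec \<phi>s (Inc t) T (T(t := unary_tape (Suc n)))"
proof -
  have T: "T = T(t := utape n (int 0))"
    using assms by (auto simp: unary_tape_utape)
  have "exec \<phi>s (While_Mark t (Act t Mark Go_Right)) T (T(t := utape n (int n)))"
    using exec_walk_right[of 0 n \<phi>s t T] T by simp
  moreover have "exec \<phi>s (Act t Mark Go_Left) (T(t := utape n (int n))) (T(t := utape (Suc n) (int n - 1)))"
    by (rule exec_ActI) (simp add: act_utape)
  moreover have "exec \<phi>s (While_Mark t (Act t Mark Go_Left)) (T(t := utape (Suc n) (int n - 1)))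
      (T(t := utape (Suc n) (-1)))"
    by (rule exec_walk_left) simp
  moreover have "exec \<phi>s (Act t Blank Go_Right) (T(t := utape (Suc n) (-1))) (T(t := unary_tape (Suc n)))"
    by (rule exec_ActI) (simp add: act_utape_Blank unary_tape_utape)
  ultimately show ?thesis
    unfolding Inc_def by (blast intro: exec.Seq)
qed

definition Dec :: "nat \<Rightarrow> prog" where
  "Dec t = While_Mark t (Act t Mark Go_Right) ;; Act t Blank Go_Left ;; Act t Blank Go_Left ;;
     While_Mark t (Act t Mark Go_Left) ;; Act t Blank Go_Right"

text \<open>The walk right overshoots the block by one cell; hence two steps left, of which the
  second erases the last mark.\<close>

lemma exec_Dec:
  assumes "T t = unary_tape (Suc n)"
  shows "exec \<phi>s (Dec t) T (T(t := unary_tape n))"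
proof -
  have T: "T = T(t := utape (Suc n) (int 0))"
    using assms by (auto simp: unary_tape_utape)
  have "exec \<phi>s (While_Mark t (Act t Mark Go_Right)) T (T(t := utape (Suc n) (int (Suc n))))"
    using exec_walk_right[of 0 "Suc n" \<phi>s t T] T by simp
  moreover have "exec \<phi>s (Act t Blank Go_Left) (T(t := utape (Suc n) (int (Suc n)))) (T(t := utape (Suc n) (int n)))"
    by (rule exec_ActI) (simp add: act_utape_Blank)
  moreover have "exec \<phi>s (Act t Blank Go_Left) (T(t := utape (Suc n) (int n))) (T(t := utape n (int n - 1)))"
    by (rule exec_ActI) (simp add: act_utape_erase act_utape_Blank)
  moreover have "exec \<phi>s (While_Mark t (Act t Mark Go_Left)) (T(t := utape n (int n - 1)))
      (T(t := utape n (-1)))"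
    by (rule exec_walk_left) simp
  moreover have "exec \<phi>s (Act t Blank Go_Right) (T(t := utape n (-1))) (T(t := unary_tape n))"
    by (rule exec_ActI) (simp add: act_utape_Blank unary_tape_utape)
  ultimately show ?thesis
    unfolding Dec_def by (blast intro: exec.Seq)
qed

definition Copy :: "nat \<Rightarrow> nat \<Rightarrow> prog" where
  "Copy s t = Query (Suc 0) t ;; While_Mark s (Act t Mark Go_Right ;; Act s Mark Go_Right) ;;
     Act t Blank Go_Left ;; Act s Blank Go_Left ;;
     While_Mark s (Act t Mark Go_Left ;; Act s Mark Go_Left) ;; Act t Blank Go_Right ;; Act s Blank Go_Right"

text \<open>Both heads move in step, with the source as guard in both directions, so the source is
  restored without a scratch tape. The initial query clears the target whatever it contains: with
  the one-element list \<open>[\<phi>]\<close>, oracle 1 is missing.\<close>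

lemma exec_Copy:
  assumes "T s = unary_tape n" "s \<noteq> t"
  shows "exec [\<phi>] (Copy s t) T (T(t := unary_tape n))"
proof -
  let ?T = "\<lambda>m p q. T(s := utape n p, t := utape m q)"
  have T: "T = T(s := unary_tape n)"
    using assms by auto
  have s1: "exec [\<phi>] (Query (Suc 0) t) T (?T 0 0 0)"
    using exec_reset[of \<phi> t T] T by (simp add: unary_tape_utape)
  have "exec [\<phi>] (While_Mark s (Act t Mark Go_Right ;; Act s Mark Go_Right))
      (?T p (int p) (int p)) (?T n (int n) (int n))" if "p \<le> n" for p
    using that
  proof (induction p rule: inc_induct)
    case base
    show ?case by (rule exec.While_Blank) (use assms in \<open>simp add: scanned_utape\<close>)
  next
    case (step p)
    show ?case
      by (rule exec.While_Mark[OF _ exec.Seq[OF exec_ActI[OF refl] exec_ActI] step.IH])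
        (use step.hyps assms in \<open>simp_all add: scanned_utape act_utape_Mark act_utape(1) fun_eq_iff ac_simps\<close>)
  qed
  from this[of 0] have s2: "exec [\<phi>] (While_Mark s (Act t Mark Go_Right ;; Act s Mark Go_Right))
      (?T 0 0 0) (?T n (int n) (int n))" by simp
  have s3: "exec [\<phi>] (Act t Blank Go_Left) (?T n (int n) (int n)) (?T n (int n) (int n - 1))"
    by (rule exec_ActI) (use assms in \<open>simp add: act_utape_Blank\<close>)
  have s4: "exec [\<phi>] (Act s Blank Go_Left) (?T n (int n) (int n - 1)) (?T n (int n - 1) (int n - 1))"
    by (rule exec_ActI) (use assms in \<open>simp add: act_utape_Blank fun_eq_iff\<close>)
  have "exec [\<phi>] (While_Mark s (Act t Mark Go_Left ;; Act s Mark Go_Left))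
      (?T n (int p - 1) (int p - 1)) (?T n (-1) (-1))" if "p \<le> n" for p
    using that
  proof (induction p)
    case 0
    have "scanned (?T n (-1) (-1) s) = Blank"
      using assms by (simp add: scanned_utape)
    from exec.While_Blank[where T = "?T n (-1) (-1)", OF this] show ?case by (simp only: of_nat_0 diff_0)
  next
    case (Suc p)
    show ?case
      by (rule exec.While_Mark[OF _ exec.Seq[OF exec_ActI[OF refl] exec_ActI] Suc.IH])
        (use Suc.prems assms in \<open>simp_all add: scanned_utape act_utape_Mark fun_eq_iff\<close>)
  qed
  then have s5: "exec [\<phi>] (While_Mark s (Act t Mark Go_Left ;; Act s Mark Go_Left))
      (?T n (int n - 1) (int n - 1)) (?T n (-1) (-1))" by blast
  have s6: "exec [\<phi>] (Act t Blank Go_Right) (?T n (-1) (-1)) (?T n (-1) 0)"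
    by (rule exec_ActI) (use assms in \<open>simp add: act_utape_Blank\<close>)
  have s7: "exec [\<phi>] (Act s Blank Go_Right) (?T n (-1) 0) (?T n 0 0)"
    by (rule exec_ActI) (use assms in \<open>simp add: act_utape_Blank fun_eq_iff\<close>)
  have "?T n 0 0 = T(t := unary_tape n)"
    using T by (simp add: unary_tape_utape)
  then show ?thesis
    using exec.Seq[OF exec.Seq[OF exec.Seq[OF exec.Seq[OF exec.Seq[OF exec.Seq[OF s1 s2] s3] s4] s5] s6] s7]
    by (simp only: Copy_def)
qed

text \<open>
  A functional takes an oracle and an environment of registers.  The program may be asked to find
  register \<open>i\<close> on tape \<open>l i\<close>, to leave all tapes below \<open>N\<close> intact and to put the result on tape \<open>N\<close>;
  the other tapes may contain anything.
\<close>

definition runs ::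
  "(nat \<Rightarrow> nat) set \<Rightarrow> (nat \<Rightarrow> nat) \<Rightarrow> nat \<Rightarrow> prog \<Rightarrow> ((nat \<Rightarrow> nat) \<Rightarrow> (nat \<Rightarrow> nat) \<Rightarrow> nat) \<Rightarrow> bool"
  where "runs D l N p E \<longleftrightarrow>
    (\<forall>\<phi>\<in>D. \<forall>\<rho> T. (\<forall>i. T (l i) = unary_tape (\<rho> i)) \<longrightarrow>
      (\<exists>T'. exec [\<phi>] p T T' \<and> (\<forall>i<N. T' i = T i) \<and> T' N = unary_tape (E \<phi> \<rho>)))"

lemma runsI:
  assumes "\<And>\<phi> \<rho> T. \<phi> \<in> D \<Longrightarrow> \<forall>i. T (l i) = unary_tape (\<rho> i) \<Longrightarrow>
    \<exists>T'. exec [\<phi>] p T T' \<and> (\<forall>i<N. T' i = T i) \<and> T' N = unary_tape (E \<phi> \<rho>)"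
  shows "runs D l N p E"
  using assms by (simp add: runs_def)

lemma runsD:
  assumes "runs D l N p E" "\<phi> \<in> D" "\<forall>i. T (l i) = unary_tape (\<rho> i)"
  shows "\<exists>T'. exec [\<phi>] p T T' \<and> (\<forall>i<N. T' i = T i) \<and> T' N = unary_tape (E \<phi> \<rho>)"
  using assms by (simp add: runs_def)

text \<open>Quantifying over \<open>l\<close> and \<open>N\<close> makes programs composable: a
  caller can keep intermediate results on tapes from \<open>N\<close> on and run the next program
  above them. The layout \<open>l\<close> need not be injective. Correctness is demanded only for
  oracles in \<open>D\<close>, so a search has to succeed only there.\<close>

definition effective ::
  "(nat \<Rightarrow> nat) set \<Rightarrow> ((nat \<Rightarrow> nat) \<Rightarrow> (nat \<Rightarrow> nat) \<Rightarrow> nat) \<Rightarrow> bool" where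
  "effective D E \<longleftrightarrow> (\<forall>l N. (\<forall>i. l i < N) \<longrightarrow> (\<exists>p. runs D l N p E))"

lemma effectiveI:
  assumes "\<And>l N. \<forall>i. l i < N \<Longrightarrow> \<exists>p. runs D l N p E"
  shows "effective D E"
  using assms by (simp add: effective_def)

lemma effectiveE:
  assumes "effective D E" "\<forall>i. l i < N"
  obtains p where "runs D l N p E"
  using assms unfolding effective_def by blast

lemma effective_cong:
  assumes "effective D E" "\<And>\<phi> \<rho>. \<phi> \<in> D \<Longrightarrow> E \<phi> \<rho> = F \<phi> \<rho>"
  shows "effective D F"
proof (rule effectiveI)
  fix l :: "nat \<Rightarrow> nat" and N
  assume l: "\<forall>i. l i < N"
  obtain p where "runs D l N p E"
    by (rule effectiveE[OF assms(1) l])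
  then have "runs D l N p F"
    by (simp add: runs_def assms(2))
  then show "\<exists>p. runs D l N p F" ..
qed

section \<open>Basic functionals and their composition\<close>

lemma effective_var: "effective D (\<lambda>\<phi> \<rho>. \<rho> i)"
proof (rule effectiveI)
  fix l :: "nat \<Rightarrow> nat" and N
  assume l: "\<forall>i. l i < N"
  show "\<exists>p. runs D l N p (\<lambda>\<phi> \<rho>. \<rho> i)"
  proof (intro exI[of _ "Copy (l i) N"] runsI)
    fix \<phi> \<rho> T assume T: "\<forall>i. T (l i) = unary_tape (\<rho> i)"
    have "l i \<noteq> N"
      using l by (metis less_irrefl)
    from exec_Copy[where T = T and s = "l i" and t = N, OF T[rule_format] this]
    show "\<exists>T'. exec [\<phi>] (Copy (l i) N) T T' \<and> (\<forall>i<N. T' i = T i) \<and> T' N = unary_tape (\<rho> i)"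
      by (intro exI[of _ "T(N := unary_tape (\<rho> i))"]) simp
  qed
qed

lemma effective_zero: "effective D (\<lambda>\<phi> \<rho>. 0)"
proof (rule effectiveI)
  fix l :: "nat \<Rightarrow> nat" and N
  have "\<exists>T'. exec [\<phi>] (Query (Suc 0) N) T T' \<and> (\<forall>i<N. T' i = T i) \<and> T' N = unary_tape 0" for \<phi> T
    using exec_reset[of \<phi> N T] by (intro exI[of _ "T(N := unary_tape 0)"]) simp
  then show "\<exists>p. runs D l N p (\<lambda>\<phi> \<rho>. 0)"
    unfolding runs_def by (intro exI[of _ "Query (Suc 0) N"]) blast
qed

lemma effective_Suc:
  assumes "effective D A"
  shows "effective D (\<lambda>\<phi> \<rho>. Suc (A \<phi> \<rho>))"
proof (rule effectiveI)
  fix l :: "nat \<Rightarrow> nat" and N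
  assume l: "\<forall>i. l i < N"
  obtain p where p: "runs D l N p (\<lambda>\<phi> \<rho>. A \<phi> \<rho>)"
    by (rule effectiveE[OF assms l])
  show "\<exists>p. runs D l N p (\<lambda>\<phi> \<rho>. Suc (A \<phi> \<rho>))"
  proof (intro exI[of _ "p ;; Inc N"] runsI)
    fix \<phi> \<rho> T assume \<phi>: "\<phi> \<in> D" and T: "\<forall>i. T (l i) = unary_tape (\<rho> i)"
    obtain T' where T': "exec [\<phi>] p T T'" "\<forall>i<N. T' i = T i" "T' N = unary_tape (A \<phi> \<rho>)"
      using runsD[OF p \<phi> T] by blast
    from exec.Seq[OF T'(1) exec_Inc[where T = T' and t = N, OF T'(3)]] T'(2)
    show "\<exists>T'. exec [\<phi>] (p ;; Inc N) T T' \<and> (\<forall>i<N. T' i = T i) \<and> T' N = unary_tape (Suc (A \<phi> \<rho>))"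
      by (intro exI[of _ "T'(N := unary_tape (Suc (A \<phi> \<rho>)))"]) simp
  qed
qed

lemma effective_pred:
  assumes "effective D A"
  shows "effective D (\<lambda>\<phi> \<rho>. A \<phi> \<rho> - 1)"
proof (rule effectiveI)
  fix l :: "nat \<Rightarrow> nat" and N
  assume l: "\<forall>i. l i < N"
  obtain p where p: "runs D l N p (\<lambda>\<phi> \<rho>. A \<phi> \<rho>)"
    by (rule effectiveE[OF assms l])
  show "\<exists>p. runs D l N p (\<lambda>\<phi> \<rho>. A \<phi> \<rho> - 1)"
  proof (intro exI[of _ "p ;; If_Mark N (Dec N) Skip"] runsI)
    fix \<phi> \<rho> T assume \<phi>: "\<phi> \<in> D" and T: "\<forall>i. T (l i) = unary_tape (\<rho> i)"
    obtain T' where T': "exec [\<phi>] p T T'" "\<forall>i<N. T' i = T i" "T' N = unary_tape (A \<phi> \<rho>)"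
      using runsD[OF p \<phi> T] by blast
    have "exec [\<phi>] (If_Mark N (Dec N) Skip) T' (T'(N := unary_tape (A \<phi> \<rho> - 1)))"
    proof (cases "A \<phi> \<rho>")
      case 0
      with T' have "T'(N := unary_tape (A \<phi> \<rho> - 1)) = T'"
        by auto
      moreover have "scanned (T' N) = Blank"
        using 0 T' by (simp add: scanned_unary_tape)
      ultimately show ?thesis
        using exec.If_Blank[OF _ exec.Skip] by simp
    next
      case (Suc n)
      with T' have "T' N = unary_tape (Suc n)" "scanned (T' N) = Mark"
        by (simp_all add: scanned_unary_tape)
      from exec.If_Mark[OF this(2) exec_Dec[where T = T' and t = N, OF this(1)]] Suc show ?thesis
        by simp
    qed
    from exec.Seq[OF T'(1) this] T'(2) show "\<exists>T'. exec [\<phi>] (p ;; If_Mark N (Dec N) Skip) T T' \<and> (\<forall>i<N. T' i = T i) \<and>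
        T' N = unary_tape (A \<phi> \<rho> - 1)"
      by (intro exI[of _ "T'(N := unary_tape (A \<phi> \<rho> - 1))"]) simp
  qed
qed

lemma effective_oracle:
  assumes "effective D A"
  shows "effective D (\<lambda>\<phi> \<rho>. \<phi> (A \<phi> \<rho>))"
proof (rule effectiveI)
  fix l :: "nat \<Rightarrow> nat" and N
  assume l: "\<forall>i. l i < N"
  obtain p where p: "runs D l N p (\<lambda>\<phi> \<rho>. A \<phi> \<rho>)"
    by (rule effectiveE[OF assms l])
  show "\<exists>p. runs D l N p (\<lambda>\<phi> \<rho>. \<phi> (A \<phi> \<rho>))"
  proof (intro exI[of _ "p ;; Query 0 N"] runsI)
    fix \<phi> \<rho> T assume \<phi>: "\<phi> \<in> D" and T: "\<forall>i. T (l i) = unary_tape (\<rho> i)"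
    obtain T' where T': "exec [\<phi>] p T T'" "\<forall>i<N. T' i = T i" "T' N = unary_tape (A \<phi> \<rho>)"
      using runsD[OF p \<phi> T] by blast
    have "exec [\<phi>] (Query 0 N) T' (T'(N := unary_tape (\<phi> (A \<phi> \<rho>))))"
      by (rule exec_QueryI) (simp add: T' ask_def tape_value_unary_tape)
    from exec.Seq[OF T'(1) this] T'(2) show "\<exists>T'. exec [\<phi>] (p ;; Query 0 N) T T' \<and> (\<forall>i<N. T' i = T i) \<and>
        T' N = unary_tape (\<phi> (A \<phi> \<rho>))"
      by (intro exI[of _ "T'(N := unary_tape (\<phi> (A \<phi> \<rho>)))"]) simp
  qed
qed

text \<open>Renaming registers costs no code: the program for \<open>A\<close> is requested with
  another layout.\<close>

lemma effective_weaken: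
  assumes "effective D A"
  shows "effective D (\<lambda>\<phi> \<rho>. A \<phi> (\<lambda>i. \<rho> (g i)))"
proof (rule effectiveI)
  fix l :: "nat \<Rightarrow> nat" and N
  assume "\<forall>i. l i < N"
  then have l: "\<forall>i. l (g i) < N" by blast
  obtain p where p: "runs D (\<lambda>i. l (g i)) N p (\<lambda>\<phi> \<rho>. A \<phi> \<rho>)"
    by (rule effectiveE[OF assms l])
  show "\<exists>p. runs D l N p (\<lambda>\<phi> \<rho>. A \<phi> (\<lambda>i. \<rho> (g i)))"
    by (intro exI[of _ p] runsI runsD[OF p]) simp_all
qed

text \<open>Environments behave like de Bruijn contexts: \<open>case_nat x \<rho>\<close> binds
  register 0 and shifts the others up. \<open>F\<close> runs one tape higher, so that the value of
  \<open>A\<close> is still there while it is read, and the result is then copied down to tape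
  \<open>N\<close>.\<close>

lemma effective_bind:
  assumes "effective D A" "effective D F"
  shows "effective D (\<lambda>\<phi> \<rho>. F \<phi> (case_nat (A \<phi> \<rho>) \<rho>))"
proof (rule effectiveI)
  fix l :: "nat \<Rightarrow> nat" and N
  assume l: "\<forall>i. l i < N"
  obtain p where p: "runs D l N p (\<lambda>\<phi> \<rho>. A \<phi> \<rho>)"
    by (rule effectiveE[OF assms(1) l])
  have l': "\<forall>i. case_nat N l i < Suc N"
    using l by (simp add: less_SucI split: nat.split)
  obtain q where q: "runs D (case_nat N l) (Suc N) q (\<lambda>\<phi> \<rho>. F \<phi> \<rho>)"
    by (rule effectiveE[OF assms(2) l'])
  show "\<exists>p. runs D l N p (\<lambda>\<phi> \<rho>. F \<phi> (case_nat (A \<phi> \<rho>) \<rho>))"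
  proof (intro exI[of _ "p ;; q ;; Copy (Suc N) N"] runsI)
    fix \<phi> \<rho> T assume \<phi>: "\<phi> \<in> D" and T: "\<forall>i. T (l i) = unary_tape (\<rho> i)"
    obtain T' where T': "exec [\<phi>] p T T'" "\<forall>i<N. T' i = T i" "T' N = unary_tape (A \<phi> \<rho>)"
      using runsD[OF p \<phi> T] by blast
    have "\<forall>i. T' (case_nat N l i) = unary_tape (case_nat (A \<phi> \<rho>) \<rho> i)"
      using T T' l by (simp split: nat.split)
    from runsD[OF q \<phi> this] obtain T'' where T'': "exec [\<phi>] q T' T''" "\<forall>i<Suc N. T'' i = T' i"
      "T'' (Suc N) = unary_tape (F \<phi> (case_nat (A \<phi> \<rho>) \<rho>))" by blast
    have "exec [\<phi>] (Copy (Suc N) N) T'' (T''(N := unary_tape (F \<phi> (case_nat (A \<phi> \<rho>) \<rho>))))"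
      by (rule exec_Copy) (simp_all add: T'')
    from exec.Seq[OF exec.Seq[OF T'(1) T''(1)] this] T'(2) T''(2)
    show "\<exists>T'. exec [\<phi>] (p ;; q ;; Copy (Suc N) N) T T' \<and> (\<forall>i<N. T' i = T i) \<and>
        T' N = unary_tape (F \<phi> (case_nat (A \<phi> \<rho>) \<rho>))"
      by (intro exI[of _ "T''(N := unary_tape (F \<phi> (case_nat (A \<phi> \<rho>) \<rho>)))"]) simp
  qed
qed

lemma effective_subst1:
  assumes "effective D (\<lambda>\<phi> \<rho>. F \<phi> (\<rho> 0))" "effective D A"
  shows "effective D (\<lambda>\<phi> \<rho>. F \<phi> (A \<phi> \<rho>))"
  using effective_bind[OF assms(2,1)] by simp

lemma effective_subst2:
  assumes F: "effective D (\<lambda>\<phi> \<rho>. F \<phi> (\<rho> 0) (\<rho> 1))" and A: "effective D A" and B: "effective D B"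
  shows "effective D (\<lambda>\<phi> \<rho>. F \<phi> (A \<phi> \<rho>) (B \<phi> \<rho>))"
proof -
  \<comment> \<open>\<open>effective_bind\<close> fills register 0, so the arguments are bound from
    last to first. Truncated subtraction swaps the registers 0 and 1 for this, and
    \<open>Suc\<close> keeps \<open>B\<close> off the register reserved for
    \<open>A\<close>.\<close>
  have "effective D (\<lambda>\<phi> \<rho>. F \<phi> (\<rho> 1) (\<rho> 0))"
    using effective_weaken[OF F, of "\<lambda>i. 1 - i"] by simp
  from effective_bind[OF effective_weaken[OF B, of Suc] this]
  have "effective D (\<lambda>\<phi> \<rho>. F \<phi> (\<rho> 0) (B \<phi> (\<lambda>i. \<rho> (Suc i))))"
    by simp
  from effective_bind[OF A this] show ?thesis
    by simp
qed

lemma effective_subst3: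
  assumes F: "effective D (\<lambda>\<phi> \<rho>. F \<phi> (\<rho> 0) (\<rho> 1) (\<rho> 2))"
    and A: "effective D A" and B: "effective D B" and C: "effective D C"
  shows "effective D (\<lambda>\<phi> \<rho>. F \<phi> (A \<phi> \<rho>) (B \<phi> \<rho>) (C \<phi> \<rho>))"
proof -
  have "effective D (\<lambda>\<phi> \<rho>. F \<phi> (\<rho> 2) (\<rho> 1) (\<rho> 0))"
    using effective_weaken[OF F, of "\<lambda>i. 2 - i"] by (simp add: numeral_2_eq_2)
  from effective_bind[OF effective_weaken[OF C, of "\<lambda>i. Suc (Suc i)"] this]
  have "effective D (\<lambda>\<phi> \<rho>. F \<phi> (\<rho> 1) (\<rho> 0) (C \<phi> (\<lambda>i. \<rho> (Suc (Suc i)))))"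
    by (simp add: numeral_2_eq_2)
  from effective_bind[OF effective_weaken[OF B, of Suc] this]
  have "effective D (\<lambda>\<phi> \<rho>. F \<phi> (\<rho> 0) (B \<phi> (\<lambda>i. \<rho> (Suc i))) (C \<phi> (\<lambda>i. \<rho> (Suc i))))"
    by simp
  from effective_bind[OF A this] show ?thesis
    by simp
qed

text \<open>The number of rounds is not counted down: the head on tape \<open>Suc N\<close> walks
  right over its marks until the first blank. The body runs above that tape and so leaves the head
  alone; after \<open>k\<close> rounds it is on cell \<open>k\<close>.\<close>

lemma effective_iterate:
  assumes C: "effective D C" and A: "effective D A"
    and G: "effective D (\<lambda>\<phi> \<rho>. G \<phi> (\<lambda>i. \<rho> (Suc i)) (\<rho> 0))"
  shows "effective D (\<lambda>\<phi> \<rho>. (G \<phi> \<rho> ^^ C \<phi> \<rho>) (A \<phi> \<rho>))"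
proof (rule effectiveI)
  fix l :: "nat \<Rightarrow> nat" and N
  assume l: "\<forall>i. l i < N"
  obtain p where p: "runs D l N p (\<lambda>\<phi> \<rho>. A \<phi> \<rho>)"
    by (rule effectiveE[OF A l])
  from l have l1: "\<forall>i. l i < Suc N"
    by (simp add: less_SucI)
  obtain c where c: "runs D l (Suc N) c (\<lambda>\<phi> \<rho>. C \<phi> \<rho>)"
    by (rule effectiveE[OF C l1])
  have l': "\<forall>i. case_nat N l i < Suc (Suc N)"
    using l by (simp add: less_SucI split: nat.split)
  obtain g where g: "runs D (case_nat N l) (Suc (Suc N)) g (\<lambda>\<phi> \<rho>. G \<phi> (\<lambda>i. \<rho> (Suc i)) (\<rho> 0))"
    by (rule effectiveE[OF G l'])
  let ?body = "g ;; Copy (Suc (Suc N)) N ;; Act (Suc N) Mark Go_Right"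
  let ?loop = "While_Mark (Suc N) ?body"
  have loop: "\<exists>T'. exec [\<phi>] ?loop T T' \<and> (\<forall>i<N. T' i = T i) \<and> T' N = unary_tape ((G \<phi> \<rho> ^^ (n - k)) x)"
    if "\<phi> \<in> D" "\<forall>i. T (l i) = unary_tape (\<rho> i)" "T N = unary_tape x" "T (Suc N) = utape n (int k)" "k \<le> n"
    for \<phi> \<rho> T n k x
    using that(5,2-4)
  proof (induction k arbitrary: T x rule: inc_induct)
    case base
    then show ?case
      by (intro exI[of _ T] conjI exec.While_Blank) (simp_all add: scanned_utape)
  next
    case (step k)
    have "\<forall>i. T (case_nat N l i) = unary_tape (case_nat x \<rho> i)"
      using step.prems by (simp split: nat.split)
    from runsD[OF g that(1) this] obtain T1 where T1: "exec [\<phi>] g T T1" "\<forall>i<Suc (Suc N). T1 i = T i"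
      "T1 (Suc (Suc N)) = unary_tape (G \<phi> \<rho> x)" by auto
    let ?T2 = "T1(N := unary_tape (G \<phi> \<rho> x))"
    let ?T3 = "?T2(Suc N := act (Mark, Go_Right) (?T2 (Suc N)))"
    have "exec [\<phi>] (Copy (Suc (Suc N)) N) T1 ?T2"
      by (rule exec_Copy) (simp_all add: T1)
    from exec.Seq[OF exec.Seq[OF T1(1) this] exec.Act]
    have body: "exec [\<phi>] ?body T ?T3" .
    have "\<exists>T'. exec [\<phi>] ?loop ?T3 T' \<and> (\<forall>i<N. T' i = ?T3 i) \<and>
        T' N = unary_tape ((G \<phi> \<rho> ^^ (n - Suc k)) (G \<phi> \<rho> x))"
    proof (rule step.IH)
      show "\<forall>i. ?T3 (l i) = unary_tape (\<rho> i)"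
      proof
        fix i
        have "l i < N" using l ..
        then show "?T3 (l i) = unary_tape (\<rho> i)"
          using step.prems(1) T1(2) by simp
      qed
      show "?T3 (Suc N) = utape n (int (Suc k))"
        using step T1(2) by (simp add: act_utape_Mark ac_simps)
    qed simp
    then obtain T' where "exec [\<phi>] ?loop ?T3 T'" "\<forall>i<N. T' i = ?T3 i"
        "T' N = unary_tape ((G \<phi> \<rho> ^^ (n - Suc k)) (G \<phi> \<rho> x))" by blast
    moreover have "(G \<phi> \<rho> ^^ (n - k)) x = (G \<phi> \<rho> ^^ (n - Suc k)) (G \<phi> \<rho> x)"
      using step.hyps by (simp add: Suc_diff_Suc[symmetric] funpow_Suc_right del: funpow.simps)
    ultimately show ?case
      using body T1(2) step
      by (intro exI[of _ T'] conjI exec.While_Mark[OF _ body]) (simp_all add: scanned_utape)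
  qed
  show "\<exists>p. runs D l N p (\<lambda>\<phi> \<rho>. (G \<phi> \<rho> ^^ C \<phi> \<rho>) (A \<phi> \<rho>))"
  proof (intro exI[of _ "p ;; c ;; ?loop"] runsI)
    fix \<phi> \<rho> T assume \<phi>: "\<phi> \<in> D" and T: "\<forall>i. T (l i) = unary_tape (\<rho> i)"
    obtain T1 where T1: "exec [\<phi>] p T T1" "\<forall>i<N. T1 i = T i" "T1 N = unary_tape (A \<phi> \<rho>)"
      using runsD[OF p \<phi> T] by blast
    have "\<forall>i. T1 (l i) = unary_tape (\<rho> i)"
      using T T1 l by simp
    from runsD[OF c \<phi> this] obtain T2 where T2: "exec [\<phi>] c T1 T2" "\<forall>i<Suc N. T2 i = T1 i"
      "T2 (Suc N) = unary_tape (C \<phi> \<rho>)" by blast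
    have "\<exists>T'. exec [\<phi>] ?loop T2 T' \<and> (\<forall>i<N. T' i = T2 i) \<and> T' N = unary_tape ((G \<phi> \<rho> ^^ (C \<phi> \<rho> - 0)) (A \<phi> \<rho>))"
      by (rule loop[OF \<phi>]) (use T T1 T2 l in \<open>simp_all add: unary_tape_utape less_SucI\<close>)
    then obtain T' where T': "exec [\<phi>] ?loop T2 T'" "\<forall>i<N. T' i = T2 i"
      "T' N = unary_tape ((G \<phi> \<rho> ^^ C \<phi> \<rho>) (A \<phi> \<rho>))" by auto
    with exec.Seq[OF exec.Seq[OF T1(1) T2(1)] T'(1)] T1(2) T2(2)
    show "\<exists>T'. exec [\<phi>] (p ;; c ;; ?loop) T T' \<and> (\<forall>i<N. T' i = T i) \<and>
        T' N = unary_tape ((G \<phi> \<rho> ^^ C \<phi> \<rho>) (A \<phi> \<rho>))"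
      by (intro exI[of _ T']) simp
  qed
qed

text \<open>A number is nonzero iff cell 0 of its unary tape is marked, so the value of
  \<open>G\<close> is itself the loop guard. Assumption \<open>ex\<close> makes the loop
  end.\<close>

lemma effective_Least:
  assumes G: "effective D (\<lambda>\<phi> \<rho>. G \<phi> (\<lambda>i. \<rho> (Suc i)) (\<rho> 0))"
    and ex: "\<And>\<phi> \<rho>. \<phi> \<in> D \<Longrightarrow> \<exists>x. G \<phi> \<rho> x = 0"
  shows "effective D (\<lambda>\<phi> \<rho>. LEAST x. G \<phi> \<rho> x = 0)"
proof (rule effectiveI)
  fix l :: "nat \<Rightarrow> nat" and N
  assume l: "\<forall>i. l i < N"
  have l': "\<forall>i. case_nat N l i < Suc N"
    using l by (simp add: less_SucI split: nat.split)
  obtain g where g: "runs D (case_nat N l) (Suc N) g (\<lambda>\<phi> \<rho>. G \<phi> (\<lambda>i. \<rho> (Suc i)) (\<rho> 0))"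
    by (rule effectiveE[OF G l'])
  have lN: "l i \<noteq> N" for i
    using l by (metis less_irrefl)
  let ?loop = "While_Mark (Suc N) (Inc N ;; g)"
  show "\<exists>p. runs D l N p (\<lambda>\<phi> \<rho>. LEAST x. G \<phi> \<rho> x = 0)"
  proof (intro exI[of _ "Query (Suc 0) N ;; g ;; ?loop"] runsI)
    fix \<phi> \<rho> T assume \<phi>: "\<phi> \<in> D" and T: "\<forall>i. T (l i) = unary_tape (\<rho> i)"
    define y where "y = (LEAST x. G \<phi> \<rho> x = 0)"
    have y: "G \<phi> \<rho> y = 0" "x < y \<Longrightarrow> 0 < G \<phi> \<rho> x" for x
      using LeastI_ex[OF ex[OF \<phi>]] not_less_Least[of x "\<lambda>x. G \<phi> \<rho> x = 0"] by (auto simp: y_def)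
    have g': "\<exists>T'. exec [\<phi>] g T T' \<and> (\<forall>i<N. T' i = T i) \<and> T' N = unary_tape x \<and>
        T' (Suc N) = unary_tape (G \<phi> \<rho> x)"
      if "\<forall>i. T (l i) = unary_tape (\<rho> i)" "T N = unary_tape x" for T x
    proof -
      have "\<forall>i. T (case_nat N l i) = unary_tape (case_nat x \<rho> i)"
        using that by (simp split: nat.split)
      from runsD[OF g \<phi> this] show ?thesis
        using that by fastforce
    qed
    have loop: "\<exists>T'. exec [\<phi>] ?loop T T' \<and> (\<forall>i<N. T' i = T i) \<and> T' N = unary_tape y"
      if "x \<le> y" "\<forall>i. T (l i) = unary_tape (\<rho> i)" "T N = unary_tape x" "T (Suc N) = unary_tape (G \<phi> \<rho> x)"
      for x T
      using that
    proof (induction x arbitrary: T rule: inc_induct)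
      case base
      then show ?case
        by (intro exI[of _ T] conjI exec.While_Blank) (simp_all add: scanned_unary_tape y)
    next
      case (step x)
      let ?T1 = "T(N := unary_tape (Suc x))"
      have T1: "exec [\<phi>] (Inc N) T ?T1"
        by (rule exec_Inc) (simp add: step.prems)
      have l1: "\<forall>i. ?T1 (l i) = unary_tape (\<rho> i)"
        using step.prems(1) lN by simp
      from g'[OF this, of "Suc x"] obtain T2 where T2: "exec [\<phi>] g ?T1 T2" "\<forall>i<N. T2 i = ?T1 i"
        "T2 N = unary_tape (Suc x)" "T2 (Suc N) = unary_tape (G \<phi> \<rho> (Suc x))"
        by (simp only: fun_upd_same) blast
      have "\<forall>i. T2 (l i) = unary_tape (\<rho> i)"
      proof
        fix i
        have "l i < N" using l ..
        with T2(2) have "T2 (l i) = ?T1 (l i)" by blast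
        also have "\<dots> = unary_tape (\<rho> i)" using l1 ..
        finally show "T2 (l i) = unary_tape (\<rho> i)" .
      qed
      from step.IH[OF this T2(3,4)] obtain T' where T': "exec [\<phi>] ?loop T2 T'" "\<forall>i<N. T' i = T2 i"
        "T' N = unary_tape y" by blast
      have "exec [\<phi>] ?loop T T'"
        by (rule exec.While_Mark[OF _ exec.Seq[OF T1 T2(1)] T'(1)])
          (use step y in \<open>simp add: scanned_unary_tape\<close>)
      with T' T2 show ?case
        by (intro exI[of _ T']) auto
    qed
    let ?T0 = "T(N := unary_tape 0)"
    have l0: "\<forall>i. ?T0 (l i) = unary_tape (\<rho> i)"
      using T lN by simp
    from g'[OF l0, of 0] obtain T1 where T1: "exec [\<phi>] g ?T0 T1" "\<forall>i<N. T1 i = ?T0 i" "T1 N = unary_tape 0"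
      "T1 (Suc N) = unary_tape (G \<phi> \<rho> 0)"
      by (simp only: fun_upd_same) blast
    have "\<forall>i. T1 (l i) = unary_tape (\<rho> i)"
    proof
      fix i
      have "l i < N" using l ..
      with T1(2) have "T1 (l i) = ?T0 (l i)" by blast
      also have "\<dots> = unary_tape (\<rho> i)" using l0 ..
      finally show "T1 (l i) = unary_tape (\<rho> i)" .
    qed
    from loop[OF le0 this T1(3,4)] obtain T' where T': "exec [\<phi>] ?loop T1 T'" "\<forall>i<N. T' i = T1 i"
      "T' N = unary_tape y" by blast
    then show "\<exists>T'. exec [\<phi>] (Query (Suc 0) N ;; g ;; ?loop) T T' \<and> (\<forall>i<N. T' i = T i) \<and>
        T' N = unary_tape (LEAST x. G \<phi> \<rho> x = 0)"
      using exec.Seq[OF exec.Seq[OF exec_reset T1(1)] T'(1)] T1(2) T'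
      by (intro exI[of _ T']) (simp add: y_def)
  qed
qed

lemma machine_of_effective:
  assumes "effective D (\<lambda>\<phi> \<rho>. E \<phi> (\<rho> 0))"
  obtains M where "\<And>\<phi> k. \<phi> \<in> D \<Longrightarrow> machine_output M [\<phi>] [k] (E \<phi> k)"
proof -
  \<comment> \<open>Every register is placed on the input tape 0, so the environment is constantly
    the input.\<close>
  obtain p where p: "runs D (\<lambda>_. 0) 1 p (\<lambda>\<phi> \<rho>. E \<phi> (\<rho> 0))"
    by (rule effectiveE[OF assms, of "\<lambda>_. 0" 1]) simp
  obtain M where M: "\<forall>\<phi>s ns T. exec \<phi>s (p ;; Copy 1 0) (snd (initial_config ns)) T \<longrightarrow>
    machine_output M \<phi>s ns (tape_value (T 0))"
    using machine_of_exec by metis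
  show thesis
  proof (rule that)
    fix \<phi> k assume \<phi>: "\<phi> \<in> D"
    have "\<forall>i. snd (initial_config [k]) 0 = unary_tape k"
      by (simp add: initial_config_def)
    from runsD[where \<rho> = "\<lambda>_. k" and T = "snd (initial_config [k])", OF p \<phi> this] obtain T where
      T: "exec [\<phi>] p (snd (initial_config [k])) T" "T 1 = unary_tape (E \<phi> k)"
      by blast
    have "exec [\<phi>] (Copy 1 0) T (T(0 := unary_tape (E \<phi> k)))"
      using T(2) by (intro exec_Copy) simp_all
    from M[rule_format, OF exec.Seq[OF T(1) this]] show "machine_output M [\<phi>] [k] (E \<phi> k)"
      by (simp add: tape_value_unary_tape)
  qed
qed

section \<open>Simulation of machines by programs\<close>

fun fill :: "(nat \<Rightarrow> prog) \<Rightarrow> nat \<Rightarrow> prog" where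
  "fill P 0 = Skip"
| "fill P (Suc n) = fill P n ;; P n"

text \<open>Each \<open>P m\<close> changes only its own tape, which is not below \<open>N\<close>;
  so the condition on the tapes below \<open>N\<close> persists, and every tape is still in its
  original state when its turn comes.\<close>

lemma exec_fill:
  assumes P: "\<And>m S. m < n \<Longrightarrow> \<forall>i<N. S i = S0 i \<Longrightarrow> exec \<phi>s (P m) S (S(a + m := v m (S (a + m))))"
    and N: "N \<le> a" and S: "\<forall>i<N. S i = S0 i"
  shows "exec \<phi>s (fill P n) S (\<lambda>i. if a \<le> i \<and> i < a + n then v (i - a) (S i) else S i)"
  using P
proof (induction n)
  case 0
  have "(\<lambda>i. if a \<le> i \<and> i < a + 0 then v (i - a) (S i) else S i) = S"
    by (intro ext) auto
  then show ?case by (simp only: fill.simps exec.Skip)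
next
  case (Suc n)
  let ?S = "\<lambda>n i. if a \<le> i \<and> i < a + n then v (i - a) (S i) else S i"
  have IH: "exec \<phi>s (fill P n) S (?S n)"
    by (rule Suc.IH) (rule Suc.prems, simp_all)
  have "\<forall>i<N. ?S n i = S0 i"
    using S N by auto
  from Suc.prems[OF lessI this] have "exec \<phi>s (P n) (?S n) ((?S n)(a + n := v n (?S n (a + n))))" .
  moreover have "(?S n)(a + n := v n (?S n (a + n))) = ?S (Suc n)"
    by (auto simp: fun_eq_iff)
  ultimately have "exec \<phi>s (P n) (?S n) (?S (Suc n))"
    by simp
  from exec.Seq[OF IH this] show ?case
    by (simp only: fill.simps)
qed

fun switch :: "nat \<Rightarrow> nat \<Rightarrow> (symbol list \<Rightarrow> prog) \<Rightarrow> prog" where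
  "switch b 0 K = K []"
| "switch b (Suc n) K =
     If_Mark b (switch (Suc b) n (\<lambda>xs. K (Mark # xs))) (switch (Suc b) n (\<lambda>xs. K (Blank # xs)))"

text \<open>A decision tree on the scanned symbols. In each leaf they are a constant list, and thus
  an arbitrary function \<open>delta\<close> becomes finite code.\<close>

lemma exec_switch:
  assumes "exec \<phi>s (K (map (\<lambda>i. scanned (T (b + i))) [0..<n])) T T'"
  shows "exec \<phi>s (switch b n K) T T'"
  using assms
proof (induction n arbitrary: b K)
  case 0
  then show ?case by simp
next
  case (Suc n)
  have "map (\<lambda>i. scanned (T (b + i))) [0..<Suc n] =
      scanned (T b) # map (\<lambda>i. scanned (T (Suc b + i))) [0..<n]"
    by (simp add: upt_conv_Cons map_Suc_upt[symmetric] del: upt_Suc)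
  with Suc.prems have *: "exec \<phi>s (K (scanned (T b) # map (\<lambda>i. scanned (T (Suc b + i))) [0..<n])) T T'"
    by simp
  show ?case
  proof (cases "scanned (T b)")
    case Mark
    with * show ?thesis
      by (auto intro!: exec.If_Mark Suc.IH)
  next
    case Blank
    with * show ?thesis
      by (auto intro!: exec.If_Blank Suc.IH)
  qed
qed

lemma finite_marks_act:
  "finite {p. snd T p = Mark} \<Longrightarrow> finite {p. snd (act (s, d) T) p = Mark}"
proof (cases T)
  case (Pair p c)
  assume "finite {p. snd T p = Mark}"
  then have "finite (insert p {p. c p = Mark})"
    by (simp add: Pair)
  then show ?thesis
    by (rule rev_finite_subset) (auto simp: Pair)
qed

lemma finite_marks_unary_tape: "finite {p. snd (unary_tape n) p = Mark}"
  by (rule finite_subset[of _ "{0..<int n}"]) (auto simp: unary_tape_def)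

text \<open>\<open>card\<close> is 0 on infinite sets, so a change of one cell shows in the count
  only while the marks are finitely many.\<close>

lemma tape_value_act:
  assumes fin: "finite {p. snd T p = Mark}"
  shows "scanned T = s \<Longrightarrow> tape_value (act (s, d) T) = tape_value T"
    and "scanned T = Blank \<Longrightarrow> tape_value (act (Mark, d) T) = Suc (tape_value T)"
    and "scanned T = Mark \<Longrightarrow> tape_value T = Suc (tape_value (act (Blank, d) T))"
proof -
  obtain p c where T: "T = (p, c)" by (cases T)
  show "tape_value (act (s, d) T) = tape_value T" if "scanned T = s"
  proof -
    have "c(p := s) = c" using that by (auto simp: T scanned_def)
    then show ?thesis by (simp add: T tape_value_def del: fun_upd_apply)
  qed
  show "tape_value (act (Mark, d) T) = Suc (tape_value T)" if "scanned T = Blank"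
  proof -
    have "{q. (c(p := Mark)) q = Mark} = insert p {q. c q = Mark}" by auto
    moreover have "p \<notin> {q. c q = Mark}" using that by (simp add: T scanned_def)
    ultimately show ?thesis using fin by (simp add: T tape_value_def del: fun_upd_apply)
  qed
  show "tape_value T = Suc (tape_value (act (Blank, d) T))" if "scanned T = Mark"
  proof -
    have "{q. c q = Mark} = insert p {q. (c(p := Blank)) q = Mark}"
      using that by (auto simp: T scanned_def)
    moreover have "p \<notin> {q. (c(p := Blank)) q = Mark}" by simp
    moreover have "finite {q. (c(p := Blank)) q = Mark}"
      using fin by (rule rev_finite_subset) (auto simp: T)
    ultimately show ?thesis by (simp add: T tape_value_def del: fun_upd_apply)
  qed
qed

text \<open>The output of a simulated machine counts all marks on its tape 0, and no scan could tell
  that the last one has been seen. Hence the count is updated at every write, from the old and the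
  new symbol.\<close>

definition adjust :: "nat \<Rightarrow> symbol \<Rightarrow> symbol \<Rightarrow> prog" where
  "adjust N s s' = (if s = Blank \<and> s' = Mark then Inc N else if s = Mark \<and> s' = Blank then Dec N else Skip)"

lemma exec_adjust:
  assumes "finite {p. snd T p = Mark}" "S N = unary_tape (tape_value T)"
  shows "exec \<phi>s (adjust N (scanned T) s) S (S(N := unary_tape (tape_value (act (s, d) T))))"
proof -
  consider "scanned T = s" | "scanned T = Blank" "s = Mark" | "scanned T = Mark" "s = Blank"
    by (metis symbol.exhaust)
  then show ?thesis
  proof cases
    case 1
    have "S(N := unary_tape (tape_value (act (s, d) T))) = S"
      using tape_value_act(1)[OF assms(1) 1] assms(2) by auto
    then show ?thesis
      using 1 by (cases s) (simp_all add: adjust_def exec.Skip)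
  next
    case 2
    then show ?thesis
      using exec_Inc[where T = S and t = N, OF assms(2)] tape_value_act(2)[OF assms(1) 2(1), of d]
      by (simp add: adjust_def)
  next
    case 3
    have "S N = unary_tape (Suc (tape_value (act (Blank, d) T)))"
      using assms(2) tape_value_act(3)[OF assms(1) 3(1), of d] by simp
    from exec_Dec[where T = S and t = N, OF this] show ?thesis
      using 3 by (simp add: adjust_def)
  qed
qed

text \<open>
  Tape \<open>N\<close> counts the marks on tape 0 of the simulated machine, tape \<open>N + 1\<close> is marked while the
  machine is running, the next tapes are flags for its states, and its own tapes begin at \<open>base\<close>.
\<close>

locale simulation =
  fixes M :: oracle_machine and call :: "nat \<Rightarrow> nat \<Rightarrow> prog" and N \<tau> :: nat
  assumes tapes: "tapes M \<le> \<tau>" and \<tau>: "0 < \<tau>"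
    and queries: "\<And>q j t q'. q < states M \<Longrightarrow> query M q = Some (j, t, q') \<Longrightarrow> t < \<tau>"
begin

definition flag :: "nat \<Rightarrow> nat" where "flag q = N + 2 + q"
definition base :: nat where "base = N + 2 + states M"

definition set_state :: "nat \<Rightarrow> nat \<Rightarrow> prog" where
  "set_state q q' = Act (flag q) Blank Stay ;;
     (if q' < states M then Act (flag q') Mark Stay else Act (N + 1) Blank Stay)"

definition at_state :: "nat \<Rightarrow> (nat \<Rightarrow> tape) \<Rightarrow> bool" where
  "at_state q S \<longleftrightarrow> S (N + 1) = unary_tape (of_bool (q < states M)) \<and>
     (\<forall>q'<states M. S (flag q') = unary_tape (of_bool (q = q')))"

definition step_prog :: "nat \<Rightarrow> prog" where
  "step_prog q = (case query M q of
       Some (j, t, q') \<Rightarrow> call j (base + t) ;; (if t = 0 then Copy base N else Skip) ;; set_state q q'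
     | None \<Rightarrow> switch base (tapes M) (\<lambda>xs. case delta M q xs of (q', as) \<Rightarrow>
         (if 0 < tapes M then adjust N (xs ! 0) (fst (as ! 0)) else Skip) ;;
         fill (\<lambda>i. Act (base + i) (fst (as ! i)) (snd (as ! i))) (tapes M) ;; set_state q q'))"

fun dispatch :: "nat \<Rightarrow> prog" where
  "dispatch 0 = Skip"
| "dispatch (Suc q) = If_Mark (flag q) (step_prog q) (dispatch q)"

definition main_loop :: prog where
  "main_loop = While_Mark (N + 1) (dispatch (states M))"

definition simulates :: "nat \<times> (nat \<Rightarrow> tape) \<Rightarrow> (nat \<Rightarrow> tape) \<Rightarrow> bool" where
  "simulates = (\<lambda>(q, T) S. S N = unary_tape (tape_value (T 0)) \<and> finite {p. snd (T 0) p = Mark} \<and>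
     at_state q S \<and> (\<forall>i<\<tau>. S (base + i) = T i))"

lemma act_flag:
  "act (Blank, Stay) (unary_tape 1) = unary_tape 0"
  "act (Mark, Stay) (unary_tape 0) = unary_tape 1"
  by (auto simp: unary_tape_def fun_eq_iff)

lemma exec_set_state:
  assumes "at_state q S" "q < states M"
  shows "\<exists>S'. exec \<phi>s (set_state q q') S S' \<and> at_state q' S' \<and> (\<forall>i. i \<le> N \<or> base \<le> i \<longrightarrow> S' i = S i)"
proof -
  let ?S1 = "S(flag q := unary_tape 0)"
  have "S (flag q) = unary_tape 1"
    using assms by (simp add: at_state_def)
  then have 1: "exec \<phi>s (Act (flag q) Blank Stay) S ?S1"
    by (intro exec_ActI) (simp only: act_flag)
  show ?thesis
  proof (cases "q' < states M")
    case True
    have "?S1 (flag q') = unary_tape 0"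
      using assms True by (auto simp: at_state_def flag_def)
    then have "exec \<phi>s (Act (flag q') Mark Stay) ?S1 (?S1(flag q' := unary_tape 1))"
      by (intro exec_ActI) (simp only: act_flag)
    from exec.Seq[OF 1 this] assms True show ?thesis
      by (intro exI[of _ "?S1(flag q' := unary_tape 1)"])
        (auto simp: at_state_def set_state_def flag_def base_def)
  next
    case False
    have "?S1 (N + 1) = unary_tape 1"
      using assms by (simp add: at_state_def flag_def)
    then have "exec \<phi>s (Act (N + 1) Blank Stay) ?S1 (?S1(N + 1 := unary_tape 0))"
      by (intro exec_ActI) (simp only: act_flag)
    from exec.Seq[OF 1 this] assms False show ?thesis
      by (intro exI[of _ "?S1(N + 1 := unary_tape 0)"])
        (auto simp: at_state_def set_state_def flag_def base_def)
  qed
qed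

lemma exec_step_prog:
  assumes sim: "simulates (q, T) S" and q: "q < states M"
    and call: "\<And>j t S. \<forall>i<N. S i = S0 i \<Longrightarrow> N \<le> t \<Longrightarrow>
      exec [\<phi>] (call j t) S (S(t := unary_tape (ask \<psi>s j (tape_value (S t)))))"
    and S0: "\<forall>i<N. S i = S0 i"
  shows "\<exists>S'. exec [\<phi>] (step_prog q) S S' \<and> simulates (machine_step M \<psi>s (q, T)) S' \<and> (\<forall>i<N. S' i = S i)"
proof -
  have SN: "S N = unary_tape (tape_value (T 0))" and fin: "finite {p. snd (T 0) p = Mark}"
    and at: "at_state q S" and ST: "i < \<tau> \<Longrightarrow> S (base + i) = T i" for i
    using sim by (simp_all add: simulates_def)
  have N: "N < base" by (simp add: base_def)
  have at_cong: "at_state q S'" if "\<And>i. N < i \<Longrightarrow> i < base \<Longrightarrow> S' i = S i" for S'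
    using at that by (simp add: at_state_def flag_def base_def)
  show ?thesis
  proof (cases "query M q")
    case None
    define xs where "xs = map (\<lambda>i. scanned (T i)) [0..<tapes M]"
    obtain q' as where d: "delta M q xs = (q', as)" by fastforce
    have xs: "map (\<lambda>i. scanned (S (base + i))) [0..<tapes M] = xs"
      unfolding xs_def by (rule map_cong) (use ST tapes in auto)
    define T' where "T' = (\<lambda>i. if i < tapes M then act (as ! i) (T i) else T i)"
    have step: "machine_step M \<psi>s (q, T) = (q', T')"
      using q d by (simp add: None xs_def[symmetric] T'_def)
    let ?S1 = "S(N := unary_tape (tape_value (T' 0)))"
    have 1: "exec [\<phi>] (if 0 < tapes M then adjust N (xs ! 0) (fst (as ! 0)) else Skip) S ?S1"
    proof (cases "0 < tapes M")
      case True
      then have "xs ! 0 = scanned (T 0)" "T' 0 = act (fst (as ! 0), snd (as ! 0)) (T 0)"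
        by (simp_all add: xs_def T'_def)
      then show ?thesis
        using exec_adjust[where T = "T 0" and S = S and N = N and s = "fst (as ! 0)" and d = "snd (as ! 0)", OF fin SN] True
        by simp
    next
      case False
      then have "?S1 = S"
        using SN by (auto simp: T'_def)
      then show ?thesis
        using False by (simp add: exec.Skip)
    qed
    let ?S2 = "\<lambda>i. if base \<le> i \<and> i < base + tapes M then act (as ! (i - base)) (?S1 i) else ?S1 i"
    have "exec [\<phi>] (fill (\<lambda>i. Act (base + i) (fst (as ! i)) (snd (as ! i))) (tapes M)) ?S1 ?S2"
      by (rule exec_fill[where N = 0 and v = "\<lambda>i. act (as ! i)"]) (simp_all add: exec_ActI)
    note 2 = exec.Seq[OF 1 this]
    have "at_state q ?S2"
      by (rule at_cong) simp
    from exec_set_state[OF this q] obtain S3 where S3: "exec [\<phi>] (set_state q q') ?S2 S3"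
      "at_state q' S3" "\<forall>i. i \<le> N \<or> base \<le> i \<longrightarrow> S3 i = ?S2 i" by blast
    have "exec [\<phi>] (step_prog q) S S3"
      unfolding step_prog_def None option.case
      by (rule exec_switch, unfold xs d prod.case) (rule exec.Seq[OF 2 S3(1)])
    moreover have "simulates (q', T') S3"
      unfolding simulates_def prod.case
    proof (intro conjI allI impI)
      show "S3 N = unary_tape (tape_value (T' 0))"
        using S3(3)[rule_format, of N] N by simp
      show "finite {p. snd (T' 0) p = Mark}"
        using finite_marks_act[OF fin, of "fst (as ! 0)" "snd (as ! 0)"] fin by (simp add: T'_def)
      show "S3 (base + i) = T' i" if "i < \<tau>" for i
        using S3(3)[rule_format, of "base + i"] N ST[OF that] by (simp add: T'_def)
    qed (rule S3(2))
    moreover have "\<forall>i<N. S3 i = S i"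
      using S3(3) N by simp
    ultimately show ?thesis
      unfolding step by blast
  next
    case (Some a)
    then obtain j t q' where Q: "query M q = Some (j, t, q')" by (cases a) auto
    note t = queries[OF q Q]
    define y where "y = ask \<psi>s j (tape_value (T t))"
    define T' where "T' = T(t := unary_tape y)"
    have step: "machine_step M \<psi>s (q, T) = (q', T')"
      using q by (simp add: Q T'_def y_def)
    let ?S1 = "S(base + t := unary_tape y)"
    \<comment> \<open>The simulated tape is stored as it is, so \<open>call\<close> finds the same
      number of marks even if they form no block.\<close>
    have 1: "exec [\<phi>] (call j (base + t)) S ?S1"
      using call[OF S0, of "base + t" j] N ST[OF t] by (simp add: y_def)
    let ?S2 = "?S1(N := unary_tape (tape_value (T' 0)))"
    \<comment> \<open>An answer written to tape 0 is a block starting at cell 0, so the count is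
      obtained by copying it.\<close>
    have "exec [\<phi>] (if t = 0 then Copy base N else Skip) ?S1 ?S2"
    proof (cases "t = 0")
      case True
      have "?S1 base = unary_tape (tape_value (T' 0))"
        using True by (simp add: T'_def tape_value_unary_tape)
      from exec_Copy[where T = ?S1 and s = base and t = N, OF this] N True show ?thesis
        by simp
    next
      case False
      then have "?S1(N := unary_tape (tape_value (T' 0))) = ?S1"
        using SN N by (intro fun_upd_idem) (simp add: T'_def)
      with False show ?thesis
        by (simp only: exec.Skip if_False)
    qed
    note 2 = exec.Seq[OF 1 this]
    have "at_state q ?S2"
      by (rule at_cong) simp
    from exec_set_state[OF this q] obtain S3 where S3: "exec [\<phi>] (set_state q q') ?S2 S3"
      "at_state q' S3" "\<forall>i. i \<le> N \<or> base \<le> i \<longrightarrow> S3 i = ?S2 i" by blast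
    have "exec [\<phi>] (step_prog q) S S3"
      unfolding step_prog_def Q option.case prod.case by (rule exec.Seq[OF 2 S3(1)])
    moreover have "simulates (q', T') S3"
      unfolding simulates_def prod.case
    proof (intro conjI allI impI)
      show "S3 N = unary_tape (tape_value (T' 0))"
        using S3(3)[rule_format, of N] by simp
      show "finite {p. snd (T' 0) p = Mark}"
        using fin finite_marks_unary_tape by (simp add: T'_def)
      show "S3 (base + i) = T' i" if "i < \<tau>" for i
        using S3(3)[rule_format, of "base + i"] N ST[OF that] by (simp add: T'_def)
    qed (rule S3(2))
    moreover have "\<forall>i<N. S3 i = S i"
      using S3(3) N by simp
    ultimately show ?thesis
      unfolding step by blast
  qed
qed

lemma exec_dispatch:
  assumes "exec \<phi>s (step_prog q) S S'" "at_state q S" "q < n" "n \<le> states M"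
  shows "exec \<phi>s (dispatch n) S S'"
  using assms(3,4)
proof (induction n)
  case (Suc n)
  have flag: "S (flag n) = unary_tape (of_bool (q = n))"
    using assms(2) Suc.prems by (simp add: at_state_def)
  show ?case
  proof (cases "q = n")
    case True
    then have "scanned (S (flag n)) = Mark"
      by (simp add: flag scanned_unary_tape)
    from exec.If_Mark[where T = S and t = "flag n", OF this] assms(1) True show ?thesis
      by simp
  next
    case False
    then have "scanned (S (flag n)) = Blank"
      by (simp add: flag scanned_unary_tape)
    from exec.If_Blank[where T = S and t = "flag n", OF this] Suc False show ?thesis
      by simp
  qed
qed simp

text \<open>The answers given by \<open>call\<close> may depend on registers, which lie below
  \<open>N\<close>; \<open>S0\<close> records these tapes for the whole run.\<close>

lemma exec_main_loop:
  assumes call: "\<And>j t S. \<forall>i<N. S i = S0 i \<Longrightarrow> N \<le> t \<Longrightarrow>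
      exec [\<phi>] (call j t) S (S(t := unary_tape (ask \<psi>s j (tape_value (S t)))))"
    and "(machine_step M \<psi>s ^^ k) (q, T) = (q', T')" "states M \<le> q'"
    and "simulates (q, T) S" "\<forall>i<N. S i = S0 i"
  shows "\<exists>S'. exec [\<phi>] main_loop S S' \<and> S' N = unary_tape (tape_value (T' 0)) \<and> (\<forall>i<N. S' i = S0 i)"
  using assms(2-)
proof (induction k arbitrary: q T S)
  have halted: "\<exists>S'. exec [\<phi>] main_loop S S' \<and> S' N = unary_tape (tape_value (T 0)) \<and> (\<forall>i<N. S' i = S0 i)"
    if "states M \<le> q" "simulates (q, T) S" "\<forall>i<N. S i = S0 i" for q T S
  proof -
    have "scanned (S (N + 1)) = Blank" "S N = unary_tape (tape_value (T 0))"
      using that by (simp_all add: simulates_def at_state_def scanned_unary_tape)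
    with exec.While_Blank[where T = S and t = "N + 1", OF this(1)] that show ?thesis
      unfolding main_loop_def by blast
  qed
  {
    case 0
    then show ?case using halted[of q T S] by simp
  next
    case (Suc k)
    show ?case
    proof (cases "q < states M")
      case False
      have "(machine_step M \<psi>s ^^ n) (q, T) = (q, T)" for n
        by (induction n) (use False in auto)
      with Suc.prems halted[of q T S] False show ?thesis by auto
    next
      case True
      from exec_step_prog[OF Suc.prems(3) True call Suc.prems(4)]
      obtain S1 where S1: "exec [\<phi>] (step_prog q) S S1" "simulates (machine_step M \<psi>s (q, T)) S1"
        "\<forall>i<N. S1 i = S i" by blast
      obtain q1 T1 where step: "machine_step M \<psi>s (q, T) = (q1, T1)" by fastforce
      have "(machine_step M \<psi>s ^^ k) (q1, T1) = (q', T')"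
        using Suc.prems(1) step by (simp only: funpow_Suc_right comp_apply)
      moreover have "simulates (q1, T1) S1"
        using S1(2) by (simp only: step)
      moreover have "\<forall>i<N. S1 i = S0 i"
        using S1(3) Suc.prems(4) by simp
      ultimately obtain S' where S': "exec [\<phi>] main_loop S1 S'"
        "S' N = unary_tape (tape_value (T' 0))" "\<forall>i<N. S' i = S0 i"
        using Suc.IH Suc.prems(2) by blast
      have at: "at_state q S"
        using Suc.prems(3) by (simp add: simulates_def)
      then have m: "scanned (S (N + 1)) = Mark"
        using True by (simp add: at_state_def scanned_unary_tape)
      have "exec [\<phi>] main_loop S S'"
        using exec.While_Mark[where t = "N + 1" and T = S, OF m exec_dispatch[OF S1(1) at True order_refl]] S'(1)
        unfolding main_loop_def by blast
      with S' show ?thesis by blast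
    qed
  }
qed

end

section \<open>Initial configuration of the simulated machine\<close>

definition fetch :: "(nat \<Rightarrow> nat) \<Rightarrow> nat \<Rightarrow> nat \<Rightarrow> nat \<Rightarrow> prog" where
  "fetch l k i t = (if i < k then Copy (l i) t else Query (Suc 0) t)"

lemma exec_fetch:
  assumes "\<forall>i. S (l i) = unary_tape (\<rho> i)" "\<forall>i. l i < t"
  shows "exec [\<phi>] (fetch l k i t) S (S(t := unary_tape (if i < k then \<rho> i else 0)))"
proof (cases "i < k")
  case True
  have "l i \<noteq> t" using assms(2) by (metis less_irrefl)
  from exec_Copy[where T = S and s = "l i" and t = t, OF assms(1)[rule_format] this] True show ?thesis
    by (simp add: fetch_def)
next
  case False
  then show ?thesis
    using exec_reset by (simp add: fetch_def)
qed

context simulation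
begin

text \<open>Offsets from \<open>N\<close>: 0 is the mark count, which starts as the first input; 1
  is the running flag; 2 to \<open>states M + 1\<close> are the state flags; the simulated tapes
  follow. The running flag and the flag of state 0 start marked, unless the machine has no states
  and is halted from the beginning.\<close>

definition init_prog :: "(nat \<Rightarrow> nat) \<Rightarrow> nat \<Rightarrow> nat \<Rightarrow> prog" where
  "init_prog l k i =
     (if i = 0 then fetch l k 0 N
      else if i < 3 \<and> 0 < states M then Query (Suc 0) (N + i) ;; Act (N + i) Mark Stay
      else if i < states M + 2 then Query (Suc 0) (N + i)
      else fetch l k (i - (states M + 2)) (N + i))"

lemma exec_init:
  assumes S: "\<forall>i. S (l i) = unary_tape (\<rho> i)" and l: "\<forall>i. l i < N"
  shows "\<exists>S'. exec [\<phi>] (fill (init_prog l k) (states M + 2 + \<tau>)) S S' \<and>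
    simulates (initial_config (map \<rho> [0..<k])) S' \<and> (\<forall>i<N. S' i = S i)"
proof -
  define n where "n i = (if i < k then \<rho> i else 0)" for i
  define v where "v i = unary_tape (if i = 0 then n 0 else if i < 3 \<and> 0 < states M then 1
    else if i < states M + 2 then 0 else n (i - (states M + 2)))" for i
  define S' where "S' = (\<lambda>i. if N \<le> i \<and> i < N + (states M + 2 + \<tau>) then v (i - N) else S i)"
  have init: "exec [\<phi>] (init_prog l k i) R (R(N + i := v i))" if R: "\<forall>i<N. R i = S i" for i R
  proof -
    have Rl: "\<forall>i. R (l i) = unary_tape (\<rho> i)"
      using R l S by simp
    have l': "\<forall>j. l j < N + i"
      using l by (simp add: trans_less_add1)
    have fetch: "exec [\<phi>] (fetch l k j (N + i)) R (R(N + i := unary_tape (n j)))" for j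
      using exec_fetch[OF Rl l'] by (simp add: n_def)
    have reset: "exec [\<phi>] (Query (Suc 0) (N + i)) R (R(N + i := unary_tape 0))"
      by (rule exec_reset)
    have "act (Mark, Stay) (unary_tape 0) = unary_tape 1"
      by (rule act_flag)
    then have "exec [\<phi>] (Act (N + i) Mark Stay) (R(N + i := unary_tape 0)) (R(N + i := unary_tape 1))"
      by (intro exec_ActI) simp
    from exec.Seq[OF reset this] reset fetch show ?thesis
      by (auto simp: init_prog_def v_def split: if_splits)
  qed
  have "exec [\<phi>] (fill (init_prog l k) (states M + 2 + \<tau>)) S S'"
    unfolding S'_def
    by (rule exec_fill[where N = N and S0 = S and v = "\<lambda>i _. v i"], erule init) simp_all
  moreover have T0: "snd (initial_config (map \<rho> [0..<k])) i = unary_tape (n i)" for i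
    by (simp add: initial_config_def n_def)
  have "initial_config (map \<rho> [0..<k]) = (0, \<lambda>i. unary_tape (n i))"
    using T0 by (auto simp: initial_config_def)
  then have "simulates (initial_config (map \<rho> [0..<k])) S'"
    using \<tau> by (auto simp: simulates_def at_state_def flag_def base_def tape_value_unary_tape
      finite_marks_unary_tape S'_def v_def)
  moreover have "\<forall>i<N. S' i = S i"
    by (simp add: S'_def)
  ultimately show ?thesis by blast
qed

end

text \<open>\<open>call\<close> answers the queries of the simulated machine. It is chosen after the
  layout \<open>l\<close>, because the answer may have to be read off a register.\<close>

lemma effective_simulate:
  assumes call: "\<And>l N. \<forall>i. l i < N \<Longrightarrow>
      \<exists>call. \<forall>\<phi>\<in>D. \<forall>\<rho> S j t. (\<forall>i. S (l i) = unary_tape (\<rho> i)) \<longrightarrow> N \<le> t \<longrightarrow>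
        exec [\<phi>] (call j t) S (S(t := unary_tape (ask (\<psi>s \<phi> \<rho>) j (tape_value (S t)))))"
    and out: "\<And>\<phi> \<rho>. \<phi> \<in> D \<Longrightarrow> machine_output M (\<psi>s \<phi> \<rho>) (map \<rho> [0..<k]) (E \<phi> \<rho>)"
  shows "effective D E"
proof (rule effectiveI)
  fix l :: "nat \<Rightarrow> nat" and N
  assume l: "\<forall>i. l i < N"
  from call[OF this] obtain call where call: "\<And>\<phi> \<rho> S j t. \<phi> \<in> D \<Longrightarrow> \<forall>i. S (l i) = unary_tape (\<rho> i) \<Longrightarrow> N \<le> t \<Longrightarrow>
        exec [\<phi>] (call j t) S (S(t := unary_tape (ask (\<psi>s \<phi> \<rho>) j (tape_value (S t)))))"
    by blast
  define Q where "Q = (\<lambda>q. case query M q of None \<Rightarrow> 0 | Some (j, t, q') \<Rightarrow> t) ` {..<states M}"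
  \<comment> \<open>A query may address a tape beyond \<open>tapes M\<close>, so the simulated range
    must reach past those tapes too.\<close>
  define \<tau> where "\<tau> = Suc (tapes M + Max (insert 0 Q))"
  interpret simulation M call N \<tau>
  proof
    fix q j t q' assume "q < states M" "query M q = Some (j, t, q')"
    then have "t \<in> Q"
      unfolding Q_def by (intro image_eqI[of _ _ q]) auto
    then have "t \<le> Max (insert 0 Q)"
      by (intro Max_ge) (auto simp: Q_def)
    then show "t < \<tau>" by (simp add: \<tau>_def)
  qed (simp_all add: \<tau>_def)
  let ?p = "fill (init_prog l k) (states M + 2 + \<tau>) ;; main_loop"
  have "runs D l N ?p E"
  proof (rule runsI)
    fix \<phi> \<rho> T assume \<phi>: "\<phi> \<in> D" and T: "\<forall>i. T (l i) = unary_tape (\<rho> i)"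
    from exec_init[OF T l] obtain S where S: "exec [\<phi>] (fill (init_prog l k) (states M + 2 + \<tau>)) T S"
      "simulates (initial_config (map \<rho> [0..<k])) S" "\<forall>i<N. S i = T i" by blast
    obtain q0 T0 where init: "initial_config (map \<rho> [0..<k]) = (q0, T0)" by fastforce
    from out[OF \<phi>, of \<rho>] obtain n q' T' where run: "(machine_step M (\<psi>s \<phi> \<rho>) ^^ n) (q0, T0) = (q', T')"
      "states M \<le> q'" "tape_value (T' 0) = E \<phi> \<rho>"
      unfolding machine_output_def init by blast
    have "exec [\<phi>] (call j t) S' (S'(t := unary_tape (ask (\<psi>s \<phi> \<rho>) j (tape_value (S' t)))))"
      if "\<forall>i<N. S' i = T i" "N \<le> t" for j t S'
      by (rule call[OF \<phi> _ that(2)]) (use that(1) T l in simp)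
    from exec_main_loop[OF this run(1,2) S(2)[unfolded init] S(3)] obtain S' where
      S': "exec [\<phi>] main_loop S S'" "S' N = unary_tape (tape_value (T' 0))" "\<forall>i<N. S' i = T i" by blast
    show "\<exists>T'. exec [\<phi>] ?p T T' \<and> (\<forall>i<N. T' i = T i) \<and> T' N = unary_tape (E \<phi> \<rho>)"
      using exec.Seq[OF S(1) S'(1)] S'(2,3) run(3) by (intro exI[of _ S']) simp
  qed
  then show "\<exists>p. runs D l N p E" ..
qed

lemma effective_machine:
  assumes "\<And>\<phi> \<rho>. \<phi> \<in> D \<Longrightarrow> machine_output M [\<phi>] (map \<rho> [0..<k]) (E \<phi> \<rho>)"
  shows "effective D E"
proof (rule effective_simulate[OF _ assms])
  show "\<exists>call. \<forall>\<phi>\<in>D. \<forall>\<rho> S j t. (\<forall>i. S (l i) = unary_tape (\<rho> i)) \<longrightarrow> N \<le> t \<longrightarrow>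
        exec [\<phi>] (call j t) S (S(t := unary_tape (ask [\<phi>] j (tape_value (S t)))))"
    for l :: "nat \<Rightarrow> nat" and N
    by (intro exI[of _ Query]) (simp add: exec.Query)
qed

text \<open>In an empty list every oracle is missing, so each query clears its tape, just as the
  reset query does.\<close>

lemma effective_machine_without_oracle:
  assumes "\<And>\<rho>. machine_output M [] (map \<rho> [0..<k]) (E \<rho>)"
  shows "effective D (\<lambda>\<phi>. E)"
proof (rule effective_simulate[OF _ assms])
  show "\<exists>call. \<forall>\<phi>\<in>D. \<forall>\<rho> S j t. (\<forall>i. S (l i) = unary_tape (\<rho> i)) \<longrightarrow> N \<le> t \<longrightarrow>
        exec [\<phi>] (call j t) S (S(t := unary_tape (ask [] j (tape_value (S t)))))"
    for l :: "nat \<Rightarrow> nat" and N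
    by (intro exI[of _ "\<lambda>j. Query (Suc 0)"]) (auto simp: ask_def intro: exec_reset)
qed

text \<open>For evaluation at a point of a dense sequence: the constant oracle
  \<open>\<lambda>_. i\<close> names the \<open>i\<close>-th point exactly, and answering a query
  means copying the register that holds \<open>i\<close>.\<close>

lemma effective_machine_constant_oracle:
  assumes "\<And>\<rho>. machine_output M [\<lambda>_. \<rho> n] (map \<rho> [0..<k]) (E \<rho>)"
  shows "effective D (\<lambda>\<phi>. E)"
proof (rule effective_simulate[OF _ assms])
  fix l :: "nat \<Rightarrow> nat" and N
  assume l: "\<forall>i. l i < N"
  show "\<exists>call. \<forall>\<phi>\<in>D. \<forall>\<rho> S j t. (\<forall>i. S (l i) = unary_tape (\<rho> i)) \<longrightarrow> N \<le> t \<longrightarrow>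
        exec [\<phi>] (call j t) S (S(t := unary_tape (ask [\<lambda>_. \<rho> n] j (tape_value (S t)))))"
  proof (intro exI[of _ "\<lambda>j t. if j = 0 then Copy (l n) t else Query (Suc 0) t"] ballI allI impI)
    fix \<phi> \<rho> S j t
    assume S: "\<forall>i. S (l i) = unary_tape (\<rho> i)" and "N \<le> (t::nat)"
    then have "l n \<noteq> t"
      using l by (metis leD)
    from exec_Copy[where T = S and s = "l n" and t = t, OF S[rule_format] this]
    show "exec [\<phi>] (if j = 0 then Copy (l n) t else Query (Suc 0) t) S
        (S(t := unary_tape (ask [\<lambda>_. \<rho> n] j (tape_value (S t)))))"
      by (simp add: ask_def exec_reset)
  qed
qed

section \<open>Arithmetic of effective functionals\<close>

definition decidable ::
  "(nat \<Rightarrow> nat) set \<Rightarrow> ((nat \<Rightarrow> nat) \<Rightarrow> (nat \<Rightarrow> nat) \<Rightarrow> bool) \<Rightarrow> bool" where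
  "decidable D P \<longleftrightarrow> effective D (\<lambda>\<phi> \<rho>. of_bool (P \<phi> \<rho>))"

lemma decidable_cong:
  assumes "decidable D P" "\<And>\<phi> \<rho>. \<phi> \<in> D \<Longrightarrow> P \<phi> \<rho> = Q \<phi> \<rho>"
  shows "decidable D Q"
  using assms unfolding decidable_def by (elim effective_cong) simp

lemma effective_const: "effective D (\<lambda>\<phi> \<rho>. n)"
  by (induction n) (simp_all add: effective_zero effective_Suc)

lemma effective_add:
  assumes "effective D A" "effective D B"
  shows "effective D (\<lambda>\<phi> \<rho>. A \<phi> \<rho> + B \<phi> \<rho>)"
proof -
  have h: "effective D (\<lambda>\<phi> \<rho>. ((\<lambda>x. Suc x) ^^ B \<phi> \<rho>) (A \<phi> \<rho>))"
    by (intro effective_iterate assms effective_Suc effective_var)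
  have eq: "((\<lambda>x. Suc x) ^^ n) m = m + n" for m n
    by (induction n) simp_all
  show ?thesis by (rule effective_cong[OF h]) (rule eq)
qed

lemma effective_diff:
  assumes "effective D A" "effective D B"
  shows "effective D (\<lambda>\<phi> \<rho>. A \<phi> \<rho> - B \<phi> \<rho>)"
proof -
  have h: "effective D (\<lambda>\<phi> \<rho>. ((\<lambda>x. x - 1) ^^ B \<phi> \<rho>) (A \<phi> \<rho>))"
    by (intro effective_iterate assms effective_pred effective_var)
  have eq: "((\<lambda>x. x - 1) ^^ n) m = m - n" for m n :: nat
    by (induction n) simp_all
  show ?thesis by (rule effective_cong[OF h]) (rule eq)
qed

lemma effective_mult:
  assumes "effective D A" "effective D B"
  shows "effective D (\<lambda>\<phi> \<rho>. A \<phi> \<rho> * B \<phi> \<rho>)"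
proof -
  have h: "effective D (\<lambda>\<phi> \<rho>. ((\<lambda>x. x + A \<phi> \<rho>) ^^ B \<phi> \<rho>) 0)"
    by (intro effective_iterate assms effective_add effective_var effective_zero effective_weaken[OF assms(1)])
  have eq: "((\<lambda>x. x + a) ^^ n) 0 = a * n" for a n :: nat
    by (induction n) simp_all
  show ?thesis by (rule effective_cong[OF h]) (rule eq)
qed

lemma effective_power2:
  assumes "effective D A"
  shows "effective D (\<lambda>\<phi> \<rho>. 2 ^ A \<phi> \<rho>)"
proof -
  have h: "effective D (\<lambda>\<phi> \<rho>. ((\<lambda>x. 2 * x) ^^ A \<phi> \<rho>) (1::nat))"
    by (intro effective_iterate assms effective_mult effective_var effective_const)
  have eq: "((\<lambda>x. 2 * x) ^^ n) 1 = (2 ^ n :: nat)" for n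
    by (induction n) simp_all
  show ?thesis by (rule effective_cong[OF h]) (rule eq)
qed

text \<open>A conditional is an iteration with at most one round, whose body ignores the current
  value.\<close>

lemma effective_If:
  assumes "decidable D P" "effective D A" "effective D B"
  shows "effective D (\<lambda>\<phi> \<rho>. if P \<phi> \<rho> then A \<phi> \<rho> else B \<phi> \<rho>)"
proof -
  have h: "effective D (\<lambda>\<phi> \<rho>. ((\<lambda>x. A \<phi> \<rho>) ^^ of_bool (P \<phi> \<rho>)) (B \<phi> \<rho>))"
    by (intro effective_iterate assms assms(1)[unfolded decidable_def] effective_weaken[OF assms(2)])
  have eq: "((\<lambda>x. a) ^^ of_bool p) b = (if p then a else b)" for a b :: nat and p
    by simp
  show ?thesis by (rule effective_cong[OF h]) (rule eq)
qed

lemma decidable_le: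
  assumes "effective D A" "effective D B"
  shows "decidable D (\<lambda>\<phi> \<rho>. A \<phi> \<rho> \<le> B \<phi> \<rho>)"
proof -
  have "effective D (\<lambda>\<phi> \<rho>. 1 - (A \<phi> \<rho> - B \<phi> \<rho>))"
    by (intro effective_diff effective_const assms)
  moreover have "1 - (a - b) = of_bool (a \<le> b)" for a b :: nat
    by auto
  ultimately show ?thesis by (simp add: decidable_def)
qed

lemma decidable_not:
  assumes "decidable D P"
  shows "decidable D (\<lambda>\<phi> \<rho>. \<not> P \<phi> \<rho>)"
proof -
  have "effective D (\<lambda>\<phi> \<rho>. 1 - of_bool (P \<phi> \<rho>))"
    by (intro effective_diff effective_const assms[unfolded decidable_def])
  moreover have "1 - of_bool p = (of_bool (\<not> p) :: nat)" for p
    by simp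
  ultimately show ?thesis by (simp add: decidable_def)
qed

lemma decidable_conj:
  assumes "decidable D P" "decidable D Q"
  shows "decidable D (\<lambda>\<phi> \<rho>. P \<phi> \<rho> \<and> Q \<phi> \<rho>)"
proof -
  have "effective D (\<lambda>\<phi> \<rho>. of_bool (P \<phi> \<rho>) * of_bool (Q \<phi> \<rho>))"
    by (intro effective_mult assms[unfolded decidable_def])
  then show ?thesis by (simp add: decidable_def of_bool_conj)
qed

lemma decidable_less:
  assumes "effective D A" "effective D B"
  shows "decidable D (\<lambda>\<phi> \<rho>. A \<phi> \<rho> < B \<phi> \<rho>)"
  using decidable_le[OF effective_Suc[OF assms(1)] assms(2)] by (simp add: Suc_le_eq)

lemma decidable_eq:
  assumes "effective D A" "effective D B"
  shows "decidable D (\<lambda>\<phi> \<rho>. A \<phi> \<rho> = B \<phi> \<rho>)"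
  using decidable_conj[OF decidable_le[OF assms] decidable_le[OF assms(2,1)]]
  by (simp add: eq_iff)

lemma effective_Least_decidable:
  assumes P: "decidable D (\<lambda>\<phi> \<rho>. P \<phi> (\<lambda>i. \<rho> (Suc i)) (\<rho> 0))"
    and ex: "\<And>\<phi> \<rho>. \<phi> \<in> D \<Longrightarrow> \<exists>x. P \<phi> \<rho> x"
  shows "effective D (\<lambda>\<phi> \<rho>. LEAST x. P \<phi> \<rho> x)"
proof -
  have "effective D (\<lambda>\<phi> \<rho>. LEAST x. (of_bool (\<not> P \<phi> \<rho> x) :: nat) = 0)"
    by (rule effective_Least) (use decidable_not[OF P] ex in \<open>simp_all add: decidable_def\<close>)
  then show ?thesis by simp
qed

text \<open>The search for a counterexample is stopped at \<open>C\<close> by the added clause, so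
  it always ends, and all instances hold iff it reaches \<open>C\<close>.\<close>

lemma decidable_all:
  assumes P: "decidable D (\<lambda>\<phi> \<rho>. P \<phi> (\<lambda>i. \<rho> (Suc i)) (\<rho> 0))" and C: "effective D C"
  shows "decidable D (\<lambda>\<phi> \<rho>. \<forall>x<C \<phi> \<rho>. P \<phi> \<rho> x)"
proof -
  have "decidable D (\<lambda>\<phi> \<rho>. \<not> (\<rho> 0 < C \<phi> (\<lambda>i. \<rho> (Suc i)) \<and> P \<phi> (\<lambda>i. \<rho> (Suc i)) (\<rho> 0)))"
    by (intro decidable_not decidable_conj decidable_less effective_var effective_weaken[OF C] P)
  then have "effective D (\<lambda>\<phi> \<rho>. LEAST x. \<not> (x < C \<phi> \<rho> \<and> P \<phi> \<rho> x))"
    by (rule effective_Least_decidable) (metis less_irrefl)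
  with C have "decidable D (\<lambda>\<phi> \<rho>. C \<phi> \<rho> \<le> (LEAST x. \<not> (x < C \<phi> \<rho> \<and> P \<phi> \<rho> x)))"
    by (intro decidable_le)
  moreover have "c \<le> (LEAST x. \<not> (x < c \<and> Q x)) \<longleftrightarrow> (\<forall>x<c. Q x)" for c :: nat and Q
  proof
    assume "c \<le> (LEAST x. \<not> (x < c \<and> Q x))"
    then show "\<forall>x<c. Q x"
      using not_less_Least by (metis less_le_trans)
  next
    assume "\<forall>x<c. Q x"
    then show "c \<le> (LEAST x. \<not> (x < c \<and> Q x))"
      using LeastI[of "\<lambda>x. \<not> (x < c \<and> Q x)" c] by (metis less_irrefl linorder_not_le)
  qed
  ultimately show ?thesis by simp
qed

lemma decidable_ex:
  assumes "decidable D (\<lambda>\<phi> \<rho>. P \<phi> (\<lambda>i. \<rho> (Suc i)) (\<rho> 0))" "effective D C"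
  shows "decidable D (\<lambda>\<phi> \<rho>. \<exists>x<C \<phi> \<rho>. P \<phi> \<rho> x)"
  using decidable_not[OF decidable_all[where P = "\<lambda>\<phi> \<rho> x. \<not> P \<phi> \<rho> x", OF decidable_not[OF assms(1)] assms(2)]]
  by simp

text \<open>\<open>I\<close> is a fixed finite set and no register: the conjunction is written out
  in the program, which is how the components of a vector are treated.\<close>

lemma decidable_ball:
  assumes "finite I" "\<And>j. j \<in> I \<Longrightarrow> decidable D (P j)"
  shows "decidable D (\<lambda>\<phi> \<rho>. \<forall>j\<in>I. P j \<phi> \<rho>)"
  using assms
proof (induction I rule: finite_induct)
  case empty
  then show ?case by (simp add: decidable_def effective_const)
next
  case (insert i I)
  then show ?case by (simp add: decidable_conj)
qed

lemmas effective_intros =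
  effective_var effective_const effective_Suc effective_add effective_diff effective_mult
  effective_power2 effective_If decidable_le decidable_less decidable_eq decidable_not
  decidable_conj decidable_all decidable_ex

section \<open>Halving and unpairing\<close>

lemma effective_div2:
  assumes "effective D A"
  shows "effective D (\<lambda>\<phi> \<rho>. A \<phi> \<rho> div 2)"
proof -
  have ex: "\<exists>x. n < 2 * Suc x" for n
    by (rule exI[of _ n]) simp
  have "effective D (\<lambda>\<phi> \<rho>. LEAST x. \<rho> 0 < 2 * Suc x)"
    by (rule effective_Least_decidable, intro effective_intros, rule ex)
  moreover have "(LEAST x. n < 2 * Suc x) = n div 2" for n
    by (rule Least_equality) auto
  ultimately have "effective D (\<lambda>\<phi> \<rho>. \<rho> 0 div 2)"
    by (simp only:)
  then show ?thesis
    by (rule effective_subst1[where F = "\<lambda>\<phi> x. x div 2"]) (rule assms)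
qed

text \<open>\<open>prod_encode (a, b)\<close> is \<open>triangle (a + b) + a\<close>; doubling
  clears the division in \<open>triangle\<close>, and a test by addition and multiplication
  remains.\<close>

lemma prod_decode_iff:
  "prod_decode n = (a, b) \<longleftrightarrow> (a + b) * Suc (a + b) + 2 * a = 2 * n"
proof -
  have "(a + b) * Suc (a + b) = 2 * triangle (a + b)"
    unfolding triangle_def by (simp add: dvd_mult_div_cancel)
  moreover have "prod_decode n = (a, b) \<longleftrightarrow> prod_encode (a, b) = n"
    by (metis prod_decode_inverse prod_encode_inverse)
  ultimately show ?thesis
    by (auto simp: prod_encode_def)
qed

text \<open>Both components are at most the code, so when one is searched for, the other can be
  bounded.\<close>

lemma effective_prod_decode:
  assumes "effective D A"
  shows "effective D (\<lambda>\<phi> \<rho>. fst (prod_decode (A \<phi> \<rho>)))"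
    and "effective D (\<lambda>\<phi> \<rho>. snd (prod_decode (A \<phi> \<rho>)))"
proof -
  have le: "a < Suc n \<and> b < Suc n" if "prod_decode n = (a, b)" for n a b
    using that le_prod_encode_1[of a b] le_prod_encode_2[of b a] by (metis le_imp_less_Suc prod_decode_inverse)
  have fst: "(LEAST a. \<exists>b<Suc n. (a + b) * Suc (a + b) + 2 * a = 2 * n) = fst (prod_decode n)"
    and snd: "(LEAST b. \<exists>a<Suc n. (a + b) * Suc (a + b) + 2 * a = 2 * n) = snd (prod_decode n)"
    and ex: "\<exists>a. \<exists>b<Suc n. (a + b) * Suc (a + b) + 2 * a = 2 * n"
      "\<exists>b. \<exists>a<Suc n. (a + b) * Suc (a + b) + 2 * a = 2 * n" for n
  proof -
    obtain a b where ab: "prod_decode n = (a, b)" by fastforce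
    show "(LEAST a. \<exists>b<Suc n. (a + b) * Suc (a + b) + 2 * a = 2 * n) = fst (prod_decode n)"
      "(LEAST b. \<exists>a<Suc n. (a + b) * Suc (a + b) + 2 * a = 2 * n) = snd (prod_decode n)"
      "\<exists>a. \<exists>b<Suc n. (a + b) * Suc (a + b) + 2 * a = 2 * n"
      "\<exists>b. \<exists>a<Suc n. (a + b) * Suc (a + b) + 2 * a = 2 * n"
      unfolding prod_decode_iff[symmetric] ab using le[OF ab] by (auto intro!: Least_equality)
  qed
  have "effective D (\<lambda>\<phi> \<rho>. LEAST a. \<exists>b<Suc (\<rho> 0). (a + b) * Suc (a + b) + 2 * a = 2 * \<rho> 0)"
    by (rule effective_Least_decidable, intro effective_intros, rule ex)
  from effective_subst1[where F = "\<lambda>\<phi> n. fst (prod_decode n)", OF this[unfolded fst] assms]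
  show "effective D (\<lambda>\<phi> \<rho>. fst (prod_decode (A \<phi> \<rho>)))" .
  have "effective D (\<lambda>\<phi> \<rho>. LEAST b. \<exists>a<Suc (\<rho> 0). (a + b) * Suc (a + b) + 2 * a = 2 * \<rho> 0)"
    by (rule effective_Least_decidable, intro effective_intros, rule ex)
  from effective_subst1[where F = "\<lambda>\<phi> n. snd (prod_decode n)", OF this[unfolded snd] assms]
  show "effective D (\<lambda>\<phi> \<rho>. snd (prod_decode (A \<phi> \<rho>)))" .
qed

text \<open>The values are rational and represented exactly, by three natural numbers; this makes
  comparisons decidable. The successor keeps denominators positive.\<close>

definition effective_real ::
  "(nat \<Rightarrow> nat) set \<Rightarrow> ((nat \<Rightarrow> nat) \<Rightarrow> (nat \<Rightarrow> nat) \<Rightarrow> real) \<Rightarrow> bool" where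
  "effective_real D X \<longleftrightarrow> (\<exists>A B C. effective D A \<and> effective D B \<and> effective D C \<and>
     (\<forall>\<phi>\<in>D. \<forall>\<rho>. X \<phi> \<rho> = (real (A \<phi> \<rho>) - real (B \<phi> \<rho>)) / real (Suc (C \<phi> \<rho>))))"

lemma effective_realI:
  assumes "effective D A" "effective D B" "effective D C"
    and "\<And>\<phi> \<rho>. \<phi> \<in> D \<Longrightarrow> X \<phi> \<rho> = (real (A \<phi> \<rho>) - real (B \<phi> \<rho>)) / real (Suc (C \<phi> \<rho>))"
  shows "effective_real D X"
  using assms unfolding effective_real_def by blast

lemma effective_realE:
  assumes "effective_real D X"
  obtains A B C where "effective D A" "effective D B" "effective D C"
    and "\<And>\<phi> \<rho>. \<phi> \<in> D \<Longrightarrow> X \<phi> \<rho> = (real (A \<phi> \<rho>) - real (B \<phi> \<rho>)) / real (Suc (C \<phi> \<rho>))"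
  using assms unfolding effective_real_def by blast

lemma effective_real_of_nat:
  assumes "effective D A"
  shows "effective_real D (\<lambda>\<phi> \<rho>. real (A \<phi> \<rho>))"
  by (rule effective_realI[OF assms effective_zero effective_zero]) simp

lemma effective_real_zero: "effective_real D (\<lambda>\<phi> \<rho>. 0)"
  using effective_real_of_nat[OF effective_zero, of D] by simp

lemma effective_real_one: "effective_real D (\<lambda>\<phi> \<rho>. 1)"
  using effective_real_of_nat[OF effective_const[of D 1]] by simp

lemma effective_real_numeral: "effective_real D (\<lambda>\<phi> \<rho>. numeral n)"
  using effective_real_of_nat[OF effective_const[of D "numeral n"]] by simp

lemma effective_real_minus:
  assumes "effective_real D X"
  shows "effective_real D (\<lambda>\<phi> \<rho>. - X \<phi> \<rho>)"
proof -
  obtain A B C where "effective D A" "effective D B" "effective D C"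
    and "\<And>\<phi> \<rho>. \<phi> \<in> D \<Longrightarrow> X \<phi> \<rho> = (real (A \<phi> \<rho>) - real (B \<phi> \<rho>)) / real (Suc (C \<phi> \<rho>))"
    using assms by (rule effective_realE) blast
  then show ?thesis
    by (intro effective_realI[of D B A C]) (simp_all add: field_simps)
qed

lemma effective_real_add:
  assumes "effective_real D X" "effective_real D Y"
  shows "effective_real D (\<lambda>\<phi> \<rho>. X \<phi> \<rho> + Y \<phi> \<rho>)"
proof -
  obtain A B C where 1: "effective D A" "effective D B" "effective D C"
    and X: "\<And>\<phi> \<rho>. \<phi> \<in> D \<Longrightarrow> X \<phi> \<rho> = (real (A \<phi> \<rho>) - real (B \<phi> \<rho>)) / real (Suc (C \<phi> \<rho>))"
    using assms(1) by (rule effective_realE) blast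
  obtain A' B' C' where 2: "effective D A'" "effective D B'" "effective D C'"
    and Y: "\<And>\<phi> \<rho>. \<phi> \<in> D \<Longrightarrow> Y \<phi> \<rho> = (real (A' \<phi> \<rho>) - real (B' \<phi> \<rho>)) / real (Suc (C' \<phi> \<rho>))"
    using assms(2) by (rule effective_realE) blast
  \<comment> \<open>\<open>c * Suc c' + c'\<close> is the predecessor of the product of the two
    denominators.\<close>
  have eq: "(a - b) / real (Suc c) + (a' - b') / real (Suc c') =
      (a * real (Suc c') + a' * real (Suc c) - (b * real (Suc c') + b' * real (Suc c))) / real (Suc (c * Suc c' + c'))"
    for a b a' b' c c'
  proof -
    have "real (Suc (c * Suc c' + c')) = real (Suc c) * real (Suc c')"
      by (simp add: algebra_simps)
    then show ?thesis
      by (simp add: divide_simps del: of_nat_Suc) (simp add: algebra_simps del: of_nat_Suc)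
  qed
  show ?thesis
  proof (rule effective_realI)
    show "effective D (\<lambda>\<phi> \<rho>. A \<phi> \<rho> * Suc (C' \<phi> \<rho>) + A' \<phi> \<rho> * Suc (C \<phi> \<rho>))"
      "effective D (\<lambda>\<phi> \<rho>. B \<phi> \<rho> * Suc (C' \<phi> \<rho>) + B' \<phi> \<rho> * Suc (C \<phi> \<rho>))"
      "effective D (\<lambda>\<phi> \<rho>. C \<phi> \<rho> * Suc (C' \<phi> \<rho>) + C' \<phi> \<rho>)"
      by (intro effective_intros 1 2)+
  qed (simp only: X Y eq of_nat_add of_nat_mult)
qed

lemma effective_real_diff:
  assumes "effective_real D X" "effective_real D Y"
  shows "effective_real D (\<lambda>\<phi> \<rho>. X \<phi> \<rho> - Y \<phi> \<rho>)"
  using effective_real_add[OF assms(1) effective_real_minus[OF assms(2)]] by simp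

lemma effective_real_mult:
  assumes "effective_real D X" "effective_real D Y"
  shows "effective_real D (\<lambda>\<phi> \<rho>. X \<phi> \<rho> * Y \<phi> \<rho>)"
proof -
  obtain A B C where 1: "effective D A" "effective D B" "effective D C"
    and X: "\<And>\<phi> \<rho>. \<phi> \<in> D \<Longrightarrow> X \<phi> \<rho> = (real (A \<phi> \<rho>) - real (B \<phi> \<rho>)) / real (Suc (C \<phi> \<rho>))"
    using assms(1) by (rule effective_realE) blast
  obtain A' B' C' where 2: "effective D A'" "effective D B'" "effective D C'"
    and Y: "\<And>\<phi> \<rho>. \<phi> \<in> D \<Longrightarrow> Y \<phi> \<rho> = (real (A' \<phi> \<rho>) - real (B' \<phi> \<rho>)) / real (Suc (C' \<phi> \<rho>))"
    using assms(2) by (rule effective_realE) blast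
  have eq: "((a - b) / real (Suc c)) * ((a' - b') / real (Suc c')) =
      (a * a' + b * b' - (a * b' + b * a')) / real (Suc (c * Suc c' + c'))" for a b a' b' c c'
  proof -
    have "real (Suc (c * Suc c' + c')) = real (Suc c) * real (Suc c')"
      by (simp add: algebra_simps)
    then show ?thesis
      by (simp add: divide_simps del: of_nat_Suc) (simp add: algebra_simps del: of_nat_Suc)
  qed
  show ?thesis
  proof (rule effective_realI)
    show "effective D (\<lambda>\<phi> \<rho>. A \<phi> \<rho> * A' \<phi> \<rho> + B \<phi> \<rho> * B' \<phi> \<rho>)"
      "effective D (\<lambda>\<phi> \<rho>. A \<phi> \<rho> * B' \<phi> \<rho> + B \<phi> \<rho> * A' \<phi> \<rho>)"
      "effective D (\<lambda>\<phi> \<rho>. C \<phi> \<rho> * Suc (C' \<phi> \<rho>) + C' \<phi> \<rho>)"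
      by (intro effective_intros 1 2)+
  qed (simp only: X Y eq of_nat_add of_nat_mult)
qed

lemma decidable_real_less:
  assumes "effective_real D X" "effective_real D Y"
  shows "decidable D (\<lambda>\<phi> \<rho>. X \<phi> \<rho> < Y \<phi> \<rho>)"
proof -
  from effective_real_diff[OF assms(2,1)] obtain A B C where 1: "effective D A" "effective D B" "effective D C"
    and X: "\<And>\<phi> \<rho>. \<phi> \<in> D \<Longrightarrow> Y \<phi> \<rho> - X \<phi> \<rho> = (real (A \<phi> \<rho>) - real (B \<phi> \<rho>)) / real (Suc (C \<phi> \<rho>))"
    by (rule effective_realE) blast
  have "decidable D (\<lambda>\<phi> \<rho>. B \<phi> \<rho> < A \<phi> \<rho>)"
    by (intro effective_intros 1)
  then show ?thesis
  proof (rule decidable_cong)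
    fix \<phi> \<rho> assume "\<phi> \<in> D"
    have "X \<phi> \<rho> < Y \<phi> \<rho> \<longleftrightarrow> 0 < (real (A \<phi> \<rho>) - real (B \<phi> \<rho>)) / real (Suc (C \<phi> \<rho>))"
      by (simp only: X[OF \<open>\<phi> \<in> D\<close>, symmetric] diff_gt_0_iff_gt)
    also have "\<dots> \<longleftrightarrow> B \<phi> \<rho> < A \<phi> \<rho>"
      by (simp add: zero_less_divide_iff)
    finally show "(B \<phi> \<rho> < A \<phi> \<rho>) = (X \<phi> \<rho> < Y \<phi> \<rho>)" ..
  qed
qed

lemma decidable_real_eq:
  assumes "effective_real D X" "effective_real D Y"
  shows "decidable D (\<lambda>\<phi> \<rho>. X \<phi> \<rho> = Y \<phi> \<rho>)"
  by (rule decidable_cong[OF decidable_conj[OF decidable_not decidable_not, OF decidable_real_less[OF assms]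
    decidable_real_less[OF assms(2,1)]]]) auto

lemma effective_real_If:
  assumes P: "decidable D P" and "effective_real D X" "effective_real D Y"
  shows "effective_real D (\<lambda>\<phi> \<rho>. if P \<phi> \<rho> then X \<phi> \<rho> else Y \<phi> \<rho>)"
proof -
  have "effective_real D (\<lambda>\<phi> \<rho>. real (of_bool (P \<phi> \<rho>)) * X \<phi> \<rho> + real (of_bool (\<not> P \<phi> \<rho>)) * Y \<phi> \<rho>)"
    using P decidable_not[OF P] unfolding decidable_def
    by (intro effective_real_add effective_real_mult effective_real_of_nat assms)
  moreover have "real (of_bool p) * x + real (of_bool (\<not> p)) * y = (if p then x else y)" for p x y
    by simp
  ultimately show ?thesis by simp
qed

lemma effective_real_inverse:
  assumes "effective_real D X"
  shows "effective_real D (\<lambda>\<phi> \<rho>. inverse (X \<phi> \<rho>))"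
proof -
  obtain A B C where 1: "effective D A" "effective D B" "effective D C"
    and X: "\<And>\<phi> \<rho>. \<phi> \<in> D \<Longrightarrow> X \<phi> \<rho> = (real (A \<phi> \<rho>) - real (B \<phi> \<rho>)) / real (Suc (C \<phi> \<rho>))"
    using assms by (rule effective_realE) blast
  \<comment> \<open>Denominators must be successors, and \<open>Suc (N - 1)\<close> equals
    \<open>N\<close> when \<open>N\<close> is positive.\<close>
  have pos: "effective_real D (\<lambda>\<phi> \<rho>. 1 / real (Suc (N \<phi> \<rho> - 1)))" if "effective D N" for N
    by (rule effective_realI[OF effective_const[of D 1] effective_zero effective_diff[OF that effective_const[of D 1]]]) simp
  \<comment> \<open>The sign of the numerator selects the truncated difference that becomes the new
    denominator; the value 0 for numerator 0 matches \<open>inverse 0 = 0\<close>.\<close>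
  define Z where "Z \<phi> \<rho> = (if B \<phi> \<rho> < A \<phi> \<rho> then real (Suc (C \<phi> \<rho>)) * (1 / real (Suc (A \<phi> \<rho> - B \<phi> \<rho> - 1)))
      else if A \<phi> \<rho> < B \<phi> \<rho> then - (real (Suc (C \<phi> \<rho>)) * (1 / real (Suc (B \<phi> \<rho> - A \<phi> \<rho> - 1)))) else 0)" for \<phi> \<rho>
  have "effective_real D Z"
    unfolding Z_def
    by (intro effective_real_If effective_real_mult effective_real_minus effective_real_of_nat pos
        effective_real_zero effective_intros 1)
  moreover have "Z \<phi> \<rho> = inverse (X \<phi> \<rho>)" if "\<phi> \<in> D" for \<phi> \<rho>
    unfolding X[OF that] Z_def by (auto simp: field_simps of_nat_diff)
  ultimately show ?thesis
    unfolding effective_real_def by metis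
qed

lemma effective_real_divide:
  assumes "effective_real D X" "effective_real D Y"
  shows "effective_real D (\<lambda>\<phi> \<rho>. X \<phi> \<rho> / Y \<phi> \<rho>)"
  unfolding divide_inverse by (intro effective_real_mult effective_real_inverse assms)

lemma effective_real_abs:
  assumes "effective_real D X"
  shows "effective_real D (\<lambda>\<phi> \<rho>. \<bar>X \<phi> \<rho>\<bar>)"
  unfolding abs_if
  by (intro effective_real_If decidable_real_less effective_real_minus effective_real_zero assms)

lemma effective_real_half_power:
  assumes "effective D A"
  shows "effective_real D (\<lambda>\<phi> \<rho>. (1/2) ^ A \<phi> \<rho>)"
proof -
  have "effective_real D (\<lambda>\<phi> \<rho>. 1 / real (2 ^ A \<phi> \<rho>))"
    by (intro effective_real_divide effective_real_one effective_real_of_nat effective_power2 assms)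
  then show ?thesis by (simp add: power_one_over)
qed

lemma effective_real_sum:
  assumes "finite I" "\<And>j. j \<in> I \<Longrightarrow> effective_real D (X j)"
  shows "effective_real D (\<lambda>\<phi> \<rho>. \<Sum>j\<in>I. X j \<phi> \<rho>)"
  using assms
proof (induction I rule: finite_induct)
  case empty
  then show ?case by (simp add: effective_real_zero)
next
  case (insert i I)
  then show ?case by (simp add: effective_real_add)
qed

lemmas effective_real_intros =
  effective_real_zero effective_real_one effective_real_numeral effective_real_of_nat
  effective_real_minus effective_real_add effective_real_diff effective_real_mult
  effective_real_divide effective_real_abs effective_real_half_power effective_real_If
  decidable_real_less decidable_real_eq

section \<open>Decoding the dense sequences\<close>

lemma real_of_int_int_decode:
  "real_of_int (int_decode n) = (if n = 2 * (n div 2) then real (n div 2) else - real (n div 2) - 1)"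
proof -
  have "n = 2 * (n div 2) \<longleftrightarrow> even n" by presburger
  then show ?thesis
    by (simp add: int_decode_def sum_decode_def)
qed

text \<open>\<open>nat_to_rat_surj\<close> also decodes to fractions with denominator 0; both
  conventions give 0 for them.\<close>

lemma of_rat_Fract: "of_rat (Fract a b) = (of_int a / of_int b :: real)"
  by (cases "b = 0") (simp_all add: of_rat_rat rat_number_collapse)

lemma effective_real_nat_to_rat_surj:
  assumes "effective D A"
  shows "effective_real D (\<lambda>\<phi> \<rho>. real_of_rat (nat_to_rat_surj (A \<phi> \<rho>)))"
  unfolding nat_to_rat_surj_def Let_def case_prod_beta of_rat_Fract real_of_int_int_decode
  by (intro effective_real_intros effective_intros effective_div2 effective_prod_decode assms)

text \<open>Start at the least element and pass repeatedly to the least one beyond the current.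
  Membership is a bounded quantifier over decidable equalities, and each search ends because the set
  is infinite.\<close>

lemma effective_enumerate:
  fixes F :: "nat \<Rightarrow> 'b"
  assumes dec: "decidable D (\<lambda>\<phi> \<rho>. F (\<rho> 0) = F (\<rho> 1))" and inf: "infinite (range F)"
    and A: "effective D A"
  shows "effective D (\<lambda>\<phi> \<rho>. enumerate {c. \<forall>b<c. F b \<noteq> F c} (A \<phi> \<rho>))"
proof -
  let ?S = "{c. \<forall>b<c. F b \<noteq> F c}"
  have "\<exists>c\<in>?S. F c = F a" for a
  proof (intro bexI[of _ "LEAST c. F c = F a"])
    show "F (LEAST c. F c = F a) = F a" by (rule LeastI) (rule refl)
    then show "(LEAST c. F c = F a) \<in> ?S" by (auto dest: not_less_Least)
  qed
  then have "range F \<subseteq> F ` ?S" by (auto simp: image_iff) metis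
  with inf have S: "infinite ?S"
    by (meson finite_imageI finite_subset)
  have ex: "\<exists>c. x \<le> c \<and> (\<forall>b<c. F b \<noteq> F c)" for x
    using S[unfolded infinite_nat_iff_unbounded_le] by blast
  have dec': "decidable D (\<lambda>\<phi> \<rho>. F (B \<phi> \<rho>) = F (C \<phi> \<rho>))" if "effective D B" "effective D C" for B C
    using effective_subst2[where F = "\<lambda>\<phi> b c. of_bool (F b = F c)", OF dec[unfolded decidable_def] that]
    by (simp add: decidable_def)
  let ?next = "\<lambda>x. LEAST c. x \<le> c \<and> (\<forall>b<c. F b \<noteq> F c)"
  have "effective D (\<lambda>\<phi> \<rho>. ((\<lambda>x. ?next (Suc x)) ^^ A \<phi> \<rho>) (?next 0))"
    by (rule effective_iterate[OF A]; rule effective_Least_decidable[OF _ ex]; intro dec' effective_intros)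
  moreover have "((\<lambda>x. ?next (Suc x)) ^^ n) (?next 0) = enumerate ?S n" for n
    by (induction n) (simp_all add: enumerate_0 enumerate_Suc''[OF S] Suc_le_eq conj_commute del: enumerate_Suc)
  ultimately show ?thesis by simp
qed

text \<open>Turns the injectivity of the enumerations of rationals and rational vectors into the
  infinitude that \<open>effective_enumerate\<close> asks for.\<close>

lemma infinite_range_without_repetition:
  assumes "inj (without_repetition F)"
  shows "infinite (range F)"
proof
  assume "finite (range F)"
  moreover have "range (without_repetition F) \<subseteq> range F"
    by (auto simp: without_repetition_def)
  ultimately have "finite (range (without_repetition F))"
    using finite_subset by blast
  with assms show False
    by (simp add: finite_image_iff)
qed

lemma effective_real_rat_enum:
  assumes "effective D A"
  shows "effective_real D (\<lambda>\<phi> \<rho>. rat_enum (A \<phi> \<rho>))"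
  unfolding rat_enum_def without_repetition_def
  by (intro effective_real_nat_to_rat_surj effective_enumerate assms effective_real_intros effective_intros
      infinite_range_without_repetition) (use inj_rat_enum in \<open>simp add: rat_enum_def\<close>)

lemma effective_real_rat_vec_decode:
  assumes "effective D A"
  shows "effective_real D (\<lambda>\<phi> \<rho>. (rat_vec_decode (A \<phi> \<rho>) :: real ^ 'm::finite) $ j)"
proof -
  have "effective D (\<lambda>\<phi> \<rho>. ((snd \<circ> prod_decode) ^^ k) (A \<phi> \<rho>))" for k
  proof (induction k)
    case (Suc k)
    from effective_prod_decode(2)[OF this] show ?case by simp
  qed (simp add: assms)
  then show ?thesis
    unfolding rat_vec_decode_def vec_lambda_beta
    by (intro effective_real_nat_to_rat_surj effective_prod_decode)
qed

lemma effective_real_rat_vec_enum: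
  assumes "effective D A"
  shows "effective_real D (\<lambda>\<phi> \<rho>. (rat_vec_enum (A \<phi> \<rho>) :: real ^ 'm::finite) $ j)"
proof -
  have "decidable D (\<lambda>\<phi> \<rho>. \<forall>j\<in>UNIV. (rat_vec_decode (\<rho> 0) :: real ^ 'm) $ j = rat_vec_decode (\<rho> 1) $ j)"
    by (intro decidable_ball decidable_real_eq effective_real_rat_vec_decode effective_var finite)
  then have "decidable D (\<lambda>\<phi> \<rho>. (rat_vec_decode (\<rho> 0) :: real ^ 'm) = rat_vec_decode (\<rho> 1))"
    by (simp add: vec_eq_iff)
  moreover have "infinite (range (rat_vec_decode :: nat \<Rightarrow> real ^ 'm))"
    using inj_rat_vec_enum unfolding rat_vec_enum_def by (rule infinite_range_without_repetition)
  ultimately show ?thesis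
    unfolding rat_vec_enum_def without_repetition_def
    by (intro effective_real_rat_vec_decode effective_enumerate assms)
qed

section \<open>Entropy of finite partitions\<close>

text \<open>Shannon entropy of \<open>X\<close> as a random variable. With maps in place of
  partitions, joining two partitions is pairing, and their elements carry labels to sum
  over.\<close>

definition fiber_entropy :: "'a measure \<Rightarrow> ('a \<Rightarrow> 'b) \<Rightarrow> real" where
  "fiber_entropy \<mu> X = - (\<Sum>w\<in>range X. measure \<mu> (X -` {w}) * ln (measure \<mu> (X -` {w})))"

text \<open>Values that are not attained have empty fibers and contribute
  \<open>0 * ln 0 = 0\<close>.\<close>

lemma fiber_entropy_superset:
  assumes "finite W" "range X \<subseteq> W"
  shows "fiber_entropy \<mu> X = - (\<Sum>w\<in>W. measure \<mu> (X -` {w}) * ln (measure \<mu> (X -` {w})))"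
proof -
  have "X -` {w} = {}" if "w \<in> W - range X" for w
    using that by auto
  then show ?thesis
    unfolding fiber_entropy_def using assms by (subst sum.mono_neutral_left[of W "range X"]) auto
qed

lemma partition_entropy_fibers: "partition_entropy \<mu> (range (\<lambda>x. X -` {X x})) = fiber_entropy \<mu> X"
proof -
  have "range (\<lambda>x. X -` {X x}) = (\<lambda>w. X -` {w}) ` range X"
    by auto
  moreover have "inj_on (\<lambda>w. X -` {w}) (range X)"
    by (rule inj_onI) (metis insertI1 rangeE singletonD vimage_singleton_eq)
  ultimately show ?thesis
    by (simp add: partition_entropy_def fiber_entropy_def sum.reindex)
qed

lemma fiber_entropy_inj:
  assumes "inj_on g (range X)"
  shows "fiber_entropy \<mu> (\<lambda>x. g (X x)) = fiber_entropy \<mu> X"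
proof -
  have "(\<lambda>x. g (X x)) -` {g w} = X -` {w}" if "w \<in> range X" for w
    using that assms by (auto dest: inj_onD)
  moreover have "range (\<lambda>x. g (X x)) = g ` range X"
    by auto
  ultimately show ?thesis
    using assms by (simp add: fiber_entropy_def sum.reindex)
qed

lemma (in prob_space) fiber_entropy_nonneg: "0 \<le> fiber_entropy M X"
  unfolding fiber_entropy_def neg_0_le_iff_le
proof (rule sum_nonpos)
  fix w
  show "prob (X -` {w}) * ln (prob (X -` {w})) \<le> 0"
    by (cases "prob (X -` {w}) = 0") (auto simp: mult_le_0_iff zero_less_measure_iff intro!: measure_nonneg)
qed

text \<open>Gibbs' inequality: \<open>ln x \<le> x - 1\<close> at
  \<open>x = q a * r b / p a b\<close> compares the joint law with the product of its marginals, and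
  both have total mass 1.\<close>

lemma (in prob_space) fiber_entropy_Pair_le:
  assumes X: "simple_function M X" and Y: "simple_function M Y" and space: "space M = UNIV"
  shows "fiber_entropy M (\<lambda>x. (X x, Y x)) \<le> fiber_entropy M X + fiber_entropy M Y"
proof -
  define A where "A = range X"
  define B where "B = range Y"
  have fin: "finite A" "finite B"
    using X Y by (simp_all add: simple_function_def space A_def B_def)
  have XY: "X -` {a} \<in> sets M" "Y -` {b} \<in> sets M" for a b
    using simple_functionD(2)[OF X, of "{a}"] simple_functionD(2)[OF Y, of "{b}"] by (simp_all add: space)
  define p where "p a b = prob (X -` {a} \<inter> Y -` {b})" for a b
  define q where "q a = prob (X -` {a})" for a
  define r where "r b = prob (Y -` {b})" for b
  have q: "q a = (\<Sum>b\<in>B. p a b)" for a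
  proof -
    have "X -` {a} = (\<Union>b\<in>B. X -` {a} \<inter> Y -` {b})" by (auto simp: B_def)
    moreover have "prob (\<Union>b\<in>B. X -` {a} \<inter> Y -` {b}) = (\<Sum>b\<in>B. p a b)"
      unfolding p_def by (rule finite_measure_finite_Union) (use fin XY in \<open>auto simp: disjoint_family_on_def\<close>)
    ultimately show ?thesis by (simp add: q_def)
  qed
  have r: "r b = (\<Sum>a\<in>A. p a b)" for b
  proof -
    have "Y -` {b} = (\<Union>a\<in>A. X -` {a} \<inter> Y -` {b})" by (auto simp: A_def)
    moreover have "prob (\<Union>a\<in>A. X -` {a} \<inter> Y -` {b}) = (\<Sum>a\<in>A. p a b)"
      unfolding p_def by (rule finite_measure_finite_Union) (use fin XY in \<open>auto simp: disjoint_family_on_def\<close>)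
    ultimately show ?thesis by (simp add: r_def)
  qed
  have q1: "(\<Sum>a\<in>A. q a) = 1"
  proof -
    have "UNIV = (\<Union>a\<in>A. X -` {a})" by (auto simp: A_def)
    moreover have "prob (\<Union>a\<in>A. X -` {a}) = (\<Sum>a\<in>A. q a)"
      unfolding q_def by (rule finite_measure_finite_Union) (use fin XY in \<open>auto simp: disjoint_family_on_def\<close>)
    ultimately show ?thesis using prob_space by (simp add: space)
  qed
  have r1: "(\<Sum>b\<in>B. r b) = 1"
  proof -
    have "UNIV = (\<Union>b\<in>B. Y -` {b})" by (auto simp: B_def)
    moreover have "prob (\<Union>b\<in>B. Y -` {b}) = (\<Sum>b\<in>B. r b)"
      unfolding r_def by (rule finite_measure_finite_Union) (use fin XY in \<open>auto simp: disjoint_family_on_def\<close>)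
    ultimately show ?thesis using prob_space by (simp add: space)
  qed
  have gibbs: "p a b * ln (q a) + p a b * ln (r b) - p a b * ln (p a b) \<le> q a * r b - p a b" for a b
  proof (cases "p a b = 0")
    case True
    then show ?thesis by (simp add: q_def r_def)
  next
    case False
    then have pos: "0 < p a b" by (simp add: p_def zero_less_measure_iff)
    have "p a b \<le> q a" "p a b \<le> r b"
      unfolding p_def q_def r_def by (intro finite_measure_mono; use XY in auto)+
    with pos have qr: "0 < q a" "0 < r b" by linarith+
    have "ln (q a * r b / p a b) \<le> q a * r b / p a b - 1"
      using pos qr by (intro ln_le_minus_one) simp
    then have "p a b * ln (q a * r b / p a b) \<le> p a b * (q a * r b / p a b - 1)"
      using pos by (intro mult_left_mono) simp_all
    also have "\<dots> = q a * r b - p a b"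
      using pos by (simp add: field_simps)
    finally show ?thesis
      using pos qr by (simp add: ln_mult ln_div algebra_simps)
  qed
  have "(\<Sum>a\<in>A. \<Sum>b\<in>B. p a b * ln (q a) + p a b * ln (r b) - p a b * ln (p a b)) \<le>
      (\<Sum>a\<in>A. \<Sum>b\<in>B. q a * r b - p a b)"
    by (intro sum_mono gibbs)
  also have "\<dots> = 0"
    by (simp add: sum_subtractf sum_distrib_left[symmetric] r1 q[symmetric])
  finally have "(\<Sum>a\<in>A. \<Sum>b\<in>B. p a b * ln (q a)) + (\<Sum>a\<in>A. \<Sum>b\<in>B. p a b * ln (r b)) -
      (\<Sum>a\<in>A. \<Sum>b\<in>B. p a b * ln (p a b)) \<le> 0"
    by (simp add: sum_subtractf sum.distrib)
  moreover have "(\<Sum>a\<in>A. \<Sum>b\<in>B. p a b * ln (q a)) = (\<Sum>a\<in>A. q a * ln (q a))"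
    by (simp add: q sum_distrib_right)
  moreover have "(\<Sum>a\<in>A. \<Sum>b\<in>B. p a b * ln (r b)) = (\<Sum>b\<in>B. r b * ln (r b))"
    by (subst sum.swap) (simp add: r sum_distrib_right)
  moreover have "fiber_entropy M (\<lambda>x. (X x, Y x)) = - (\<Sum>a\<in>A. \<Sum>b\<in>B. p a b * ln (p a b))"
  proof -
    have "(\<lambda>x. (X x, Y x)) -` {w} = X -` {fst w} \<inter> Y -` {snd w}" for w by (cases w) auto
    moreover have "range (\<lambda>x. (X x, Y x)) \<subseteq> A \<times> B" by (auto simp: A_def B_def)
    ultimately show ?thesis
      using fiber_entropy_superset[of "A \<times> B" "\<lambda>x. (X x, Y x)" M] fin
      by (simp add: p_def sum.cartesian_product split_def)
  qed
  ultimately show ?thesis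
    by (simp add: fiber_entropy_def A_def B_def q_def r_def)
qed

lemma fiber_entropy_invariant:
  assumes "\<And>w. measure \<mu> (T -` (X -` {w})) = measure \<mu> (X -` {w})" "finite (range X)"
  shows "fiber_entropy \<mu> (\<lambda>x. X (T x)) = fiber_entropy \<mu> X"
proof -
  have "(\<lambda>x. X (T x)) -` {w} = T -` (X -` {w})" for w by auto
  then show ?thesis
    using assms by (subst fiber_entropy_superset[of "range X"]) (auto simp: fiber_entropy_def)
qed

section \<open>Entropy of invariant measures\<close>

text \<open>Fekete's lemma: the limit is the infimum \<open>L\<close>. For \<open>k\<close> with
  \<open>u k / k\<close> close to \<open>L\<close>, writing \<open>n = q * k + n mod k\<close>
  bounds \<open>u n\<close> by \<open>q * u k\<close> plus one of finitely many remainder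
  terms.\<close>

lemma fekete_convergent:
  fixes u :: "nat \<Rightarrow> real"
  assumes sub: "\<And>m n. u (m + n) \<le> u m + u n" and nonneg: "\<And>n. 0 \<le> u n"
  shows "convergent (\<lambda>n. u n / real n)"
proof -
  define L where "L = (INF n\<in>{1..}. u n / real n)"
  have bdd: "bdd_below ((\<lambda>n. u n / real n) ` {1..})"
    by (rule bdd_belowI2[of _ 0]) (simp add: nonneg)
  have le: "L \<le> u n / real n" if "1 \<le> n" for n
    unfolding L_def by (rule cINF_lower[OF bdd]) (use that in simp)
  \<comment> \<open>For \<open>q = 0\<close> this would say \<open>u 0 \<le> 0\<close>, which is not
    assumed; hence \<open>n\<close> is taken larger than \<open>k\<close> below.\<close>
  have mult: "u (q * k) \<le> real q * u k" if "1 \<le> q" for q k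
    using that
  proof (induction q rule: dec_induct)
    case (step q)
    then show ?case using sub[of k "q * k"] by (simp add: algebra_simps)
  qed simp
  have "(\<lambda>n. u n / real n) \<longlonglongrightarrow> L"
  proof (rule LIMSEQ_I)
    fix e :: real assume e: "0 < e"
    have "\<exists>k\<in>{1..}. u k / real k < L + e / 2"
      using cINF_less_iff[OF _ bdd, of "L + e / 2"] e by (auto simp: L_def)
    then obtain k where k: "1 \<le> k" "u k / real k < L + e / 2" by auto
    define C where "C = (\<Sum>r<k. u r)"
    have C: "u r \<le> C" if "r < k" for r
      unfolding C_def using that nonneg by (intro member_le_sum) auto
    have C0: "0 \<le> C" unfolding C_def by (intro sum_nonneg nonneg)
    obtain N :: nat where N: "2 * C / e < real N" using reals_Archimedean2 by blast
    show "\<exists>no. \<forall>n\<ge>no. norm (u n / real n - L) < e"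
    proof (intro exI[of _ "Suc (N + k)"] allI impI)
      fix n assume n: "Suc (N + k) \<le> n"
      define q where "q = n div k"
      have q: "1 \<le> q" using n k(1) by (simp add: q_def div_greater_zero_iff Suc_leI)
      have nq: "n = q * k + n mod k" by (simp add: q_def)
      have "u n \<le> u (q * k) + u (n mod k)"
        using sub[of "q * k" "n mod k"] nq by simp
      also have "\<dots> \<le> real q * u k + C"
        using mult[OF q] C[of "n mod k"] k(1) by (intro add_mono) simp_all
      also have "real q * u k = real (q * k) * (u k / real k)"
        using k(1) by simp
      also have "\<dots> \<le> real n * (u k / real k)"
      proof (rule mult_right_mono)
        show "real (q * k) \<le> real n" unfolding q_def by (simp only: of_nat_le_iff div_times_less_eq_dividend)
      qed (simp add: nonneg)
      finally have "u n \<le> real n * (u k / real k) + C" by simp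
      then have "u n / real n \<le> (real n * (u k / real k) + C) / real n"
        using n by (intro divide_right_mono) simp_all
      also have "\<dots> = u k / real k + C / real n"
        using n by (simp add: add_divide_distrib)
      also have "C / real n < e / 2"
      proof -
        have "2 * C < e * real N" using N e by (simp add: field_simps)
        also have "\<dots> \<le> e * real n" using n e by (intro mult_left_mono) simp_all
        finally show ?thesis using n by (simp add: field_simps)
      qed
      finally have "u n / real n < L + e" using k(2) by linarith
      with le[of n] n show "norm (u n / real n - L) < e" by simp
    qed
  qed
  then show ?thesis by (rule convergentI)
qed

section \<open>Partitions followed along orbits\<close>

definition cell :: "'a set set \<Rightarrow> 'a \<Rightarrow> 'a set" where
  "cell P x = (THE A. A \<in> P \<and> x \<in> A)"

text \<open>The fibers of this map are the elements of the dynamical refinement; as a list it splits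
  at any time into two shorter itineraries.\<close>

definition itinerary :: "('a \<Rightarrow> 'a) \<Rightarrow> 'a set set \<Rightarrow> nat \<Rightarrow> 'a \<Rightarrow> 'a set list" where
  "itinerary f P n x = map (\<lambda>i. cell P ((f ^^ i) x)) [0..<n]"

lemma cell_eq:
  assumes "partition_on UNIV P" "A \<in> P" "x \<in> A"
  shows "cell P x = A"
  unfolding cell_def
proof (rule the_equality)
  fix B assume "B \<in> P \<and> x \<in> B"
  with assms show "B = A"
    unfolding partition_on_def disjoint_def by blast
qed (use assms in simp)

lemma cell_in:
  assumes "partition_on UNIV P"
  shows "cell P x \<in> P" "x \<in> cell P x"
proof -
  obtain A where "A \<in> P" "x \<in> A"
    using assms unfolding partition_on_def by blast
  then show "cell P x \<in> P" "x \<in> cell P x"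
    using cell_eq[OF assms] by simp_all
qed

text \<open>A nonempty intersection of one chosen cell per partition is the class of any of its
  points, because each partition has exactly one cell through that point.\<close>

lemma common_refinement_cells:
  assumes "\<And>P x. P \<in> \<P> \<Longrightarrow> \<exists>!A. A \<in> P \<and> x \<in> A"
  shows "common_refinement \<P> = range (\<lambda>x. {y. \<forall>P\<in>\<P>. \<forall>A\<in>P. x \<in> A \<longleftrightarrow> y \<in> A})"
proof (intro equalityI subsetI)
  fix Z assume "Z \<in> common_refinement \<P>"
  then obtain g x where g: "\<And>P. P \<in> \<P> \<Longrightarrow> g P \<in> P" and Z: "Z = \<Inter> (g ` \<P>)" and x: "x \<in> Z"
    by (auto simp: common_refinement)
  have "y \<in> Z \<longleftrightarrow> (\<forall>P\<in>\<P>. \<forall>A\<in>P. x \<in> A \<longleftrightarrow> y \<in> A)" for y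
  proof
    assume y: "y \<in> Z"
    show "\<forall>P\<in>\<P>. \<forall>A\<in>P. x \<in> A \<longleftrightarrow> y \<in> A"
    proof (intro ballI)
      fix P A assume "P \<in> \<P>" "A \<in> P"
      moreover have "x \<in> g P" "y \<in> g P" using x y Z \<open>P \<in> \<P>\<close> by auto
      ultimately show "x \<in> A \<longleftrightarrow> y \<in> A" using assms g by metis
    qed
  next
    assume "\<forall>P\<in>\<P>. \<forall>A\<in>P. x \<in> A \<longleftrightarrow> y \<in> A"
    then show "y \<in> Z" using x g unfolding Z by blast
  qed
  then show "Z \<in> range (\<lambda>x. {y. \<forall>P\<in>\<P>. \<forall>A\<in>P. x \<in> A \<longleftrightarrow> y \<in> A})"
    by (intro image_eqI[of _ _ x]) auto
next
  fix Z assume "Z \<in> range (\<lambda>x. {y. \<forall>P\<in>\<P>. \<forall>A\<in>P. x \<in> A \<longleftrightarrow> y \<in> A})"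
  then obtain x where Z: "Z = {y. \<forall>P\<in>\<P>. \<forall>A\<in>P. x \<in> A \<longleftrightarrow> y \<in> A}" by blast
  have "\<forall>P\<in>\<P>. \<exists>A. A \<in> P \<and> x \<in> A" using assms by blast
  then obtain g where g: "\<And>P. P \<in> \<P> \<Longrightarrow> g P \<in> P \<and> x \<in> g P" by metis
  have "Z = \<Inter> (g ` \<P>)"
  proof (intro equalityI subsetI)
    fix y assume "y \<in> Z" then show "y \<in> \<Inter> (g ` \<P>)" using g unfolding Z by blast
  next
    fix y assume y: "y \<in> \<Inter> (g ` \<P>)"
    show "y \<in> Z" unfolding Z
    proof (intro CollectI ballI)
      fix P A assume "P \<in> \<P>" "A \<in> P"
      moreover have "y \<in> g P" using y \<open>P \<in> \<P>\<close> by blast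
      ultimately show "x \<in> A \<longleftrightarrow> y \<in> A" using assms g by metis
    qed
  qed
  moreover have "x \<in> Z" by (simp add: Z)
  ultimately show "Z \<in> common_refinement \<P>"
    using g by (auto simp: common_refinement)
qed

lemma dynamical_refinement_fibers:
  assumes P: "partition_on UNIV P"
  shows "dynamical_refinement f P n = range (\<lambda>x. itinerary f P n -` {itinerary f P n x})"
proof -
  let ?\<P> = "(\<lambda>i. (\<lambda>A. (f ^^ i) -` A) ` P) ` {..<n}"
  have "\<exists>!A. A \<in> Q \<and> x \<in> A" if "Q \<in> ?\<P>" for Q x
  proof -
    from that obtain i where Q: "Q = (\<lambda>A. (f ^^ i) -` A) ` P" by blast
    show ?thesis
    proof (rule ex1I)
      show "(f ^^ i) -` cell P ((f ^^ i) x) \<in> Q \<and> x \<in> (f ^^ i) -` cell P ((f ^^ i) x)"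
        using cell_in[OF P] by (simp add: Q)
    next
      fix A assume "A \<in> Q \<and> x \<in> A"
      then show "A = (f ^^ i) -` cell P ((f ^^ i) x)"
        using cell_eq[OF P] by (auto simp: Q)
    qed
  qed
  then have "dynamical_refinement f P n = range (\<lambda>x. {y. \<forall>Q\<in>?\<P>. \<forall>A\<in>Q. x \<in> A \<longleftrightarrow> y \<in> A})"
    unfolding dynamical_refinement_def by (rule common_refinement_cells)
  moreover have "(\<forall>Q\<in>?\<P>. \<forall>A\<in>Q. x \<in> A \<longleftrightarrow> y \<in> A) \<longleftrightarrow> itinerary f P n y = itinerary f P n x" for x y
  proof -
    have "(\<forall>A\<in>P. a \<in> A \<longleftrightarrow> b \<in> A) \<longleftrightarrow> cell P b = cell P a" for a b
      using cell_in[OF P] cell_eq[OF P] by metis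
    then show ?thesis
      by (simp add: itinerary_def lessThan_atLeast0)
  qed
  ultimately show ?thesis
    by (simp add: vimage_def)
qed

lemma itinerary_add:
  "itinerary f P (m + n) x = itinerary f P m x @ itinerary f P n ((f ^^ m) x)"
proof -
  have "map (\<lambda>i. cell P ((f ^^ i) x)) [m..<m + n] = map (\<lambda>i. cell P ((f ^^ (i + m)) x)) [0..<n]"
    by (rule nth_equalityI) (simp_all add: add.commute)
  then show ?thesis
    by (simp add: itinerary_def upt_add_eq_append[of 0 m n] funpow_add)
qed

lemma invariant_measuresD:
  assumes "\<mu> \<in> invariant_measures f"
  shows "prob_space \<mu>" "sets \<mu> = sets borel" "space \<mu> = UNIV"
    and "A \<in> sets borel \<Longrightarrow> emeasure \<mu> (f -` A) = emeasure \<mu> A"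
  using assms sets_eq_imp_space_eq[of \<mu> borel] by (auto simp: invariant_measures_def)

lemma invariant_measure_funpow:
  assumes \<mu>: "\<mu> \<in> invariant_measures f" and f: "f \<in> borel_measurable borel" and A: "A \<in> sets borel"
  shows "measure \<mu> ((f ^^ n) -` A) = measure \<mu> A"
proof -
  have *: "(f ^^ n) -` A \<in> sets borel \<and> emeasure \<mu> ((f ^^ n) -` A) = emeasure \<mu> A" for n
  proof (induction n)
    case (Suc n)
    have "(f ^^ Suc n) -` A = f -` ((f ^^ n) -` A)"
      by (simp only: funpow_Suc_right vimage_comp)
    moreover have "f -` ((f ^^ n) -` A) \<in> sets borel"
      using measurable_sets[OF f, of "(f ^^ n) -` A"] Suc by simp
    ultimately show ?case
      using Suc invariant_measuresD(4)[OF \<mu>] by (simp del: funpow.simps)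
  qed (simp add: A)
  then show ?thesis by (simp add: measure_def)
qed

lemma measurable_funpow_borel:
  fixes f :: "'a::topological_space \<Rightarrow> 'a"
  shows "f \<in> borel_measurable borel \<Longrightarrow> f ^^ n \<in> borel_measurable borel"
proof (induction n)
  case (Suc n)
  then show ?case using measurable_comp[of "f ^^ n" borel borel f borel] by simp
qed simp

lemma simple_function_itinerary:
  assumes P: "partition_on UNIV P" "finite P" "P \<subseteq> sets borel" and f: "f \<in> borel_measurable borel"
  shows "simple_function borel (itinerary f P n)"
proof (induction n)
  case 0
  then show ?case by (simp add: itinerary_def)
next
  case (Suc n)
  have "simple_function borel (\<lambda>x. cell P ((f ^^ n) x))"
    unfolding simple_function_def
  proof (intro conjI ballI)
    show "finite ((\<lambda>x. cell P ((f ^^ n) x)) ` space borel)"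
      by (rule finite_subset[OF _ P(2)]) (use cell_in(1)[OF P(1)] in auto)
    fix w assume "w \<in> (\<lambda>x. cell P ((f ^^ n) x)) ` space borel"
    then have w: "w \<in> P" using cell_in(1)[OF P(1)] by auto
    have "(\<lambda>x. cell P ((f ^^ n) x)) -` {w} = (f ^^ n) -` w"
      using cell_eq[OF P(1) w] cell_in(2)[OF P(1)] by auto
    then show "(\<lambda>x. cell P ((f ^^ n) x)) -` {w} \<inter> space borel \<in> sets borel"
      using measurable_sets[OF measurable_funpow_borel[OF f], of w n] w P(3) by auto
  qed
  from simple_function_compose2[OF Suc this, of "\<lambda>xs x. xs @ [x]"] show ?case
    by (simp add: itinerary_def)
qed

text \<open>Splitting an itinerary at time \<open>m\<close> gives subadditivity, since by invariance
  the second half has the law of an itinerary of length \<open>n\<close>. The \<open>lim\<close> in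
  the definition is thereby a true limit, and inequalities pass to it.\<close>

lemma metric_entropy_partition_tendsto:
  assumes \<mu>: "\<mu> \<in> invariant_measures f" and f: "f \<in> borel_measurable borel"
    and P: "partition_on UNIV P" "finite P" "P \<subseteq> sets borel"
  shows "(\<lambda>n. fiber_entropy \<mu> (itinerary f P n) / real n) \<longlonglongrightarrow> metric_entropy_partition \<mu> f P"
proof -
  interpret prob_space \<mu> by (rule invariant_measuresD(1)[OF \<mu>])
  note simple = simple_function_itinerary[OF P f]
  have simple': "simple_function \<mu> (itinerary f P n)" for n
    using simple by (simp add: simple_function_def invariant_measuresD(2,3)[OF \<mu>])
  have "fiber_entropy \<mu> (itinerary f P (m + n)) \<le> fiber_entropy \<mu> (itinerary f P m) + fiber_entropy \<mu> (itinerary f P n)"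
    for m n
  proof -
    have "simple_function borel (\<lambda>x. itinerary f P n ((f ^^ m) x))"
    proof -
      \<comment> \<open>The shifted itinerary is the tail of a longer one, already known to be
        simple.\<close>
      have "simple_function borel (\<lambda>x. drop m (itinerary f P (m + n) x))"
        by (rule simple_function_compose1[OF simple])
      then show ?thesis by (simp add: itinerary_add) (simp add: itinerary_def)
    qed
    then have s: "simple_function \<mu> (\<lambda>x. itinerary f P n ((f ^^ m) x))"
      by (simp add: simple_function_def invariant_measuresD(2,3)[OF \<mu>])
    \<comment> \<open>The first itinerary has fixed length \<open>m\<close>, so concatenation loses
      nothing.\<close>
    have "inj_on (\<lambda>(xs, ys). xs @ ys) (range (\<lambda>x. (itinerary f P m x, itinerary f P n ((f ^^ m) x))))"
      by (rule inj_onI) (auto simp: itinerary_def)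
    from fiber_entropy_inj[OF this, of \<mu>]
    have "fiber_entropy \<mu> (itinerary f P (m + n)) = fiber_entropy \<mu> (\<lambda>x. (itinerary f P m x, itinerary f P n ((f ^^ m) x)))"
      by (simp add: itinerary_add[abs_def])
    also have "\<dots> \<le> fiber_entropy \<mu> (itinerary f P m) + fiber_entropy \<mu> (\<lambda>x. itinerary f P n ((f ^^ m) x))"
      by (rule fiber_entropy_Pair_le[OF simple' s invariant_measuresD(3)[OF \<mu>]])
    also have "fiber_entropy \<mu> (\<lambda>x. itinerary f P n ((f ^^ m) x)) = fiber_entropy \<mu> (itinerary f P n)"
    proof (rule fiber_entropy_invariant)
      show "measure \<mu> ((f ^^ m) -` (itinerary f P n -` {w})) = measure \<mu> (itinerary f P n -` {w})" for w
        using simple_functionD(2)[OF simple, of n "{w}"] by (intro invariant_measure_funpow[OF \<mu> f]) simp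
      show "finite (range (itinerary f P n))"
        using simple_functionD(1)[OF simple, of n] by simp
    qed
    finally show ?thesis .
  qed
  then have "convergent (\<lambda>n. fiber_entropy \<mu> (itinerary f P n) / real n)"
    by (rule fekete_convergent) (rule fiber_entropy_nonneg)
  then show ?thesis
    by (simp add: convergent_LIMSEQ_iff metric_entropy_partition_def
        dynamical_refinement_fibers[OF P(1)] partition_entropy_fibers)
qed

text \<open>The trivial partition is its own refinement and has entropy 0.\<close>

lemma metric_entropy_nonneg:
  assumes "\<mu> \<in> invariant_measures f"
  shows "0 \<le> metric_entropy f \<mu>"
proof -
  have "dynamical_refinement f {UNIV} n = {UNIV}" for n
  proof -
    have "partition_on UNIV {UNIV :: 'a set}" by (simp add: partition_on_def)
    moreover have "itinerary f {UNIV} n x = itinerary f {UNIV} n y" for x y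
      by (simp add: itinerary_def cell_eq[OF \<open>partition_on UNIV {UNIV}\<close>])
    then have "itinerary f {UNIV} n -` {itinerary f {UNIV} n x} = UNIV" for x
      by blast
    ultimately show ?thesis by (simp add: dynamical_refinement_fibers)
  qed
  moreover have "measure \<mu> UNIV = 1"
    using prob_space.prob_space invariant_measuresD(1,3)[OF assms] by metis
  ultimately have "metric_entropy_partition \<mu> f {UNIV} = 0"
    by (simp add: metric_entropy_partition_def partition_entropy_def lim_const)
  moreover have "ereal (metric_entropy_partition \<mu> f {UNIV}) \<le> metric_entropy f \<mu>"
    unfolding metric_entropy_def
    by (rule SUP_upper) (use invariant_measuresD(2,3)[OF assms] in \<open>auto simp: partition_on_def\<close>)
  ultimately show ?thesis by (simp add: zero_ereal_def)
qed

text \<open>\<open>\<kappa>\<close> draws from \<open>\<mu>\<close> with probability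
  \<open>t\<close> and from \<open>\<nu>\<close> otherwise. As a bind over a Bernoulli choice it
  inherits the formulas for measures and integrals of binds.\<close>

lemma mixture_exists:
  fixes \<mu> \<nu> :: "'a::metric_space measure"
  assumes f: "f \<in> borel_measurable borel" and \<mu>: "\<mu> \<in> invariant_measures f" and \<nu>: "\<nu> \<in> invariant_measures f" and t: "0 \<le> t" "t \<le> (1::real)"
  obtains \<kappa> where "\<kappa> \<in> invariant_measures f"
    and "\<And>A. A \<in> sets borel \<Longrightarrow> measure \<kappa> A = t * measure \<mu> A + (1 - t) * measure \<nu> A"
    and "\<And>g B. g \<in> borel_measurable borel \<Longrightarrow> (\<And>x. \<bar>g x\<bar> \<le> B) \<Longrightarrow>
      (\<integral>x. g x \<partial>\<kappa>) = t * (\<integral>x. g x \<partial>\<mu>) + (1 - t) * (\<integral>x. g x \<partial>\<nu>)"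
proof -
  define N where "N b = (if b then \<mu> else \<nu>)" for b
  define \<kappa> where "\<kappa> = measure_pmf (bernoulli_pmf t) \<bind> N"
  have N: "prob_space (N b)" "sets (N b) = sets borel" for b
    using invariant_measuresD[OF \<mu>] invariant_measuresD[OF \<nu>] by (simp_all add: N_def)
  have meas: "N \<in> measurable (measure_pmf (bernoulli_pmf t)) (subprob_algebra borel)"
    using N by (auto simp: space_subprob_algebra prob_space_imp_subprob_space)
  have em: "emeasure \<kappa> A = ennreal t * emeasure \<mu> A + ennreal (1 - t) * emeasure \<nu> A" if "A \<in> sets borel" for A
    unfolding \<kappa>_def using that t
    by (subst emeasure_bind[OF _ meas]) (simp_all add: N_def mult.commute)
  have sets: "sets \<kappa> = sets borel"
    unfolding \<kappa>_def by (rule sets_bind) (simp_all add: N)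
  have prob: "prob_space \<kappa>"
    unfolding \<kappa>_def by (rule measure_pmf.prob_space_bind[OF _ meas]) (simp add: N)
  show thesis
  proof (rule that)
    have "emeasure \<kappa> (f -` A) = emeasure \<kappa> A" if A: "A \<in> sets borel" for A
    proof -
      have "f -` A \<in> sets borel"
        using measurable_sets[OF f A] by simp
      with A show ?thesis
        using invariant_measuresD(4)[OF \<mu> A] invariant_measuresD(4)[OF \<nu> A] by (simp add: em)
    qed
    with sets prob show "\<kappa> \<in> invariant_measures f"
      by (simp add: invariant_measures_def)
    show "measure \<kappa> A = t * measure \<mu> A + (1 - t) * measure \<nu> A" if "A \<in> sets borel" for A
    proof -
      interpret \<mu>: prob_space \<mu> by (rule invariant_measuresD(1)[OF \<mu>])
      interpret \<nu>: prob_space \<nu> by (rule invariant_measuresD(1)[OF \<nu>])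
      have "emeasure \<kappa> A = ennreal (t * measure \<mu> A + (1 - t) * measure \<nu> A)"
        using em[OF that] t by (simp add: \<mu>.emeasure_eq_measure \<nu>.emeasure_eq_measure ennreal_mult'' ennreal_plus)
      then show ?thesis using t by (intro measure_eq_emeasure_eq_ennreal) simp_all
    qed
    show "(\<integral>x. g x \<partial>\<kappa>) = t * (\<integral>x. g x \<partial>\<mu>) + (1 - t) * (\<integral>x. g x \<partial>\<nu>)"
      if g: "g \<in> borel_measurable borel" "\<And>x. \<bar>g x\<bar> \<le> B" for g :: "'a \<Rightarrow> real" and B
    proof -
      have "emeasure (N b) (space (N b)) \<le> ennreal 1" for b
        using prob_space.emeasure_space_1[OF N(1)] by simp
      then have "(\<integral>x. g x \<partial>\<kappa>) = (\<integral>b. \<integral>x. g x \<partial>N b \<partial>measure_pmf (bernoulli_pmf t))"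
        unfolding \<kappa>_def
        by (intro integral_bind[OF g(1) g(2) meas, where B' = 1])
          (simp_all add: measure_pmf.finite_measure_axioms)
      also have "\<dots> = (\<integral>x. g x \<partial>\<mu>) * t + (\<integral>x. g x \<partial>\<nu>) * (1 - t)"
        using t by (subst integral_bernoulli_pmf) (simp_all add: N_def)
      finally show ?thesis by (simp add: mult.commute)
    qed
  qed
qed

text \<open>The right side is the tangent at \<open>m\<close> of the concave function
  \<open>- (x * ln x)\<close>.\<close>

lemma neg_mult_ln_tangent:
  fixes x m :: real
  assumes "0 \<le> x" "0 < m"
  shows "- (x * ln x) \<le> m - x - x * ln m"
proof (cases "x = 0")
  case False
  with assms have x: "0 < x" by simp
  have "ln (m / x) \<le> m / x - 1"
    using x assms by (intro ln_le_minus_one) simp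
  then have "x * ln (m / x) \<le> x * (m / x - 1)"
    using x by (intro mult_left_mono) simp_all
  then show ?thesis
    using x assms by (simp add: ln_div algebra_simps)
qed (use assms in simp)

text \<open>Concavity, by averaging two tangents at the mean \<open>m\<close>; the term of
  \<open>b\<close> is dropped, being nonnegative for \<open>b\<close> in the unit interval.\<close>

lemma neg_mult_ln_mixture:
  fixes a b t :: real
  assumes t: "0 \<le> t" "t \<le> 1" and a: "0 \<le> a" and b: "0 \<le> b" "b \<le> 1"
  shows "t * - (a * ln a) \<le> - ((t * a + (1 - t) * b) * ln (t * a + (1 - t) * b))"
proof -
  define m where "m = t * a + (1 - t) * b"
  have "0 \<le> m" using assms by (simp add: m_def)
  show ?thesis
  proof (cases "m = 0")
    case True
    then have "t * a = 0"
      using assms by (simp add: m_def add_nonneg_eq_0_iff)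
    with True show ?thesis by (auto simp: m_def)
  next
    case False
    with \<open>0 \<le> m\<close> have m: "0 < m" by simp
    have "0 \<le> - (b * ln b)"
      using b by (cases "b = 0") (auto simp: mult_le_0_iff)
    then have "t * - (a * ln a) \<le> t * - (a * ln a) + (1 - t) * - (b * ln b)"
      using t by (simp add: mult_nonneg_nonneg[of "1 - t" "- (b * ln b)", simplified])
    also have "\<dots> \<le> t * (m - a - a * ln m) + (1 - t) * (m - b - b * ln m)"
      using t by (intro add_mono mult_left_mono neg_mult_ln_tangent a b m) simp_all
    also have "\<dots> = m - (t * a + (1 - t) * b) - (t * a + (1 - t) * b) * ln m"
      by (simp add: algebra_simps)
    also have "\<dots> = - (m * ln m)"
      by (simp add: m_def)
    finally show ?thesis by (simp add: m_def)
  qed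
qed

text \<open>A weak form of the concavity of entropy: the inequality holds for every fiber of an
  itinerary and passes to sums, limits and suprema. Nonnegativity of the entropies lets the factor
  \<open>t\<close> move through the supremum.\<close>

lemma metric_entropy_mixture:
  fixes f :: "'a::metric_space \<Rightarrow> 'a"
  assumes f: "f \<in> borel_measurable borel"
    and \<mu>: "\<mu> \<in> invariant_measures f" and \<kappa>: "\<kappa> \<in> invariant_measures f" and \<nu>: "\<nu> \<in> invariant_measures f"
    and t: "0 \<le> t" "t \<le> (1::real)"
    and mix: "\<And>A. A \<in> sets borel \<Longrightarrow> measure \<kappa> A = t * measure \<mu> A + (1 - t) * measure \<nu> A"
  shows "ereal t * metric_entropy f \<mu> \<le> metric_entropy f \<kappa>"
proof -
  let ?PS = "{P :: 'a set set. finite P \<and> partition_on UNIV P \<and> P \<subseteq> sets borel}"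
  have le: "t * metric_entropy_partition \<mu> f P \<le> metric_entropy_partition \<kappa> f P" if P: "P \<in> ?PS" for P
  proof (rule LIMSEQ_le)
    show "(\<lambda>n. t * (fiber_entropy \<mu> (itinerary f P n) / real n)) \<longlonglongrightarrow> t * metric_entropy_partition \<mu> f P"
      using P by (intro tendsto_mult_left metric_entropy_partition_tendsto[OF \<mu> f]) auto
    show "(\<lambda>n. fiber_entropy \<kappa> (itinerary f P n) / real n) \<longlonglongrightarrow> metric_entropy_partition \<kappa> f P"
      using P by (intro metric_entropy_partition_tendsto[OF \<kappa> f]) auto
    have "t * fiber_entropy \<mu> (itinerary f P n) \<le> fiber_entropy \<kappa> (itinerary f P n)" for n
    proof -
      have s: "simple_function borel (itinerary f P n)"
        using P by (intro simple_function_itinerary f) auto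
      have le: "- (measure \<kappa> A * ln (measure \<kappa> A)) \<ge> t * - (measure \<mu> A * ln (measure \<mu> A))"
        if "A \<in> sets borel" for A
        unfolding mix[OF that] using prob_space.prob_le_1[OF invariant_measuresD(1)] \<mu> \<nu>
        by (intro neg_mult_ln_mixture t measure_nonneg) auto
      have "itinerary f P n -` {w} \<in> sets borel" for w
        using simple_functionD(2)[OF s, of "{w}"] by simp
      from le[OF this] have "t * (\<Sum>w\<in>range (itinerary f P n). - (measure \<mu> (itinerary f P n -` {w}) * ln (measure \<mu> (itinerary f P n -` {w}))))
        \<le> (\<Sum>w\<in>range (itinerary f P n). - (measure \<kappa> (itinerary f P n -` {w}) * ln (measure \<kappa> (itinerary f P n -` {w}))))"
        unfolding sum_distrib_left by (intro sum_mono)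
      then show ?thesis
        by (simp add: fiber_entropy_def sum_negf)
    qed
    then show "\<exists>N. \<forall>n\<ge>N. t * (fiber_entropy \<mu> (itinerary f P n) / real n) \<le> fiber_entropy \<kappa> (itinerary f P n) / real n"
      by (simp add: divide_right_mono)
  qed
  have nonneg: "0 \<le> metric_entropy_partition \<mu> f P" if P: "P \<in> ?PS" for P
  proof (rule LIMSEQ_le_const)
    show "(\<lambda>n. fiber_entropy \<mu> (itinerary f P n) / real n) \<longlonglongrightarrow> metric_entropy_partition \<mu> f P"
      using P by (intro metric_entropy_partition_tendsto[OF \<mu> f]) auto
    show "\<exists>N. \<forall>n\<ge>N. 0 \<le> fiber_entropy \<mu> (itinerary f P n) / real n"
      by (simp add: prob_space.fiber_entropy_nonneg[OF invariant_measuresD(1)[OF \<mu>]])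
  qed
  have "partition_on UNIV {UNIV :: 'a set}" by (simp add: partition_on_def)
  then have ne: "?PS \<noteq> {}" by (auto intro!: exI[of _ "{UNIV}"])
  have "ereal t * metric_entropy f \<mu> = ereal t * (SUP P\<in>?PS. ereal (metric_entropy_partition \<mu> f P))"
    by (simp add: metric_entropy_def invariant_measuresD(2,3)[OF \<mu>])
  also have "\<dots> = (SUP P\<in>?PS. ereal t * ereal (metric_entropy_partition \<mu> f P))"
    using nonneg t ne by (intro SUP_ereal_mult_left[symmetric]) simp_all
  also have "\<dots> \<le> (SUP P\<in>?PS. ereal (metric_entropy_partition \<kappa> f P))"
  proof (rule SUP_mono)
    fix P assume P: "P \<in> ?PS"
    show "\<exists>Q\<in>?PS. ereal t * ereal (metric_entropy_partition \<mu> f P) \<le> ereal (metric_entropy_partition \<kappa> f Q)"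
      by (rule bexI[OF _ P]) (use le[OF P] in simp)
  qed
  also have "\<dots> = metric_entropy f \<kappa>"
    by (simp add: metric_entropy_def invariant_measuresD(2,3)[OF \<kappa>])
  finally show ?thesis .
qed

section \<open>Continuity of computable functions\<close>

lemma machine_output_unique:
  assumes "machine_output M \<phi>s ns y" "machine_output M \<phi>s ns z"
  shows "y = z"
proof -
  have fixed: "(machine_step M \<phi>s ^^ n) (q, T) = (q, T)" if "states M \<le> q" for n q T
    by (induction n) (use that in simp_all)
  have *: "(q, T) = (q', T')" if "(machine_step M \<phi>s ^^ k) c = (q, T)" "(machine_step M \<phi>s ^^ l) c = (q', T')"
    "states M \<le> q" "k \<le> l" for k l c q T q' T'
  proof -
    have "(machine_step M \<phi>s ^^ l) c = (machine_step M \<phi>s ^^ (l - k)) ((machine_step M \<phi>s ^^ k) c)"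
      using that(4) by (metis comp_apply funpow_add le_add_diff_inverse2)
    then show ?thesis using that fixed by simp
  qed
  obtain k q T l q' T' where "(machine_step M \<phi>s ^^ k) (initial_config ns) = (q, T)" "states M \<le> q"
    "tape_value (T 0) = y" "(machine_step M \<phi>s ^^ l) (initial_config ns) = (q', T')" "states M \<le> q'"
    "tape_value (T' 0) = z"
    using assms unfolding machine_output_def by blast
  then show ?thesis
    using *[of k "initial_config ns" q T l q' T'] *[of l "initial_config ns" q' T' k q T] by (cases "k \<le> l") auto
qed

lemma machine_step_local:
  "\<exists>b. \<forall>\<phi>'. (\<forall>n<b. \<phi>' n = \<phi> n) \<longrightarrow> machine_step M [\<phi>'] c = machine_step M [\<phi>] c"
proof -
  obtain q T where c: "c = (q, T)" by (cases c)
  show ?thesis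
  proof (cases "query M q")
    case None
    then show ?thesis by (simp add: c)
  next
    case (Some a)
    then obtain j t q' where "query M q = Some (j, t, q')" by (cases a) auto
    then show ?thesis
      by (intro exI[of _ "Suc (tape_value (T t))"]) (simp add: c ask_def)
  qed
qed

text \<open>The use principle: a halting computation has read only finitely many oracle
  values.\<close>

lemma machine_output_local:
  assumes "machine_output M [\<phi>] ns y"
  shows "\<exists>b. \<forall>\<phi>'. (\<forall>n<b. \<phi>' n = \<phi> n) \<longrightarrow> machine_output M [\<phi>'] ns y"
proof -
  have "\<exists>b. \<forall>\<phi>'. (\<forall>n<b. \<phi>' n = \<phi> n) \<longrightarrow> (machine_step M [\<phi>'] ^^ k) c = (machine_step M [\<phi>] ^^ k) c" for k c
  proof (induction k)
    case (Suc k)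
    then obtain b where b: "\<And>\<phi>'. \<forall>n<b. \<phi>' n = \<phi> n \<Longrightarrow> (machine_step M [\<phi>'] ^^ k) c = (machine_step M [\<phi>] ^^ k) c"
      by blast
    obtain d where d: "\<And>\<phi>'. \<forall>n<d. \<phi>' n = \<phi> n \<Longrightarrow>
        machine_step M [\<phi>'] ((machine_step M [\<phi>] ^^ k) c) = machine_step M [\<phi>] ((machine_step M [\<phi>] ^^ k) c)"
      using machine_step_local by blast
    show ?case
    proof (intro exI[of _ "max b d"] allI impI)
      fix \<phi>' assume "\<forall>n<max b d. \<phi>' n = \<phi> n"
      then have "\<forall>n<b. \<phi>' n = \<phi> n" "\<forall>n<d. \<phi>' n = \<phi> n" by simp_all
      from b[OF this(1)] d[OF this(2)] show "(machine_step M [\<phi>'] ^^ Suc k) c = (machine_step M [\<phi>] ^^ Suc k) c"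
        by (simp only: funpow.simps comp_apply)
    qed
  qed simp
  moreover obtain k q T where "(machine_step M [\<phi>] ^^ k) (initial_config ns) = (q, T)" "q \<ge> states M" "tape_value (T 0) = y"
    using assms unfolding machine_output_def by blast
  ultimately obtain b where "\<And>\<phi>'. \<forall>n<b. \<phi>' n = \<phi> n \<Longrightarrow> (machine_step M [\<phi>'] ^^ k) (initial_config ns) = (q, T)"
    by metis
  then show ?thesis
    unfolding machine_output_def using \<open>q \<ge> states M\<close> \<open>tape_value (T 0) = y\<close> by blast
qed

text \<open>The values from \<open>b\<close> on come from density; with \<open>b = 0\<close> every
  point has an oracle.\<close>

lemma oracle_extension:
  assumes dense: "closure (range s) = UNIV" and b: "\<forall>n<b. dist x (s (\<phi> n)) < (1/2) ^ n"
  shows "\<exists>\<phi>'. oracle_for s x \<phi>' \<and> (\<forall>n<b. \<phi>' n = \<phi> n)"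
proof -
  have "\<exists>i. dist x (s i) < (1/2) ^ n" for n
  proof -
    have "x \<in> closure (range s)" by (simp add: dense)
    then show ?thesis
      unfolding closure_approachable by (auto simp: dist_commute dest!: spec[of _ "(1/2) ^ n"])
  qed
  then obtain i where i: "\<And>n. dist x (s (i n)) < (1/2) ^ n" by metis
  show ?thesis
    by (intro exI[of _ "\<lambda>n. if n < b then \<phi> n else i n"]) (simp add: oracle_for_def i b)
qed

text \<open>The finite part of an oracle read at \<open>x\<close> consists of strict inequalities,
  so it is also the beginning of an oracle for every nearby \<open>x'\<close>. The machine then
  gives the same output, which is close to both values.\<close>

lemma continuous_on_approximates:
  fixes s :: "nat \<Rightarrow> 'a::metric_space" and t :: "nat \<Rightarrow> 'b::metric_space"
  assumes dense: "closure (range s) = UNIV"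
    and approx: "\<And>x \<phi>. x \<in> S \<Longrightarrow> oracle_for s x \<phi> \<Longrightarrow> approximates M [\<phi>] ns t (g x)"
  shows "continuous_on S g"
  unfolding continuous_on_iff
proof (intro ballI allI impI)
  fix x :: 'a and e :: real
  assume x: "x \<in> S" and e: "0 < e"
  obtain k where k: "(1/2) ^ k < e / 2"
    using real_arch_pow_inv[of "e / 2" "1/2"] e by auto
  obtain \<phi> where \<phi>: "oracle_for s x \<phi>"
    using oracle_extension[OF dense, of 0 x] by auto
  obtain i where i: "machine_output M [\<phi>] (ns @ [k]) i" "dist (t i) (g x) < (1/2) ^ k"
    using approx[OF x \<phi>] unfolding approximates_def by blast
  obtain b where b: "\<And>\<phi>'. \<forall>n<b. \<phi>' n = \<phi> n \<Longrightarrow> machine_output M [\<phi>'] (ns @ [k]) i"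
    using machine_output_local[OF i(1)] by blast
  have "\<forall>\<^sub>F x' in nhds x. \<forall>n\<in>{..<b}. dist x' (s (\<phi> n)) < (1/2) ^ n"
  proof (intro eventually_ball_finite ballI)
    fix n
    have "open {x'. dist x' (s (\<phi> n)) < (1/2) ^ n}"
      by (intro open_Collect_less continuous_intros)
    with \<phi> show "\<forall>\<^sub>F x' in nhds x. dist x' (s (\<phi> n)) < (1/2) ^ n"
      unfolding eventually_nhds by (intro exI[of _ "{x'. dist x' (s (\<phi> n)) < (1/2) ^ n}"]) (simp add: oracle_for_def)
  qed simp
  then obtain d where d: "0 < d" "\<And>x'. dist x' x < d \<Longrightarrow> \<forall>n<b. dist x' (s (\<phi> n)) < (1/2) ^ n"
    unfolding eventually_nhds_metric by auto
  show "\<exists>d>0. \<forall>x'\<in>S. dist x' x < d \<longrightarrow> dist (g x') (g x) < e"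
  proof (intro exI[of _ d] conjI ballI impI d(1))
    fix x' assume x': "x' \<in> S" "dist x' x < d"
    obtain \<phi>' where \<phi>': "oracle_for s x' \<phi>'" "\<forall>n<b. \<phi>' n = \<phi> n"
      using oracle_extension[OF dense d(2)[OF x'(2)]] by blast
    obtain i' where i': "machine_output M [\<phi>'] (ns @ [k]) i'" "dist (t i') (g x') < (1/2) ^ k"
      using approx[OF x'(1) \<phi>'(1)] unfolding approximates_def by blast
    have "i' = i"
      by (rule machine_output_unique[OF i'(1) b[OF \<phi>'(2)]])
    with i'(2) i(2) k show "dist (g x') (g x) < e"
      using dist_triangle3[of "g x'" "g x" "t i"] by simp
  qed
qed

lemma dense_rat_vec_enum: "closure (range (rat_vec_enum :: nat \<Rightarrow> real ^ 'm::finite)) = UNIV"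
proof -
  have "\<exists>y\<in>range rat_vec_enum. dist y x < e" if e: "0 < e" for x :: "real ^ 'm" and e
  proof -
    have "\<exists>q\<in>\<rat>. x $ i < q \<and> q < x $ i + e / real CARD('m)" for i
      using Rats_dense_in_real[of "x $ i" "x $ i + e / real CARD('m)"] e by auto
    then obtain q where q: "\<And>i. q i \<in> \<rat>" "\<And>i. x $ i < q i" "\<And>i. q i < x $ i + e / real CARD('m)"
      by metis
    have "dist (\<chi> i. q i) x \<le> (\<Sum>i\<in>UNIV. \<bar>((\<chi> i. q i) - x) $ i\<bar>)"
      unfolding dist_norm by (rule norm_le_l1_cart)
    also have "\<dots> < (\<Sum>i\<in>(UNIV :: 'm set). e / real CARD('m))"
    proof (rule sum_strict_mono)
      fix i :: 'm
      show "\<bar>((\<chi> i. q i) - x) $ i\<bar> < e / real CARD('m)"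
        using q(2,3)[of i] by simp
    qed simp_all
    also have "\<dots> = e" by simp
    finally have "dist (\<chi> i. q i) x < e" .
    moreover have "(\<chi> i. q i) \<in> range rat_vec_enum"
      using q(1) by (simp add: range_rat_vec_enum)
    ultimately show ?thesis by blast
  qed
  then show ?thesis
    by (auto simp: closure_approachable set_eq_iff)
qed

section \<open>Rotation vectors, pressure and localized entropy\<close>

lemma
  fixes \<Psi> :: "'a::metric_space \<Rightarrow> real ^ 'm::finite"
  assumes cpt: "compact (UNIV :: 'a set)" and cont: "continuous_on UNIV \<Psi>"
  shows bounded_continuous_compact: "\<exists>B. \<forall>x. norm (\<Psi> x) \<le> B"
    and integrable_continuous_compact: "\<mu> \<in> invariant_measures f \<Longrightarrow> integrable \<mu> (\<lambda>x. \<Psi> x $ i)"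
proof -
  have "bounded (\<Psi> ` UNIV)"
    by (intro compact_imp_bounded compact_continuous_image cont cpt)
  then show *: "\<exists>B. \<forall>x. norm (\<Psi> x) \<le> B"
    by (auto simp: bounded_iff)
  then obtain B where B: "\<And>x. norm (\<Psi> x) \<le> B" by blast
  assume \<mu>: "\<mu> \<in> invariant_measures f"
  interpret prob_space \<mu> by (rule invariant_measuresD(1)[OF \<mu>])
  have "(\<lambda>x. \<Psi> x $ i) \<in> borel_measurable borel"
    by (intro borel_measurable_continuous_onI continuous_intros cont)
  then have "(\<lambda>x. \<Psi> x $ i) \<in> borel_measurable \<mu>"
    using invariant_measuresD(2)[OF \<mu>] by (simp cong: measurable_cong_sets)
  then show "integrable \<mu> (\<lambda>x. \<Psi> x $ i)"
    using B component_le_norm_cart[of "\<Psi> x" i for x] by (intro integrable_const_bound[where B = B]) (auto intro!: AE_I2 intro: order_trans)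
qed

lemma inner_rotation_vector:
  fixes \<Psi> :: "'a::metric_space \<Rightarrow> real ^ 'm::finite"
  assumes "compact (UNIV :: 'a set)" "continuous_on UNIV \<Psi>" "\<mu> \<in> invariant_measures f"
  shows "integrable \<mu> (\<lambda>x. v \<bullet> \<Psi> x)" "(\<integral>x. v \<bullet> \<Psi> x \<partial>\<mu>) = v \<bullet> rotation_vector \<Psi> \<mu>"
  using integrable_continuous_compact[OF assms]
  by (simp_all add: inner_vec_def rotation_vector_def)

text \<open>Pairing the difference \<open>u\<close> of the rotation vectors with itself keeps the
  Euclidean norm: an estimate by components would bring in a factor depending on the
  dimension.\<close>

lemma rotation_vector_close:
  fixes \<Psi> \<Phi> :: "'a::metric_space \<Rightarrow> real ^ 'm::finite"
  assumes cpt: "compact (UNIV :: 'a set)" and cont: "continuous_on UNIV \<Psi>" "continuous_on UNIV \<Phi>"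
    and \<mu>: "\<mu> \<in> invariant_measures f" and le: "\<And>x. norm (\<Psi> x - \<Phi> x) \<le> e"
  shows "norm (rotation_vector \<Psi> \<mu> - rotation_vector \<Phi> \<mu>) \<le> e"
proof -
  interpret prob_space \<mu> by (rule invariant_measuresD(1)[OF \<mu>])
  define u where "u = rotation_vector \<Psi> \<mu> - rotation_vector \<Phi> \<mu>"
  note int = inner_rotation_vector[OF cpt cont(1) \<mu>, of u] inner_rotation_vector[OF cpt cont(2) \<mu>, of u]
  have "norm u * norm u = u \<bullet> u"
    by (simp add: power2_norm_eq_inner power2_eq_square[symmetric])
  also have "\<dots> = (\<integral>x. u \<bullet> \<Psi> x - u \<bullet> \<Phi> x \<partial>\<mu>)"
    using int by (simp add: u_def inner_diff_right)
  also have "\<dots> \<le> (\<integral>x. norm u * e \<partial>\<mu>)"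
  proof (rule integral_mono)
    fix x
    have "u \<bullet> \<Psi> x - u \<bullet> \<Phi> x \<le> norm u * norm (\<Psi> x - \<Phi> x)"
      using norm_cauchy_schwarz[of u "\<Psi> x - \<Phi> x"] by (simp add: inner_diff_right)
    also have "\<dots> \<le> norm u * e"
      by (intro mult_left_mono le) simp
    finally show "u \<bullet> \<Psi> x - u \<bullet> \<Phi> x \<le> norm u * e" .
  qed (use int in simp_all)
  also have "\<dots> = norm u * e"
    using prob_space by simp
  finally have "norm u * norm u \<le> norm u * e" .
  moreover have "0 \<le> e"
    using le norm_ge_zero order_trans by blast
  ultimately show ?thesis
    unfolding u_def[symmetric] by (cases "u = 0") simp_all
qed

lemma equilibrium_state_entropy_le:
  fixes \<Psi> :: "'a::metric_space \<Rightarrow> real ^ 'm::finite"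
  assumes cpt: "compact (UNIV :: 'a set)" and cont: "continuous_on UNIV \<Psi>"
    and eq: "equilibrium_state f (\<lambda>x. v \<bullet> \<Psi> x) \<mu>" and h: "metric_entropy f \<mu> = ereal h"
    and \<nu>: "\<nu> \<in> invariant_measures f"
  shows "metric_entropy f \<nu> \<le> ereal (h + v \<bullet> (rotation_vector \<Psi> \<mu> - rotation_vector \<Psi> \<nu>))"
proof -
  have \<mu>: "\<mu> \<in> invariant_measures f"
    using eq by (simp add: equilibrium_state_def)
  have "metric_entropy f \<nu> + ereal (\<integral>x. v \<bullet> \<Psi> x \<partial>\<nu>) \<le> topological_pressure f (\<lambda>x. v \<bullet> \<Psi> x)"
    unfolding topological_pressure_def by (rule SUP_upper[OF \<nu>])
  also have "\<dots> = ereal h + ereal (\<integral>x. v \<bullet> \<Psi> x \<partial>\<mu>)"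
    using eq h by (simp add: equilibrium_state_def)
  finally have "metric_entropy f \<nu> + ereal (v \<bullet> rotation_vector \<Psi> \<nu>) \<le> ereal (h + v \<bullet> rotation_vector \<Psi> \<mu>)"
    by (simp add: inner_rotation_vector(2)[OF cpt cont \<mu>] inner_rotation_vector(2)[OF cpt cont \<nu>])
  then show ?thesis
    by (cases "metric_entropy f \<nu>") (simp_all add: inner_diff_right)
qed

lemma localized_entropy_le:
  fixes \<Psi> \<Phi> :: "'a::metric_space \<Rightarrow> real ^ 'm::finite"
  assumes cpt: "compact (UNIV :: 'a set)" and cont: "continuous_on UNIV \<Psi>" "continuous_on UNIV \<Phi>"
    and eq: "equilibrium_state f (\<lambda>x. v \<bullet> \<Psi> x) \<mu>" and h: "metric_entropy f \<mu> = ereal h"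
    and le: "\<And>x. norm (\<Psi> x - \<Phi> x) \<le> e"
  shows "localized_entropy f \<Phi> w \<le> ereal (h + norm v * (norm (rotation_vector \<Psi> \<mu> - w) + e))"
  unfolding localized_entropy_def
proof (rule SUP_least)
  fix \<nu> assume "\<nu> \<in> {\<nu> \<in> invariant_measures f. rotation_vector \<Phi> \<nu> = w}"
  then have \<nu>: "\<nu> \<in> invariant_measures f" and w: "rotation_vector \<Phi> \<nu> = w" by auto
  \<comment> \<open>\<open>\<nu>\<close> has rotation vector \<open>w\<close> for
    \<open>\<Phi>\<close>, but for \<open>\<Psi>\<close> only one within \<open>e\<close> of
    \<open>w\<close>; hence the \<open>+ e\<close>.\<close>
  have "v \<bullet> (rotation_vector \<Psi> \<mu> - rotation_vector \<Psi> \<nu>) \<le>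
      norm v * norm ((rotation_vector \<Psi> \<mu> - w) - (rotation_vector \<Psi> \<nu> - w))"
    using norm_cauchy_schwarz[of v "rotation_vector \<Psi> \<mu> - rotation_vector \<Psi> \<nu>"] by simp
  also have "\<dots> \<le> norm v * (norm (rotation_vector \<Psi> \<mu> - w) + e)"
    using norm_triangle_ineq4[of "rotation_vector \<Psi> \<mu> - w" "rotation_vector \<Psi> \<nu> - w"]
      rotation_vector_close[OF cpt cont \<nu> le] by (intro mult_left_mono) (simp_all add: w)
  finally have "h + v \<bullet> (rotation_vector \<Psi> \<mu> - rotation_vector \<Psi> \<nu>) \<le>
      h + norm v * (norm (rotation_vector \<Psi> \<mu> - w) + e)" by simp
  then show "metric_entropy f \<nu> \<le> ereal (h + norm v * (norm (rotation_vector \<Psi> \<mu> - w) + e))"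
    using equilibrium_state_entropy_le[OF cpt cont(1) eq h \<nu>] by (meson ereal_less_eq(3) order_trans)
qed

lemma localized_entropy_ge:
  fixes \<Phi> :: "'a::metric_space \<Rightarrow> real ^ 'm::finite"
  assumes cpt: "compact (UNIV :: 'a set)" and cont: "continuous_on UNIV \<Phi>"
    and f: "f \<in> borel_measurable borel" and \<mu>: "\<mu> \<in> invariant_measures f" and h: "metric_entropy f \<mu> = ereal h"
    and ball: "ball w r \<subseteq> rotation_set f \<Phi>" and \<rho>: "0 < \<rho>" "\<rho> < r"
    and d: "norm (rotation_vector \<Phi> \<mu> - w) \<le> d"
  shows "ereal (\<rho> / (\<rho> + d) * h) \<le> localized_entropy f \<Phi> w"
proof -
  have h0: "0 \<le> h"
    using metric_entropy_nonneg[OF \<mu>] by (simp add: h)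
  define \<delta> where "\<delta> = norm (rotation_vector \<Phi> \<mu> - w)"
  have \<delta>: "0 \<le> \<delta>" "\<delta> \<le> d" using d by (simp_all add: \<delta>_def)
  \<comment> \<open>The weight for which \<open>w\<close> divides the segment from the rotation
    vector of \<open>\<mu>\<close>, at distance \<open>\<delta>\<close>, to a point
    \<open>w'\<close> beyond \<open>w\<close>, at distance \<open>\<rho>\<close>.\<close>
  define t where "t = \<rho> / (\<rho> + \<delta>)"
  have t: "0 \<le> t" "t \<le> 1" "1 - t = \<delta> / (\<rho> + \<delta>)"
    using \<rho> \<delta> by (simp_all add: t_def field_simps)
  \<comment> \<open>For \<open>\<delta> = 0\<close> the quotient is 0 by convention, and then
    \<open>w' = w\<close> and \<open>t = 1\<close>.\<close>
  define w' where "w' = w + (\<rho> / \<delta>) *\<^sub>R (w - rotation_vector \<Phi> \<mu>)"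
  have "norm ((\<rho> / \<delta>) *\<^sub>R (w - rotation_vector \<Phi> \<mu>)) \<le> \<rho>"
    using \<rho> \<delta> by (cases "\<delta> = 0") (simp_all add: norm_minus_commute[of w] \<delta>_def[symmetric])
  then have "w' \<in> ball w r"
    using \<rho> by (simp add: w'_def dist_norm)
  then obtain \<nu> where \<nu>: "\<nu> \<in> invariant_measures f" "rotation_vector \<Phi> \<nu> = w'"
    using ball unfolding rotation_set_def by blast
  obtain \<kappa> where \<kappa>: "\<kappa> \<in> invariant_measures f"
    and mix: "\<And>A. A \<in> sets borel \<Longrightarrow> measure \<kappa> A = t * measure \<mu> A + (1 - t) * measure \<nu> A"
    and int: "\<And>g B. g \<in> borel_measurable borel \<Longrightarrow> (\<And>x. \<bar>g x\<bar> \<le> B) \<Longrightarrow>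
      (\<integral>x. g x \<partial>\<kappa>) = t * (\<integral>x. g x \<partial>\<mu>) + (1 - t) * (\<integral>x. g x \<partial>\<nu>)"
    using mixture_exists[OF f \<mu> \<nu>(1) t(1,2)] by blast
  obtain B where B: "\<And>x. norm (\<Phi> x) \<le> B"
    using bounded_continuous_compact[OF cpt cont] by blast
  have "rotation_vector \<Phi> \<kappa> = t *\<^sub>R rotation_vector \<Phi> \<mu> + (1 - t) *\<^sub>R w'"
  proof -
    have "(\<integral>x. \<Phi> x $ i \<partial>\<kappa>) = t * (\<integral>x. \<Phi> x $ i \<partial>\<mu>) + (1 - t) * (\<integral>x. \<Phi> x $ i \<partial>\<nu>)" for i
    proof (rule int)
      show "(\<lambda>x. \<Phi> x $ i) \<in> borel_measurable borel"
        by (intro borel_measurable_continuous_onI continuous_intros cont)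
      show "\<bar>\<Phi> x $ i\<bar> \<le> B" for x
        using component_le_norm_cart[of "\<Phi> x" i] B[of x] by linarith
    qed
    then show ?thesis
      unfolding \<nu>(2)[symmetric] by (simp add: rotation_vector_def vec_eq_iff)
  qed
  also have "\<dots> = w"
  proof (cases "\<delta> = 0")
    case True
    then show ?thesis using \<rho> by (simp add: \<delta>_def w'_def t_def)
  next
    case False
    then have "(1 - t) * (\<rho> / \<delta>) = t"
      unfolding t(3) using \<rho> \<delta> by (simp add: t_def)
    then have "(1 - t) *\<^sub>R w' = (1 - t) *\<^sub>R w + t *\<^sub>R (w - rotation_vector \<Phi> \<mu>)"
      by (simp add: w'_def scaleR_add_right)
    then show ?thesis by (simp add: algebra_simps)
  qed
  finally have "metric_entropy f \<kappa> \<le> localized_entropy f \<Phi> w"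
    unfolding localized_entropy_def using \<kappa> by (intro SUP_upper) simp
  moreover have "ereal (t * h) \<le> metric_entropy f \<kappa>"
    using metric_entropy_mixture[OF f \<mu> \<kappa> \<nu>(1) t(1,2) mix] h by simp
  \<comment> \<open>The distance is known only through its upper bound \<open>d\<close>; as
    \<open>h\<close> is nonnegative, enlarging it weakens the bound.\<close>
  moreover have "\<rho> / (\<rho> + d) * h \<le> t * h"
    unfolding t_def using \<rho> \<delta> h0 by (intro mult_right_mono divide_left_mono) (simp_all add: mult_pos_pos)
  ultimately show ?thesis
    by (meson ereal_less_eq(3) order_trans)
qed

text \<open>Read \<open>h v + v \<bullet> R v\<close> as the pressure at \<open>v\<close>; its gradient is \<open>R\<close>, so a minimiser of \<open>g\<close> is a zero of \<open>R - w\<close>.\<close>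

lemma gradient_attains:
  fixes h :: "real ^ 'm::finite \<Rightarrow> real" and R :: "real ^ 'm \<Rightarrow> real ^ 'm"
  assumes conv: "\<And>v v'. h v \<le> h v' + v' \<bullet> (R v' - R v)"
    and h: "continuous_on UNIV h" and R: "continuous_on UNIV R"
    and c: "0 < c" "\<And>v. c * norm v \<le> h v + v \<bullet> (R v - w)"
  shows "\<exists>v. R v = w \<and> c * norm v \<le> h 0"
proof -
  define g where "g v = h v + v \<bullet> (R v - w)" for v
  have g0: "g 0 = h 0" by (simp add: g_def)
  \<comment> \<open>Outside the ball of radius \<open>K\<close> the growth assumption gives
    \<open>g v \<ge> |h 0| + 1 > g 0\<close>, so a minimiser over the ball is a global one.\<close>
  define K where "K = (\<bar>h 0\<bar> + 1) / c"
  have K: "0 < K" using c by (simp add: K_def)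
  have "continuous_on (cball 0 K) g"
    unfolding g_def by (intro continuous_intros continuous_on_subset[OF h] continuous_on_subset[OF R]) simp_all
  moreover have "cball 0 K \<noteq> {}" using K by simp
  ultimately have "\<exists>u\<in>cball 0 K. \<forall>v\<in>cball 0 K. g u \<le> g v"
    by (intro continuous_attains_inf compact_cball)
  then obtain u where u: "\<And>v. v \<in> cball 0 K \<Longrightarrow> g u \<le> g v"
    by blast
  have min: "g u \<le> g v" for v
  proof (cases "v \<in> cball 0 K")
    case False
    then have "c * K \<le> c * norm v" using c by simp
    also have "\<dots> \<le> g v" using c(2) by (simp add: g_def)
    finally have "\<bar>h 0\<bar> + 1 \<le> g v" using c by (simp add: K_def)
    moreover have "g u \<le> g 0" using u[of 0] K by simp
    ultimately show ?thesis using g0 by linarith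
  qed (rule u)
  \<comment> \<open>\<open>R v' - w\<close> is a subgradient of \<open>g\<close> at
    \<open>v'\<close>.\<close>
  have sub: "g v \<ge> g v' + (v - v') \<bullet> (R v' - w)" for v v'
    using conv[of v' v] by (simp add: g_def inner_diff_left inner_diff_right algebra_simps)
  \<comment> \<open>The direction in which \<open>g\<close> would decrease if \<open>R u\<close>
    differed from \<open>w\<close>. In place of a derivative at \<open>u\<close>, the subgradients
    at \<open>u + t *\<^sub>R z\<close> for small positive \<open>t\<close> are used with the
    continuity of \<open>R\<close>.\<close>
  define z where "z = w - R u"
  have "0 \<le> z \<bullet> (R u - w)"
  proof (rule tendsto_lowerbound)
    have "continuous_on UNIV (\<lambda>t. z \<bullet> (R (u + t *\<^sub>R z) - w))"
      by (intro continuous_intros continuous_on_compose2[OF R]) simp_all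
    then have "(\<lambda>t. z \<bullet> (R (u + t *\<^sub>R z) - w)) \<midarrow>0\<rightarrow> z \<bullet> (R (u + 0 *\<^sub>R z) - w)"
      unfolding continuous_on_eq_continuous_at[OF open_UNIV] isCont_def by blast
    from tendsto_within_subset[OF this subset_UNIV]
    show "((\<lambda>t. z \<bullet> (R (u + t *\<^sub>R z) - w)) \<longlongrightarrow> z \<bullet> (R u - w)) (at_right 0)"
      by simp
    show "\<forall>\<^sub>F t in at_right 0. 0 \<le> z \<bullet> (R (u + t *\<^sub>R z) - w)"
      unfolding eventually_at_right_field
    proof (intro exI[of _ 1] conjI allI impI)
      fix t :: real assume t: "0 < t"
      have "g u \<ge> g (u + t *\<^sub>R z) - t * (z \<bullet> (R (u + t *\<^sub>R z) - w))"
        using sub[of "u + t *\<^sub>R z" u] by simp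
      with min[of "u + t *\<^sub>R z"] have "0 \<le> t * (z \<bullet> (R (u + t *\<^sub>R z) - w))" by linarith
      with t show "0 \<le> z \<bullet> (R (u + t *\<^sub>R z) - w)" by (simp add: zero_le_mult_iff)
    qed simp
  qed simp
  moreover have "z \<bullet> (R u - w) = - (z \<bullet> z)"
    by (simp add: z_def inner_diff_right)
  ultimately have "\<not> 0 < z \<bullet> z" by linarith
  then have "z = 0" by (simp only: inner_gt_zero_iff not_not)
  then have "R u = w" by (simp add: z_def)
  moreover have "c * norm u \<le> h 0"
    using c(2)[of u] min[of 0] g0 by (simp add: g_def)
  ultimately show ?thesis by blast
qed

lemma approximating_sequence_le:
  fixes \<Phi> :: "'a::metric_space \<Rightarrow> real ^ 'm::finite"
  assumes cpt: "compact (UNIV :: 'a set)" and cont: "continuous_on UNIV \<Phi>"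
    and approx: "approximating_sequence \<Phi> \<epsilon> \<Phi>s"
  shows "norm (\<Phi>s n x - \<Phi> x) \<le> \<epsilon> n"
proof -
  have "continuous_on UNIV (\<lambda>x. \<Phi>s n x - \<Phi> x)"
    using approx cont by (intro continuous_intros) (auto simp: approximating_sequence_def)
  then obtain B where "\<And>x. norm (\<Phi>s n x - \<Phi> x) \<le> B"
    using bounded_continuous_compact[OF cpt] by blast
  then have "norm (\<Phi>s n x - \<Phi> x) \<le> (SUP x. norm (\<Phi>s n x - \<Phi> x))"
    by (intro cSUP_upper bdd_aboveI2) auto
  also have "\<dots> < \<epsilon> n"
    using approx by (simp add: approximating_sequence_def)
  finally show ?thesis by simp
qed

locale approximate_potentials =
  fixes f :: "'a::metric_space \<Rightarrow> 'a" and \<Phi> :: "'a \<Rightarrow> real ^ 'm::finite"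
    and \<epsilon> :: "nat \<Rightarrow> real" and \<Phi>s :: "nat \<Rightarrow> 'a \<Rightarrow> real ^ 'm"
    and m :: "real ^ 'm \<Rightarrow> nat \<Rightarrow> 'a measure" and h :: "real ^ 'm \<Rightarrow> nat \<Rightarrow> real"
  assumes cpt: "compact (UNIV :: 'a set)" and cont: "continuous_on UNIV \<Phi>"
    and f: "f \<in> borel_measurable borel"
    and approx: "approximating_sequence \<Phi> \<epsilon> \<Phi>s"
    and eq: "\<And>v n. equilibrium_state f (\<lambda>x. v \<bullet> \<Phi>s n x) (m v n)"
    and h: "\<And>v n. metric_entropy f (m v n) = ereal (h v n)"
begin

abbreviation R :: "real ^ 'm \<Rightarrow> nat \<Rightarrow> real ^ 'm" where
  "R v n \<equiv> rotation_vector (\<Phi>s n) (m v n)"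

lemma invariant: "m v n \<in> invariant_measures f"
  using eq by (simp add: equilibrium_state_def)

lemma cont': "continuous_on UNIV (\<Phi>s n)"
  using approx by (simp add: approximating_sequence_def)

lemmas close = approximating_sequence_le[OF cpt cont approx]

lemma eps_nonneg: "0 \<le> \<epsilon> n"
  using close norm_ge_zero order_trans by blast

lemma h_nonneg: "0 \<le> h v n"
  using metric_entropy_nonneg[OF invariant, of v n] by (simp add: h)

lemma entropy_le: "\<nu> \<in> invariant_measures f \<Longrightarrow> metric_entropy f \<nu> \<le> ereal (h v n + v \<bullet> (R v n - rotation_vector (\<Phi>s n) \<nu>))"
  by (rule equilibrium_state_entropy_le[OF cpt cont' eq h])

lemma h_le: "h v n \<le> h v' n' + v' \<bullet> (R v' n' - rotation_vector (\<Phi>s n') (m v n))"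
  using entropy_le[OF invariant[of v n], of v' n'] by (simp add: h)

text \<open>For \<open>v = 0\<close> the potential vanishes, so \<open>h 0 k\<close> is the largest
  entropy of an invariant measure, whatever \<open>k\<close> is.\<close>

lemma h_le_zero: "h v n \<le> h 0 k"
  using h_le[where v = v and n = n and v' = 0 and n' = k] by simp

text \<open>Phrased with upper bounds \<open>D\<close> and \<open>V\<close> and a lower bound
  \<open>\<rho>\<close>, since the search knows the norms and the radius only through such
  bounds.\<close>

lemma localized_entropy_enclosure:
  assumes H: "localized_entropy f \<Phi> w = ereal H"
    and ball: "ball w r \<subseteq> rotation_set f \<Phi>" and \<rho>: "0 < \<rho>" "\<rho> < r"
    and D: "norm (R v n - w) + \<epsilon> n \<le> D" and V: "norm v \<le> V"
  shows "h v n - D * h v n / \<rho> \<le> H" "H \<le> h v n + V * D"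
proof -
  have D0: "0 \<le> D" using D eps_nonneg[of n] norm_ge_zero[of "R v n - w"] by linarith
  have "ereal H \<le> ereal (h v n + norm v * (norm (R v n - w) + \<epsilon> n))"
    unfolding H[symmetric] by (rule localized_entropy_le[OF cpt cont' cont eq h close])
  also have "norm v * (norm (R v n - w) + \<epsilon> n) \<le> V * D"
    using V D eps_nonneg[of n] by (intro mult_mono) (auto intro: order_trans[OF norm_ge_zero])
  finally show "H \<le> h v n + V * D" by simp
  have "norm (rotation_vector \<Phi> (m v n) - w) \<le> norm (R v n - w) + \<epsilon> n"
    using norm_triangle_ineq4[of "R v n - w" "R v n - rotation_vector \<Phi> (m v n)"]
      rotation_vector_close[OF cpt cont' cont invariant[of v n] close, of n] by simp
  also note D
  finally have "ereal (\<rho> / (\<rho> + D) * h v n) \<le> ereal H"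
    unfolding H[symmetric] by (rule localized_entropy_ge[OF cpt cont f invariant h ball \<rho>])
  \<comment> \<open>Makes the bound linear in \<open>D\<close>, so that the later test needs no
    division.\<close>
  moreover have "1 - D / \<rho> \<le> \<rho> / (\<rho> + D)"
    using \<rho> D0 by (simp add: field_simps)
  then have "(1 - D / \<rho>) * h v n \<le> \<rho> / (\<rho> + D) * h v n"
    by (intro mult_right_mono h_nonneg)
  ultimately show "h v n - D * h v n / \<rho> \<le> H"
    by (simp add: algebra_simps)
qed

lemma localized_entropy_finite:
  assumes "w \<in> rotation_set f \<Phi>"
  shows "\<exists>H. localized_entropy f \<Phi> w = ereal H"
proof -
  obtain \<mu> where \<mu>: "\<mu> \<in> invariant_measures f" "rotation_vector \<Phi> \<mu> = w"
    using assms by (auto simp: rotation_set_def)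
  have "0 \<le> metric_entropy f \<mu>"
    by (rule metric_entropy_nonneg[OF \<mu>(1)])
  also have "\<dots> \<le> localized_entropy f \<Phi> w"
    unfolding localized_entropy_def using \<mu> by (intro SUP_upper) simp
  finally have "0 \<le> localized_entropy f \<Phi> w" .
  \<comment> \<open>\<open>v = 0\<close> reduces the upper bound to the maximal entropy
    \<open>h 0 0\<close>.\<close>
  moreover have "localized_entropy f \<Phi> w \<le> ereal (h 0 0 + norm (0 :: real ^ 'm) * (norm (R 0 0 - w) + \<epsilon> 0))"
    by (rule localized_entropy_le[OF cpt cont' cont eq h close])
  ultimately show ?thesis
    by (cases "localized_entropy f \<Phi> w") auto
qed

text \<open>The ball contains \<open>w + u\<close> with \<open>u\<close> of length
  \<open>r / 2\<close> in the direction of \<open>v\<close>. Testing the equilibrium inequality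
  against a measure with that rotation vector, whose entropy is nonnegative, yields the growth
  \<open>r / 2 * norm v\<close>; replacing \<open>\<Phi>\<close> by \<open>\<Phi>s n\<close> costs
  at most half of it.\<close>

lemma good_direction_exists:
  assumes conth: "continuous_on UNIV (\<lambda>v. h v n)" and contR: "continuous_on UNIV (\<lambda>v. R v n)"
    and ball: "ball w r \<subseteq> rotation_set f \<Phi>" and r: "0 < r" and \<epsilon>: "\<epsilon> n \<le> r / 4"
  shows "\<exists>v. R v n = w \<and> r / 4 * norm v \<le> h 0 0"
proof -
  have "\<exists>v. R v n = w \<and> r / 4 * norm v \<le> h 0 n"
  proof (rule gradient_attains[OF _ conth contR])
    show "h v n \<le> h v' n + v' \<bullet> (R v' n - R v n)" for v v'
      by (rule h_le)
    show "r / 4 * norm v \<le> h v n + v \<bullet> (R v n - w)" for v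
    proof (cases "v = 0")
      case True
      then show ?thesis by (simp add: h_nonneg)
    next
      case False
      define u where "u = (r / (2 * norm v)) *\<^sub>R v"
      have "norm u < r" using False r by (simp add: u_def)
      then have "w + u \<in> ball w r" by (simp add: dist_norm)
      with ball have "w + u \<in> rotation_set f \<Phi>" ..
      then obtain \<nu> where \<nu>: "\<nu> \<in> invariant_measures f" "rotation_vector \<Phi> \<nu> = w + u"
        unfolding rotation_set_def by (metis imageE)
      have "0 \<le> ereal (h v n + v \<bullet> (R v n - rotation_vector (\<Phi>s n) \<nu>))"
        by (rule order_trans[OF metric_entropy_nonneg[OF \<nu>(1)] entropy_le[OF \<nu>(1)]])
      then have "0 \<le> h v n + v \<bullet> (R v n - rotation_vector (\<Phi>s n) \<nu>)"
        by (simp only: ereal_less_eq)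
      moreover have "- (norm v * \<epsilon> n) \<le> v \<bullet> (rotation_vector (\<Phi>s n) \<nu> - rotation_vector \<Phi> \<nu>)"
      proof -
        have "\<bar>v \<bullet> (rotation_vector (\<Phi>s n) \<nu> - rotation_vector \<Phi> \<nu>)\<bar> \<le>
            norm v * norm (rotation_vector (\<Phi>s n) \<nu> - rotation_vector \<Phi> \<nu>)"
          by (rule Cauchy_Schwarz_ineq2)
        also have "\<dots> \<le> norm v * \<epsilon> n"
          by (intro mult_left_mono rotation_vector_close[OF cpt cont' cont \<nu>(1) close]) simp
        finally show ?thesis by linarith
      qed
      moreover have "v \<bullet> u = r / 2 * norm v"
        using False by (simp add: u_def power2_norm_eq_inner[symmetric] power2_eq_square)
      moreover have "norm v * \<epsilon> n \<le> r / 4 * norm v"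
        using mult_right_mono[OF \<epsilon> norm_ge_zero[of v]] by (simp add: mult.commute)
      ultimately show ?thesis
        by (simp add: \<nu>(2) inner_diff_right inner_add_right)
    qed
  qed (use r in simp)
  then show ?thesis
    using order_trans[OF _ h_le_zero[where v = 0 and n = n and k = 0]] by blast
qed

text \<open>At a solution of \<open>R u n = w\<close> only \<open>\<epsilon> n\<close> remains of
  the error, and it is small against the bound \<open>4 * K / r\<close> on \<open>norm u\<close>.
  Both conditions are strict and continuous in \<open>v\<close>, hence they also hold at a point of
  the dense set. \<open>CARD('m)\<close> bounds the sum of absolute values by the norm.\<close>

lemma good_parameters_exist:
  assumes conth: "\<And>n. continuous_on UNIV (\<lambda>v. h v n)" and contR: "\<And>n. continuous_on UNIV (\<lambda>v. R v n)"
    and ball: "ball w r \<subseteq> rotation_set f \<Phi>" and r: "0 < r" and \<delta>: "0 < \<delta>"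
    and dense: "closure V = UNIV"
  shows "\<exists>n. \<exists>v\<in>V. ((\<Sum>j\<in>UNIV. \<bar>R v n $ j - w $ j\<bar>) + \<epsilon> n) * h v n < \<delta> * r \<and>
    (\<Sum>j\<in>UNIV. \<bar>v $ j\<bar>) * ((\<Sum>j\<in>UNIV. \<bar>R v n $ j - w $ j\<bar>) + \<epsilon> n) < \<delta>"
proof -
  define K where "K = h 0 0"
  have lim: "\<epsilon> \<longlonglongrightarrow> 0"
    using approx by (simp add: approximating_sequence_def)
  have "(\<lambda>n. \<epsilon> n * K) \<longlonglongrightarrow> 0 * K" "(\<lambda>n. real CARD('m) * (4 * K / r) * \<epsilon> n) \<longlonglongrightarrow> real CARD('m) * (4 * K / r) * 0"
    by (intro tendsto_intros lim)+
  then have "\<forall>\<^sub>F n in sequentially. \<epsilon> n < r / 4 \<and> \<epsilon> n * K < \<delta> * r \<and> real CARD('m) * (4 * K / r) * \<epsilon> n < \<delta>"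
    using r \<delta> by (intro eventually_conj order_tendstoD(2)[OF lim] order_tendstoD(2)) auto
  then obtain n where n: "\<epsilon> n < r / 4" "\<epsilon> n * K < \<delta> * r" "real CARD('m) * (4 * K / r) * \<epsilon> n < \<delta>"
    by (auto simp: eventually_sequentially)
  obtain u where u: "R u n = w" "r / 4 * norm u \<le> K"
    using good_direction_exists[OF conth contR ball r, of n] n(1) unfolding K_def by auto
  let ?D = "\<lambda>v. (\<Sum>j\<in>UNIV. \<bar>R v n $ j - w $ j\<bar>) + \<epsilon> n"
  let ?U = "{v. ?D v * h v n < \<delta> * r} \<inter> {v. (\<Sum>j\<in>UNIV. \<bar>v $ j\<bar>) * ?D v < \<delta>}"
  have "open ?U"
    by (intro open_Int open_Collect_less continuous_intros conth contR)
  moreover have "u \<in> ?U"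
  proof -
    have "\<epsilon> n * h u n \<le> \<epsilon> n * K"
      unfolding K_def by (intro mult_left_mono h_le_zero eps_nonneg)
    moreover have "(\<Sum>j\<in>UNIV. \<bar>u $ j\<bar>) \<le> (\<Sum>j\<in>(UNIV :: 'm set). norm u)"
      by (intro sum_mono component_le_norm_cart)
    moreover have "norm u \<le> 4 * K / r"
      using u(2) r by (simp add: field_simps)
    ultimately have "\<epsilon> n * h u n < \<delta> * r" "(\<Sum>j\<in>UNIV. \<bar>u $ j\<bar>) \<le> real CARD('m) * (4 * K / r)"
      using n(2) mult_left_mono[of "norm u" "4 * K / r" "real CARD('m)"] by auto
    moreover have "(\<Sum>j\<in>UNIV. \<bar>u $ j\<bar>) * \<epsilon> n \<le> real CARD('m) * (4 * K / r) * \<epsilon> n"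
      using calculation(2) eps_nonneg by (rule mult_right_mono)
    ultimately show ?thesis
      using n(3) by (simp add: u(1))
  qed
  moreover have "u \<in> closure V" by (simp add: dense)
  ultimately have "?U \<inter> V \<noteq> {}"
    using open_Int_closure_eq_empty by blast
  then show ?thesis by blast
qed

end

section \<open>The search for an approximation of the localized entropy\<close>

lemma oracle_for_constant: "oracle_for s (s i) (\<lambda>_. i)"
  by (simp add: oracle_for_def)

lemma oracle_for_unique:
  assumes "oracle_for s x \<phi>" "oracle_for s y \<phi>"
  shows "x = y"
proof (rule ccontr)
  assume "x \<noteq> y"
  then obtain n where n: "(1/2) ^ n < dist x y / 2"
    using real_arch_pow_inv[of "dist x y / 2" "1/2"] by auto
  have "dist x (s (\<phi> n)) < (1/2) ^ n" "dist y (s (\<phi> n)) < (1/2) ^ n"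
    using assms by (simp_all add: oracle_for_def)
  with n dist_triangle2[of x y "s (\<phi> n)"] show False by linarith
qed

lemma tendsto_half_power:
  fixes X :: "nat \<Rightarrow> 'a::metric_space"
  assumes "\<And>p. dist (X p) x < (1/2) ^ p"
  shows "X \<longlonglongrightarrow> x"
proof (rule metric_tendsto_imp_tendsto)
  show "(\<lambda>p. (1/2) ^ p :: real) \<longlonglongrightarrow> 0"
    by (rule LIMSEQ_power_zero) simp
  show "\<forall>\<^sub>F p in sequentially. dist (X p) x \<le> dist ((1/2) ^ p) (0::real)"
    using assms by (intro always_eventually) (simp add: dist_real_def less_imp_le)
qed

lemma approximates_output:
  assumes "approximates M \<phi>s ns t y"
  shows "\<exists>i. machine_output M \<phi>s (ns @ [k]) i \<and> dist (t i) y < (1/2) ^ k"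
  using assms unfolding approximates_def by blast

theorem theorem4p10:
  fixes s :: "nat \<Rightarrow> 'a::metric_space"
    and f :: "'a \<Rightarrow> 'a"
    and \<Phi> :: "'a \<Rightarrow> real ^ 'm::finite"
    and r :: "real ^ 'm \<Rightarrow> real"
    and \<epsilon> :: "nat \<Rightarrow> real"
    and \<Phi>s :: "nat \<Rightarrow> 'a \<Rightarrow> real ^ 'm"
    and h :: "real ^ 'm \<Rightarrow> nat \<Rightarrow> real"
  assumes "compact (UNIV :: 'a set)"
    and "computable_metric_space s"
    and "computable_metric s"
    and "computable_on s s UNIV f"
    and "topological_entropy f < \<infinity>"
    and "upper_semicontinuous_map (weak_star_topology f) (metric_entropy f)"
    and "computable_on s rat_vec_enum UNIV \<Phi>"
    and "computable_on rat_vec_enum rat_enum (interior (rotation_set f \<Phi>)) r"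
    and "\<forall>w\<in>interior (rotation_set f \<Phi>). r w > 0 \<and> ball w (r w) \<subseteq> rotation_set f \<Phi>"
    and "approximating_sequence \<Phi> \<epsilon> \<Phi>s"
    and "\<forall>n v. \<exists>!\<mu>. equilibrium_state f (\<lambda>x. v \<bullet> \<Phi>s n x) \<mu>"
    and "computable_sequence rat_enum \<epsilon>"
    and "\<forall>n v. metric_entropy f (the_equilibrium_state f (\<lambda>x. v \<bullet> \<Phi>s n x)) = ereal (h v n)"
    and "computable_function_sequence rat_vec_enum rat_enum h"
    and "computable_function_sequence rat_vec_enum rat_vec_enum
           (\<lambda>v n. rotation_vector (\<Phi>s n) (the_equilibrium_state f (\<lambda>x. v \<bullet> \<Phi>s n x)))"
  shows "\<exists>H :: real ^ 'm \<Rightarrow> real.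
           (\<forall>w\<in>interior (rotation_set f \<Phi>). localized_entropy f \<Phi> w = ereal (H w)) \<and>
           computable_on rat_vec_enum rat_enum (interior (rotation_set f \<Phi>)) H"
proof -
  define m where "m v n = the_equilibrium_state f (\<lambda>x. v \<bullet> \<Phi>s n x)" for v n
  define R where "R v n = rotation_vector (\<Phi>s n) (m v n)" for v n
  let ?S = "interior (rotation_set f \<Phi>)"
  have dense_s: "closure (range s) = UNIV"
    using assms(2) by (simp add: computable_metric_space_def)
  \<comment> \<open>The measurability of \<open>f\<close>, on which itineraries and mixtures rest,
    is drawn from its computability by way of continuity.\<close>
  have "continuous_on UNIV f"
    using assms(4) unfolding computable_on_def by (blast intro: continuous_on_approximates[OF dense_s])
  then have f: "f \<in> borel_measurable borel"
    by (rule borel_measurable_continuous_onI)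
  have cont: "continuous_on UNIV \<Phi>"
    using assms(7) unfolding computable_on_def by (blast intro: continuous_on_approximates[OF dense_s])
  interpret approximate_potentials f \<Phi> \<epsilon> \<Phi>s m h
    rewrites "\<And>v n. rotation_vector (\<Phi>s n) (m v n) = R v n"
  proof -
    show "approximate_potentials f \<Phi> \<epsilon> \<Phi>s m h"
    proof
      show "equilibrium_state f (\<lambda>x. v \<bullet> \<Phi>s n x) (m v n)" for v n
        unfolding m_def the_equilibrium_state_def using assms(11) by (metis (no_types) theI')
      show "metric_entropy f (m v n) = ereal (h v n)" for v n
        unfolding m_def using assms(13) by simp
    qed (fact assms(1) cont f assms(10))+
  qed (simp add: R_def)
  obtain Mr where Mr: "\<And>w \<phi>. w \<in> ?S \<Longrightarrow> oracle_for rat_vec_enum w \<phi> \<Longrightarrow> approximates Mr [\<phi>] [] rat_enum (r w)"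
    using assms(8) unfolding computable_on_def by blast
  obtain Me where Me: "\<And>n. approximates Me [] [n] rat_enum (\<epsilon> n)"
    using assms(12) unfolding computable_sequence_def by blast
  obtain Mh where Mh: "\<And>v n \<phi>. oracle_for rat_vec_enum v \<phi> \<Longrightarrow> approximates Mh [\<phi>] [n] rat_enum (h v n)"
    using assms(14) unfolding computable_function_sequence_def by blast
  obtain MR where MR: "\<And>v n \<phi>. oracle_for rat_vec_enum v \<phi> \<Longrightarrow> approximates MR [\<phi>] [n] rat_vec_enum (R v n)"
    using assms(15) unfolding computable_function_sequence_def R_def m_def by blast
  have conth: "continuous_on UNIV (\<lambda>v. h v n)" for n
    using Mh by (rule continuous_on_approximates[OF dense_rat_vec_enum])
  have contR: "continuous_on UNIV (\<lambda>v. R v n)" for n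
    using MR by (rule continuous_on_approximates[OF dense_rat_vec_enum])
  \<comment> \<open>The oracles on which the program has to halt with a correct result.\<close>
  define D where "D = {\<phi>. \<exists>w\<in>?S. oracle_for rat_vec_enum w \<phi>}"
  define H where "H w = real_of_ereal (localized_entropy f \<Phi> w)" for w
  have H: "localized_entropy f \<Phi> w = ereal (H w)" if "w \<in> ?S" for w
    using localized_entropy_finite[of w] that interior_subset by (force simp: H_def)
  \<comment> \<open>The output depends on the oracle and not only on the point, so \<open>xr\<close>
    is made a function of \<open>\<phi>\<close>. An oracle determines its point, hence one output
    serves every \<open>w\<close> in the statement.\<close>
  have "\<exists>x. machine_output Mr [\<phi>] [p] x \<and> (\<forall>w\<in>?S. oracle_for rat_vec_enum w \<phi> \<longrightarrow> dist (rat_enum x) (r w) < (1/2) ^ p)"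
    if "\<phi> \<in> D" for \<phi> p
  proof -
    from that obtain w where w: "w \<in> ?S" "oracle_for rat_vec_enum w \<phi>" by (auto simp: D_def)
    from approximates_output[OF Mr[OF this], of p]
    obtain x where "machine_output Mr [\<phi>] [p] x" "dist (rat_enum x) (r w) < (1/2) ^ p"
      by auto
    then show ?thesis
      using oracle_for_unique[OF w(2)] by auto
  qed
  then obtain xr where "\<And>\<phi> p. \<phi> \<in> D \<Longrightarrow> machine_output Mr [\<phi>] [p] (xr \<phi> p) \<and>
      (\<forall>w\<in>?S. oracle_for rat_vec_enum w \<phi> \<longrightarrow> dist (rat_enum (xr \<phi> p)) (r w) < (1/2) ^ p)"
    by metis
  then have xr: "\<And>\<phi> p. \<phi> \<in> D \<Longrightarrow> machine_output Mr [\<phi>] [p] (xr \<phi> p)"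
    "\<And>\<phi> p w. w \<in> ?S \<Longrightarrow> oracle_for rat_vec_enum w \<phi> \<Longrightarrow> dist (rat_enum (xr \<phi> p)) (r w) < (1/2) ^ p"
    unfolding D_def by blast+
  define xe where "xe n p = (SOME x. machine_output Me [] [n, p] x \<and> dist (rat_enum x) (\<epsilon> n) < (1/2) ^ p)" for n p
  have "\<exists>x. machine_output Me [] [n, p] x \<and> dist (rat_enum x) (\<epsilon> n) < (1/2) ^ p" for n p
    using approximates_output[OF Me[of n], of p] by simp
  from someI_ex[OF this, folded xe_def] have xe: "\<And>n p. machine_output Me [] [n, p] (xe n p)"
    "\<And>n p. dist (rat_enum (xe n p)) (\<epsilon> n) < (1/2) ^ p"
    by blast+
  define xh where "xh n p i = (SOME x. machine_output Mh [\<lambda>_. i] [n, p] x \<and> dist (rat_enum x) (h (rat_vec_enum i) n) < (1/2) ^ p)" for n p i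
  have "\<exists>x. machine_output Mh [\<lambda>_. i] [n, p] x \<and> dist (rat_enum x) (h (rat_vec_enum i) n) < (1/2) ^ p" for n p i
    using approximates_output[OF Mh[where n = n, OF oracle_for_constant[of _ i]], of p] by simp
  from someI_ex[OF this, folded xh_def] have xh: "\<And>n p i. machine_output Mh [\<lambda>_. i] [n, p] (xh n p i)"
    "\<And>n p i. dist (rat_enum (xh n p i)) (h (rat_vec_enum i) n) < (1/2) ^ p"
    by blast+
  define xR where "xR n p i = (SOME x. machine_output MR [\<lambda>_. i] [n, p] x \<and> dist (rat_vec_enum x) (R (rat_vec_enum i) n) < (1/2) ^ p)" for n p i
  have "\<exists>x. machine_output MR [\<lambda>_. i] [n, p] x \<and> dist (rat_vec_enum x) (R (rat_vec_enum i) n) < (1/2) ^ p" for n p i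
    using approximates_output[OF MR[where n = n, OF oracle_for_constant[of _ i]], of p] by simp
  from someI_ex[OF this, folded xR_def] have xR: "\<And>n p i. machine_output MR [\<lambda>_. i] [n, p] (xR n p i)"
    "\<And>n p i. dist (rat_vec_enum (xR n p i)) (R (rat_vec_enum i) n) < (1/2) ^ p"
    by blast+
  \<comment> \<open>The last summand makes \<open>err\<close> an upper bound of \<open>norm (R v n - w) + \<epsilon> n\<close>: three quantities are approximated.\<close>
  define err where "err \<phi> i n p =
      (\<Sum>j\<in>UNIV. \<bar>(rat_vec_enum (xR n p i) :: real ^ 'm) $ j - (rat_vec_enum (\<phi> p) :: real ^ 'm) $ j\<bar>) +
      rat_enum (xe n p) + 3 * (1/2) ^ p" for \<phi> i n p
  \<comment> \<open>The conditions of \<open>good_parameters_exist\<close> for computed rationals: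
    \<open>xr\<close> lowered by its error bounds \<open>r w\<close> from below, \<open>xh\<close>
    raised by its error bounds \<open>h\<close> from above. The precision is \<open>Suc k\<close>
    because two errors add up, that of \<open>h\<close> against \<open>H w\<close> and that of
    \<open>xh\<close> against \<open>h\<close>.\<close>
  define good where "good \<phi> k i n p \<longleftrightarrow>
      0 < rat_enum (xr \<phi> p) - (1/2) ^ p \<and>
      err \<phi> i n p * (rat_enum (xh n p i) + (1/2) ^ p) < (1/2) ^ Suc k * (rat_enum (xr \<phi> p) - (1/2) ^ p) \<and>
      (\<Sum>j\<in>UNIV. \<bar>(rat_vec_enum i :: real ^ 'm) $ j\<bar>) * err \<phi> i n p < (1/2) ^ Suc k \<and>
      (1/2) ^ p < ((1/2) ^ Suc k :: real)" for \<phi> k i n p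
  have sound: "dist (rat_enum (xh n p i)) (H w) < (1/2) ^ k"
    if w: "w \<in> ?S" and \<phi>: "oracle_for rat_vec_enum w \<phi>" and good: "good \<phi> k i n p" for w \<phi> k i n p
  proof -
    define q where "q = ((1/2) ^ p :: real)"
    define \<delta> where "\<delta> = ((1/2) ^ Suc k :: real)"
    define \<rho> where "\<rho> = rat_enum (xr \<phi> p) - q"
    define v where "v = (rat_vec_enum i :: real ^ 'm)"
    define W where "W = (\<Sum>j\<in>UNIV. \<bar>v $ j\<bar>)"
    define E where "E = err \<phi> i n p"
    define x where "x = rat_enum (xh n p i)"
    have x: "\<bar>x - h v n\<bar> < q"
      using xh(2)[of n p i] by (simp add: x_def v_def q_def dist_real_def)
    have g: "0 < \<rho>" "E * (x + q) < \<delta> * \<rho>" "W * E < \<delta>" "q < \<delta>"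
      using good unfolding good_def \<rho>_def E_def x_def W_def v_def q_def \<delta>_def by blast+
    have \<rho>: "\<rho> < r w"
      using xr(2)[OF w \<phi>, of p] by (simp add: \<rho>_def q_def dist_real_def)
    have E: "norm (R v n - w) + \<epsilon> n \<le> E"
    proof -
      let ?R = "rat_vec_enum (xR n p i) :: real ^ 'm" and ?w = "rat_vec_enum (\<phi> p) :: real ^ 'm"
      have "norm (R v n - w) \<le> dist (R v n) ?R + dist ?R ?w + dist ?w w"
        unfolding dist_norm[symmetric] using dist_triangle[of "R v n" w ?R] dist_triangle[of ?R w ?w] by linarith
      moreover have "dist (R v n) ?R < q"
        using xR(2)[of n p i] by (simp add: v_def q_def dist_commute)
      moreover have "dist ?w w < q"
        using \<phi> by (simp add: oracle_for_def q_def dist_commute)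
      moreover have "dist ?R ?w \<le> (\<Sum>j\<in>UNIV. \<bar>?R $ j - ?w $ j\<bar>)"
        unfolding dist_norm using norm_le_l1_cart[of "?R - ?w"] by simp
      moreover have "\<bar>rat_enum (xe n p) - \<epsilon> n\<bar> < q"
        using xe(2)[of n p] by (simp add: q_def dist_real_def)
      ultimately show ?thesis
        unfolding E_def err_def q_def[symmetric] by linarith
    qed
    have E0: "0 \<le> E"
      using E eps_nonneg[of n] norm_ge_zero[of "R v n - w"] by linarith
    have "norm v \<le> W"
      unfolding W_def by (rule norm_le_l1_cart)
    note enc = localized_entropy_enclosure[OF H[OF w] _ g(1) \<rho> E this]
    have ball: "ball w (r w) \<subseteq> rotation_set f \<Phi>"
      using assms(9) w by blast
    have "E * h v n \<le> E * (x + q)"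
      using x E0 by (intro mult_left_mono) linarith+
    then have "E * h v n / \<rho> < \<delta>"
      using g(1,2) by (simp add: divide_less_eq)
    with enc[OF ball] g(3) have "\<bar>h v n - H w\<bar> < \<delta>" by linarith
    with x g(4) have "\<bar>x - H w\<bar> < 2 * \<delta>" by linarith
    then show ?thesis
      by (simp add: x_def \<delta>_def dist_real_def)
  qed
  \<comment> \<open>With \<open>n\<close> and \<open>i\<close> fixed, all approximations converge as
    \<open>p\<close> grows, and strict inequalities between the limits hold for large
    \<open>p\<close>.\<close>
  have complete: "\<exists>i n p. good \<phi> k i n p" if "\<phi> \<in> D" for \<phi> k
  proof -
    from that obtain w where w: "w \<in> ?S" "oracle_for rat_vec_enum w \<phi>"
      unfolding D_def by blast
    define \<delta> where "\<delta> = ((1/2) ^ Suc k :: real)"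
    have \<delta>: "0 < \<delta>" by (simp add: \<delta>_def)
    have r: "0 < r w" "ball w (r w) \<subseteq> rotation_set f \<Phi>"
      using assms(9) w(1) by blast+
    obtain n i where gap: "((\<Sum>j\<in>UNIV. \<bar>R (rat_vec_enum i) n $ j - w $ j\<bar>) + \<epsilon> n) * h (rat_vec_enum i) n < \<delta> * r w"
      "(\<Sum>j\<in>UNIV. \<bar>(rat_vec_enum i :: real ^ 'm) $ j\<bar>) * ((\<Sum>j\<in>UNIV. \<bar>R (rat_vec_enum i) n $ j - w $ j\<bar>) + \<epsilon> n) < \<delta>"
      using good_parameters_exist[OF conth contR r(2,1) \<delta> dense_rat_vec_enum] by blast
    have q: "(\<lambda>p. (1/2) ^ p :: real) \<longlonglongrightarrow> 0"
      by (rule LIMSEQ_power_zero) simp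
    have lr: "(\<lambda>p. rat_enum (xr \<phi> p)) \<longlonglongrightarrow> r w"
      by (rule tendsto_half_power) (rule xr(2)[OF w])
    have lh: "(\<lambda>p. rat_enum (xh n p i)) \<longlonglongrightarrow> h (rat_vec_enum i) n"
      by (rule tendsto_half_power) (rule xh(2))
    have le: "(\<lambda>p. rat_enum (xe n p)) \<longlonglongrightarrow> \<epsilon> n"
      by (rule tendsto_half_power) (rule xe(2))
    have lR: "(\<lambda>p. rat_vec_enum (xR n p i)) \<longlonglongrightarrow> R (rat_vec_enum i) n"
      by (rule tendsto_half_power) (rule xR(2))
    have lw: "(\<lambda>p. rat_vec_enum (\<phi> p)) \<longlonglongrightarrow> w"
      by (rule tendsto_half_power) (use w(2) in \<open>simp add: oracle_for_def dist_commute\<close>)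
    have lerr: "(\<lambda>p. err \<phi> i n p) \<longlonglongrightarrow> (\<Sum>j\<in>UNIV. \<bar>R (rat_vec_enum i) n $ j - w $ j\<bar>) + \<epsilon> n + 3 * 0"
      unfolding err_def by (intro tendsto_intros lR lw le q)
    have "\<forall>\<^sub>F p in sequentially. 0 < rat_enum (xr \<phi> p) - (1/2) ^ p"
      by (rule order_tendstoD(1)[OF tendsto_diff[OF lr q]]) (use r in simp)
    moreover have "\<forall>\<^sub>F p in sequentially. 0 < \<delta> * (rat_enum (xr \<phi> p) - (1/2) ^ p) - err \<phi> i n p * (rat_enum (xh n p i) + (1/2) ^ p)"
      by (rule order_tendstoD(1)[OF tendsto_diff[OF tendsto_mult_left[OF tendsto_diff[OF lr q]] tendsto_mult[OF lerr tendsto_add[OF lh q]]]])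
        (use gap in simp)
    moreover have "\<forall>\<^sub>F p in sequentially. (\<Sum>j\<in>UNIV. \<bar>(rat_vec_enum i :: real ^ 'm) $ j\<bar>) * err \<phi> i n p < \<delta>"
      by (rule order_tendstoD(2)[OF tendsto_mult_left[OF lerr]]) (use gap in simp)
    moreover have "\<forall>\<^sub>F p in sequentially. (1/2) ^ p < \<delta>"
      by (rule order_tendstoD(2)[OF q \<delta>])
    ultimately have "\<forall>\<^sub>F p in sequentially. good \<phi> k i n p"
      by eventually_elim (simp add: good_def \<delta>_def)
    then obtain p where "good \<phi> k i n p"
      by (auto simp: eventually_sequentially)
    then show ?thesis by blast
  qed
  have eff_xr: "effective D (\<lambda>\<phi> \<rho>. xr \<phi> (A \<phi> \<rho>))" if "effective D A" for A
  proof -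
    have "effective D (\<lambda>\<phi> \<rho>. xr \<phi> (\<rho> 0))"
      by (rule effective_machine[where M = Mr and k = 1]) (simp add: xr(1))
    then show ?thesis using that by (rule effective_subst1)
  qed
  have eff_xe: "effective D (\<lambda>\<phi> \<rho>. xe (A \<phi> \<rho>) (B \<phi> \<rho>))" if "effective D A" "effective D B" for A B
  proof -
    have "effective D (\<lambda>\<phi> \<rho>. xe (\<rho> 0) (\<rho> 1))"
      by (rule effective_machine_without_oracle[where M = Me and k = 2]) (simp add: xe(1) upt_rec)
    then show ?thesis using that by (rule effective_subst2[where F = "\<lambda>\<phi>. xe"])
  qed
  have eff_xh: "effective D (\<lambda>\<phi> \<rho>. xh (A \<phi> \<rho>) (B \<phi> \<rho>) (C \<phi> \<rho>))"
    if "effective D A" "effective D B" "effective D C" for A B C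
  proof -
    \<comment> \<open>Registers 0 and 1 are the exact inputs \<open>n\<close> and \<open>p\<close>;
      register 2, the code of the rational vector, answers every query.\<close>
    have "effective D (\<lambda>\<phi> \<rho>. xh (\<rho> 0) (\<rho> 1) (\<rho> 2))"
      by (rule effective_machine_constant_oracle[where M = Mh and k = 2 and n = 2]) (simp add: xh(1) upt_rec)
    then show ?thesis using that by (rule effective_subst3[where F = "\<lambda>\<phi>. xh"])
  qed
  have eff_xR: "effective D (\<lambda>\<phi> \<rho>. xR (A \<phi> \<rho>) (B \<phi> \<rho>) (C \<phi> \<rho>))"
    if "effective D A" "effective D B" "effective D C" for A B C
  proof -
    have "effective D (\<lambda>\<phi> \<rho>. xR (\<rho> 0) (\<rho> 1) (\<rho> 2))"
      by (rule effective_machine_constant_oracle[where M = MR and k = 2 and n = 2]) (simp add: xR(1) upt_rec)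
    then show ?thesis using that by (rule effective_subst3[where F = "\<lambda>\<phi>. xR"])
  qed
  have dec: "decidable D (\<lambda>\<phi> \<rho>. good \<phi> (K \<phi> \<rho>) (I \<phi> \<rho>) (N \<phi> \<rho>) (P \<phi> \<rho>))"
    if K: "effective D K" and I: "effective D I" and N: "effective D N" and P: "effective D P" for K I N P
    unfolding good_def err_def
    by (intro decidable_conj decidable_real_less effective_real_intros effective_real_sum finite
        effective_real_rat_vec_enum effective_real_rat_enum effective_oracle effective_Suc
        eff_xr eff_xe eff_xh eff_xR K I N P)
  \<comment> \<open>Unbounded search runs over a single number, so the triple of parameters is coded
    by nested pairs.\<close>
  define I where "I c = fst (prod_decode c)" for c
  define N where "N c = fst (prod_decode (snd (prod_decode c)))" for c
  define P where "P c = snd (prod_decode (snd (prod_decode c)))" for c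
  have eff: "effective D (\<lambda>\<phi> \<rho>. I (C \<phi> \<rho>))" "effective D (\<lambda>\<phi> \<rho>. N (C \<phi> \<rho>))" "effective D (\<lambda>\<phi> \<rho>. P (C \<phi> \<rho>))"
    if "effective D C" for C
    unfolding I_def N_def P_def by (intro effective_prod_decode that)+
  have ex: "\<exists>c. good \<phi> k (I c) (N c) (P c)" if \<phi>: "\<phi> \<in> D" for \<phi> k
  proof -
    obtain i n p where "good \<phi> k i n p" using complete[OF \<phi>] by blast
    then have "good \<phi> k (I c) (N c) (P c)" if "c = prod_encode (i, prod_encode (n, p))" for c
      by (simp add: I_def N_def P_def that)
    then show ?thesis by blast
  qed
  define C where "C \<phi> k = (LEAST c. good \<phi> k (I c) (N c) (P c))" for \<phi> k
  have C: "good \<phi> k (I (C \<phi> k)) (N (C \<phi> k)) (P (C \<phi> k))" if "\<phi> \<in> D" for \<phi> k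
    unfolding C_def by (rule LeastI_ex) (rule ex[OF that])
  have "effective D (\<lambda>\<phi> \<rho>. C \<phi> (\<rho> 0))"
    unfolding C_def by (rule effective_Least_decidable) (intro dec eff effective_var, rule ex)
  then have "effective D (\<lambda>\<phi> \<rho>. xh (N (C \<phi> (\<rho> 0))) (P (C \<phi> (\<rho> 0))) (I (C \<phi> (\<rho> 0))))"
    by (intro eff_xh eff)
  then obtain M where M: "\<And>\<phi> k. \<phi> \<in> D \<Longrightarrow> machine_output M [\<phi>] [k] (xh (N (C \<phi> k)) (P (C \<phi> k)) (I (C \<phi> k)))"
    by (rule machine_of_effective[where E = "\<lambda>\<phi> k. xh (N (C \<phi> k)) (P (C \<phi> k)) (I (C \<phi> k))"]) blast
  have "approximates M [\<phi>] [] rat_enum (H w)" if w: "w \<in> ?S" "oracle_for rat_vec_enum w \<phi>" for w \<phi>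
    unfolding approximates_def
  proof
    fix k
    have "\<phi> \<in> D" using w by (auto simp: D_def)
    from M[OF this, of k] sound[OF w C[OF this]]
    show "\<exists>i. machine_output M [\<phi>] ([] @ [k]) i \<and> dist (rat_enum i) (H w) < (1/2) ^ k"
      by auto
  qed
  then have "computable_on rat_vec_enum rat_enum ?S H"
    unfolding computable_on_def by blast
  with H show ?thesis by blast
qed

end
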